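(* Let $p$ be an odd prime and $\mathcal{F}$ a saturated fusion system on a finite $p$-group $S$. Assume that there exists a subgroup $D$ of $S$ with $1<|D|<|S|$ such that every subgroup of $S$ of order $|D|$ is abelian and semi-invariant in $\mathcal{F}$. Then $\mathcal{F}$ is supersolvable.
   Context: Let $\mathcal{F}$ be a fusion system on a finite $p$-group $S$. Semi-invariant: a subgroup $H\le S$ is semi-invariant in $\mathcal{F}$ if for every subgroup $K$ with $H\le K\le S$ and every $\alpha\in\mathrm{Aut}_{\mathcal{F}}(K)$ one has $H^{\alpha}=H$. Supersolvable: a saturated fusion system $\mathcal{F}$ on $S$ is supersolvable if there is a series of subgroups $1=S_0\le S_1\le\cdots\le S_n=S$ such that each $S_i$ ($0\le i\le n$) is strongly $\mathcal{F}$-closed and $S_{i+1}/S_i$ is cyclic for $0\le i\le n-1$. (A subgroup $T\le S$ is strongly $\mathcal{F}$-closed if for every $P\le T$ and every morphism $\phi\in\mathrm{Hom}_{\mathcal{F}}(P,S)$ one has $P^{\phi}\le T$.) *)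

theory Defs
  imports "HOL-Algebra.Algebra"
begin

definition centralizer :: "('a, 'b) monoid_scheme \<Rightarrow> 'a set \<Rightarrow> 'a set" where
  "centralizer G P = {g \<in> carrier G. \<forall>x\<in>P. g \<otimes>\<^bsub>G\<^esub> x = x \<otimes>\<^bsub>G\<^esub> g}"

definition sylow_subgroup :: "nat \<Rightarrow> 'a set \<Rightarrow> ('a, 'b) monoid_scheme \<Rightarrow> bool" where
  "sylow_subgroup p H G \<longleftrightarrow> subgroup H G \<and> card H = p ^ multiplicity p (order G)"

text \<open>Morphisms between subgroups are functions that are extensional on their domain, so that
  a morphism from \<open>P\<close> is determined by its values on \<open>P\<close>. Functions are applied on the left,
  so \<open>\<phi> ` P\<close> is the image often written \<open>P^\<phi>\<close>.\<close>

definition conj_map :: "('a, 'b) monoid_scheme \<Rightarrow> 'a set \<Rightarrow> 'a \<Rightarrow> 'a \<Rightarrow> 'a" where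
  "conj_map S P g = (\<lambda>x\<in>P. g \<otimes>\<^bsub>S\<^esub> x \<otimes>\<^bsub>S\<^esub> inv\<^bsub>S\<^esub> g)"

text \<open>\<open>Hom_S(P,Q)\<close>; for a finite subgroup \<open>P\<close>, the set \<open>conj_homs S P P\<close> is \<open>Aut_S(P)\<close>.\<close>

definition conj_homs :: "('a, 'b) monoid_scheme \<Rightarrow> 'a set \<Rightarrow> 'a set \<Rightarrow> ('a \<Rightarrow> 'a) set" where
  "conj_homs S P Q = {conj_map S P g | g. g \<in> carrier S \<and> conj_map S P g ` P \<subseteq> Q}"

text \<open>A fusion system on the finite \<open>p\<close>-group \<open>S\<close>: \<open>F P Q\<close> is \<open>Hom_F(P,Q)\<close>. Only its values at
  subgroups \<open>P\<close>, \<open>Q\<close> of \<open>S\<close> matter. The last axiom says that every morphism is an isomorphism of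
  the category followed by an inclusion. Identities and inclusions are the morphisms
  \<open>conj_map S P \<one>\<close>.\<close>

locale fusion_system = group S for S (structure) +
  fixes p :: nat and F :: "'a set \<Rightarrow> 'a set \<Rightarrow> ('a \<Rightarrow> 'a) set"
  assumes prime_p: "Factorial_Ring.prime p"
    and p_group: "\<exists>n. order S = p ^ n"
    and conj_homs_subset:
      "\<lbrakk>subgroup P S; subgroup Q S\<rbrakk> \<Longrightarrow> conj_homs S P Q \<subseteq> F P Q"
    and subset_mon:
      "\<lbrakk>subgroup P S; subgroup Q S\<rbrakk> \<Longrightarrow>
        F P Q \<subseteq> mon (S\<lparr>carrier := P\<rparr>) (S\<lparr>carrier := Q\<rparr>) \<inter> extensional P"
    and compose_closed:
      "\<lbrakk>subgroup P S; subgroup Q S; subgroup R S; \<phi> \<in> F P Q; \<psi> \<in> F Q R\<rbrakk> \<Longrightarrow>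
        compose P \<psi> \<phi> \<in> F P R"
    and iso_onto_image:
      "\<lbrakk>subgroup P S; subgroup Q S; \<phi> \<in> F P Q\<rbrakk> \<Longrightarrow>
        \<phi> \<in> F P (\<phi> ` P) \<and> (\<lambda>y\<in>\<phi> ` P. inv_into P \<phi> y) \<in> F (\<phi> ` P) P"

definition fusion_conjugate ::
    "('a, 'b) monoid_scheme \<Rightarrow> ('a set \<Rightarrow> 'a set \<Rightarrow> ('a \<Rightarrow> 'a) set) \<Rightarrow> 'a set \<Rightarrow> 'a set \<Rightarrow> bool" where
  "fusion_conjugate S F P Q \<longleftrightarrow>
     subgroup P S \<and> subgroup Q S \<and> (\<exists>\<phi>\<in>F P Q. \<phi> ` P = Q)"

definition fully_normalized ::
    "('a, 'b) monoid_scheme \<Rightarrow> ('a set \<Rightarrow> 'a set \<Rightarrow> ('a \<Rightarrow> 'a) set) \<Rightarrow> 'a set \<Rightarrow> bool" where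
  "fully_normalized S F P \<longleftrightarrow> subgroup P S \<and>
     (\<forall>Q. fusion_conjugate S F P Q \<longrightarrow> card (normalizer S Q) \<le> card (normalizer S P))"

definition fully_centralized ::
    "('a, 'b) monoid_scheme \<Rightarrow> ('a set \<Rightarrow> 'a set \<Rightarrow> ('a \<Rightarrow> 'a) set) \<Rightarrow> 'a set \<Rightarrow> bool" where
  "fully_centralized S F P \<longleftrightarrow> subgroup P S \<and>
     (\<forall>Q. fusion_conjugate S F P Q \<longrightarrow> card (centralizer S Q) \<le> card (centralizer S P))"

definition aut_group :: "('a set \<Rightarrow> 'a set \<Rightarrow> ('a \<Rightarrow> 'a) set) \<Rightarrow> 'a set \<Rightarrow> ('a \<Rightarrow> 'a) monoid" where
  "aut_group F P = BijGroup P\<lparr>carrier := F P P\<rparr>"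

text \<open>\<open>N_\<phi>\<close>: the elements \<open>g\<close> of \<open>N_S(P)\<close> such that \<open>\<phi> c_g \<phi>^{-1}\<close> lies in \<open>Aut_S(\<phi>(P))\<close>.\<close>

definition extension_domain :: "('a, 'b) monoid_scheme \<Rightarrow> 'a set \<Rightarrow> ('a \<Rightarrow> 'a) \<Rightarrow> 'a set" where
  "extension_domain S P \<phi> = {g \<in> normalizer S P.
     (\<lambda>y\<in>\<phi> ` P. \<phi> (conj_map S P g (inv_into P \<phi> y))) \<in> conj_homs S (\<phi> ` P) (\<phi> ` P)}"

text \<open>Saturation in the sense of Broto, Levi and Oliver.\<close>

locale saturated_fusion_system = fusion_system +
  assumes fully_normalized_imp:
      "fully_normalized S F P \<Longrightarrow>
        fully_centralized S F P \<and> sylow_subgroup p (conj_homs S P P) (aut_group F P)"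
    and extension:
      "\<lbrakk>subgroup P S; \<phi> \<in> F P (carrier S); fully_centralized S F (\<phi> ` P)\<rbrakk> \<Longrightarrow>
        \<exists>\<psi>\<in>F (extension_domain S P \<phi>) (carrier S). \<forall>x\<in>P. \<psi> x = \<phi> x"

definition semi_invariant ::
    "('a, 'b) monoid_scheme \<Rightarrow> ('a set \<Rightarrow> 'a set \<Rightarrow> ('a \<Rightarrow> 'a) set) \<Rightarrow> 'a set \<Rightarrow> bool" where
  "semi_invariant S F H \<longleftrightarrow> subgroup H S \<and>
     (\<forall>K. subgroup K S \<and> H \<subseteq> K \<longrightarrow> (\<forall>\<alpha>\<in>F K K. \<alpha> ` H = H))"

definition strongly_closed ::
    "('a, 'b) monoid_scheme \<Rightarrow> ('a set \<Rightarrow> 'a set \<Rightarrow> ('a \<Rightarrow> 'a) set) \<Rightarrow> 'a set \<Rightarrow> bool" where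
  "strongly_closed S F T \<longleftrightarrow> subgroup T S \<and>
     (\<forall>P. subgroup P S \<and> P \<subseteq> T \<longrightarrow> (\<forall>\<phi>\<in>F P (carrier S). \<phi> ` P \<subseteq> T))"

text \<open>The quotients below are genuine groups: a strongly closed subgroup is normal in \<open>S\<close>,
  because conjugations belong to the fusion system.\<close>

definition supersolvable ::
    "('a, 'b) monoid_scheme \<Rightarrow> ('a set \<Rightarrow> 'a set \<Rightarrow> ('a \<Rightarrow> 'a) set) \<Rightarrow> bool" where
  "supersolvable S F \<longleftrightarrow> (\<exists>(n :: nat) (T :: nat \<Rightarrow> 'a set).
     T 0 = {\<one>\<^bsub>S\<^esub>} \<and> T n = carrier S \<and>
     (\<forall>i\<le>n. strongly_closed S F (T i)) \<and>
     (\<forall>i<n. T i \<subseteq> T (Suc i) \<and> cyclic_group (S\<lparr>carrier := T (Suc i)\<rparr> Mod T i)))"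

end

(* Write |D| = p^d and fix P <= S with |P| > p^d. If P is not cyclic, it contains a noncyclic subgroup
   Q of order p^(d+1); otherwise let Q = P. Aut_F(P) leaves all maximal subgroups M of Q invariant,
   hence acts on each Q/M by scalars, and an element of prime order q <> p acting trivially on Q/Phi(Q)
   is trivial: it is trivial on Q, then on all elements of order p of P, then on P since p is odd. Thus
   the automorphisms acting trivially on Q/Phi(Q) are the p-elements of Aut_F(P); they form a normal
   Sylow subgroup, equal to Aut_S(P) when P is fully normalized.

   If |P| < p^d, then P is properly contained in an abelian subgroup of S. If |P| = p^d and P is
   self-centralizing, an element x of order p modulo P acts on P as a transvection, and invariance of the
   maximal subgroups of P<x> shows that no automorphism of P in F commutes with x and inverts P modulo C_P(x). Hence two such
   transvections never generate a copy of SL(2, p), which yields a nontrivial normal p-subgroup of Aut_F(P).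
   In all cases a morphism P -> S with P < S and fully normalized image extends to a larger subgroup of S,
   so every morphism of F extends to an automorphism of S.

   Finally Aut_F(S) is abelian of exponent dividing p - 1 modulo inner automorphisms, so an invariant
   subgroup T < S can be enlarged by a common eigenvector of Aut_F(S) in the socle of S/T; invariant subgroups
   are strongly closed. *)

theory Submission
  imports Defs "HOL-Number_Theory.Number_Theory"
begin

section \<open>Finite \<open>p\<close>-groups\<close>

text \<open>The delicate order is |P| = |D|. There semi-invariance says nothing about proper
  subgroups of P, so at first Aut_F(P) could contain a copy of SL(2, p), whose Sylow p-subgroups
  meet trivially, and a morphism might not extend at all. The remedy is a nontrivial normal
  p-subgroup N of the automizer of the image: it lies in every Sylow p-subgroup, hence both in Aut_S
  of the image and in the group transported from Aut_S(P), and a nontrivial element of N yields an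
  element outside P to which the morphism extends. N is built from the transvections. Since no two
  of them are opposite, failing to fix displacements gives a strict order on their fixed subgroups.
  An extremal one, a sink, fixes the displacements of all others, and N acts trivially on Z and P/Z,
  where Z consists of the common fixed points of all sinks. Oddness of p means -1 /= 1 here, and p
  dividing p(p - 1)/2 in the power formula for class two. The exponent p - 1 at the end gives
  eigenvectors because x^(p - 1) - 1 splits into distinct linear factors over the field with p
  elements.\<close>

lemma (in group_action) p_group_card_non_fixed:
  fixes p :: nat
  assumes p: "Factorial_Ring.prime p" and ord: "order G = p ^ n" and fin: "finite E"
  shows "p dvd card {x \<in> E. \<exists>g\<in>carrier G. \<phi> g x \<noteq> x}"
proof -
  let ?N = "{x \<in> E. \<exists>g\<in>carrier G. \<phi> g x \<noteq> x}"
  let ?C = "{orb \<in> orbits G E \<phi>. orb \<inter> ?N \<noteq> {}}"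
  interpret group G using group_hom group_hom.axioms(1) by auto
  have memE: "y \<in> E" if "y \<in> orbit G \<phi> x" "x \<in> E" for x y
    using that element_image by (auto simp: orbit_def)
  have orbN: "orbit G \<phi> x \<subseteq> ?N" if x: "x \<in> ?N" for x
  proof
    fix y assume y: "y \<in> orbit G \<phi> x"
    have yE: "y \<in> E" using memE y x by auto
    show "y \<in> ?N"
    proof (rule ccontr)
      assume "y \<notin> ?N"
      then have fx: "\<And>g. g \<in> carrier G \<Longrightarrow> \<phi> g y = y" using yE by blast
      have "x \<in> orbit G \<phi> y" using orbit_sym x y yE by auto
      then have "x = y" using fx by (auto simp: orbit_def)
      with fx x show False by auto
    qed
  qed
  have eq: "?N = \<Union>?C"
  proof
    show "?N \<subseteq> \<Union>?C"
    proof
      fix x assume x: "x \<in> ?N"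
      then have "x \<in> orbit G \<phi> x" "orbit G \<phi> x \<in> orbits G E \<phi>"
        using orbit_refl by (auto simp: orbits_def)
      with x show "x \<in> \<Union>?C" by blast
    qed
    show "\<Union>?C \<subseteq> ?N"
    proof
      fix y assume "y \<in> \<Union>?C"
      then obtain x z where xz: "x \<in> E" "z \<in> orbit G \<phi> x" "z \<in> ?N" "y \<in> orbit G \<phi> x"
        by (auto simp: orbits_def)
      have "y \<in> orbit G \<phi> z"
        using xz memE orbit_sym orbit_trans by (metis (no_types, lifting))
      then show "y \<in> ?N" using orbN xz by blast
    qed
  qed
  have finC: "finite ?C"
    using fin by (auto simp: orbits_def)
  \<comment> \<open>By orbit-stabilizer the orbit has \<open>p\<close>-power length, and length 1
    would make its point fixed.\<close>
  have "p dvd card c" if c: "c \<in> ?C" for c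
  proof -
    obtain x where x: "x \<in> ?N" "c = orbit G \<phi> x"
    proof -
      obtain z w where zw: "w \<in> E" "c = orbit G \<phi> w" "z \<in> c" "z \<in> ?N" using c by (auto simp: orbits_def)
      have "c = orbit G \<phi> z"
      proof -
        have "orbit G \<phi> z \<in> orbits G E \<phi>" "c \<in> orbits G E \<phi>" using zw by (auto simp: orbits_def)
        moreover have "z \<in> orbit G \<phi> z" using zw orbit_refl by auto
        ultimately show ?thesis using disjoint_union zw by blast
      qed
      with zw that show thesis by blast
    qed
    have xE: "x \<in> E" using x by auto
    have "card c * card (stabilizer G \<phi> x) = p ^ n"
      using orbit_stabilizer_theorem[OF xE] ord x by simp
    then obtain k where k: "card c = p ^ k"
      using p divides_primepow_nat[OF p, of "card c" n] by (metis dvd_triv_left)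
    have "card c \<noteq> 1"
    proof
      assume "card c = 1"
      then obtain y where "c = {y}" by (auto simp: card_1_singleton_iff)
      then have "c = {x}" using orbit_refl[OF xE] x by auto
      then have "\<phi> g x = x" if "g \<in> carrier G" for g using that x by (auto simp: orbit_def)
      with x show False by auto
    qed
    with k show ?thesis by (cases k) auto
  qed
  moreover have "card ?N = sum card ?C"
  proof -
    have "card (\<Union>?C) = sum card ?C"
      apply (rule card_Union_disjoint)
      subgoal using disjoint_union by (auto simp: pairwise_def disjnt_def)
      subgoal for A using fin memE by (auto simp: orbits_def intro: finite_subset[of _ E])
      done
    with eq show ?thesis by simp
  qed
  ultimately show ?thesis by (metis (no_types, lifting) dvd_sum)
qed

text \<open>Lets an action be given as a plain function with the two action laws; the restriction
  makes each map extensional, as membership in \<open>Bij E\<close> requires.\<close>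

lemma group_actionI:
  assumes "group G"
    and cl: "\<And>g x. \<lbrakk>g \<in> carrier G; x \<in> E\<rbrakk> \<Longrightarrow> act g x \<in> E"
    and one: "\<And>x. x \<in> E \<Longrightarrow> act \<one>\<^bsub>G\<^esub> x = x"
    and mult: "\<And>g h x. \<lbrakk>g \<in> carrier G; h \<in> carrier G; x \<in> E\<rbrakk> \<Longrightarrow>
      act (g \<otimes>\<^bsub>G\<^esub> h) x = act g (act h x)"
  shows "group_action G E (\<lambda>g. \<lambda>x\<in>E. act g x)"
proof -
  interpret group G by fact
  have bij: "restrict (act g) E \<in> Bij E" if g: "g \<in> carrier G" for g
  proof -
    have "bij_betw (restrict (act g) E) E E"
      by (rule bij_betwI[where g = "act (inv\<^bsub>G\<^esub> g)"])
        (use g cl one mult[symmetric] in auto)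
    then show ?thesis by (simp add: Bij_def)
  qed
  have "group_hom G (BijGroup E) (\<lambda>g. restrict (act g) E)"
  proof (intro group_hom.intro group_hom_axioms.intro homI)
    show "group G" by fact
    show "group (BijGroup E)" by (rule group_BijGroup)
    fix g h assume gh: "g \<in> carrier G" "h \<in> carrier G"
    show "restrict (act g) E \<in> carrier (BijGroup E)" using bij gh by (simp add: BijGroup_def)
    show "restrict (act (g \<otimes>\<^bsub>G\<^esub> h)) E = restrict (act g) E \<otimes>\<^bsub>BijGroup E\<^esub> restrict (act h) E"
      using bij gh cl mult by (auto simp: BijGroup_def compose_def)
  qed
  then show ?thesis by (simp add: group_action_def)
qed

text \<open>The class equation: moved points fall into orbits of length divisible by
  \<open>p\<close> and drop out modulo \<open>p\<close>.\<close>

lemma p_group_action_fixed: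
  fixes p :: nat
  assumes p: "Factorial_Ring.prime p" and ord: "order G = p ^ n" and fin: "finite E"
    and "group G"
    and cl: "\<And>g x. \<lbrakk>g \<in> carrier G; x \<in> E\<rbrakk> \<Longrightarrow> act g x \<in> E"
    and one: "\<And>x. x \<in> E \<Longrightarrow> act \<one>\<^bsub>G\<^esub> x = x"
    and mult: "\<And>g h x. \<lbrakk>g \<in> carrier G; h \<in> carrier G; x \<in> E\<rbrakk> \<Longrightarrow>
      act (g \<otimes>\<^bsub>G\<^esub> h) x = act g (act h x)"
  shows "[card {x \<in> E. \<forall>g\<in>carrier G. act g x = x} = card E] (mod p)"
proof -
  interpret group_action G E "\<lambda>g. \<lambda>x\<in>E. act g x"
    by (rule group_actionI) (use assms in auto)
  let ?N = "{x \<in> E. \<exists>g\<in>carrier G. (\<lambda>x\<in>E. act g x) x \<noteq> x}"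
  let ?F = "{x \<in> E. \<forall>g\<in>carrier G. act g x = x}"
  have "E = ?F \<union> ?N" "?F \<inter> ?N = {}" by auto
  then have "card E = card ?F + card ?N"
    using fin by (metis (no_types, lifting) card_Un_disjoint finite_Un)
  moreover obtain k where "card ?N = p * k"
    using p_group_card_non_fixed[OF p ord fin] by (auto elim: dvdE)
  ultimately show ?thesis by (simp add: cong_def)
qed

text \<open>The iterates of \<open>f\<close> are an action of the cyclic group of order
  \<open>q\<close>, so orbit counting for a \<open>q\<close>-group applies. The use is with
  \<open>q\<close> different from \<open>p\<close>, for automorphisms permuting a set of
  \<open>p\<close>-power size.\<close>

lemma prime_period_fixed_points:
  fixes q :: nat
  assumes q: "Factorial_Ring.prime q" and fin: "finite Y" and cl: "\<And>x. x \<in> Y \<Longrightarrow> f x \<in> Y"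
    and per: "\<And>x. x \<in> Y \<Longrightarrow> (f ^^ q) x = x"
  shows "[card {x \<in> Y. f x = x} = card Y] (mod q)"
proof -
  let ?Z = "integer_mod_group q"
  have q0: "q > 1" using q prime_gt_1_nat by auto
  have ord: "order ?Z = q ^ 1"
    using q0 by (simp add: order_def carrier_integer_mod_group)
  have pk: "(f ^^ (q * k)) x = x" if "x \<in> Y" for k x
    using that by (induction k) (simp_all add: per funpow_add)
  \<comment> \<open>The product in \<open>integer_mod_group q\<close> reduces exponents modulo
    \<open>q\<close>; periodicity of \<open>f\<close> absorbs the reduction.\<close>
  have pm: "(f ^^ (m mod q)) x = (f ^^ m) x" if "x \<in> Y" for m x
  proof -
    have "(f ^^ (m mod q + q * (m div q))) x = (f ^^ (m mod q)) ((f ^^ (q * (m div q))) x)"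
      by (simp only: funpow_add o_apply)
    then show ?thesis using pk[OF that] by simp
  qed
  have clk: "(f ^^ k) x \<in> Y" if "x \<in> Y" for k x
    using that cl by (induction k) auto
  have "[card {x \<in> Y. \<forall>g\<in>carrier ?Z. (f ^^ nat g) x = x} = card Y] (mod q)"
  proof (rule p_group_action_fixed[OF q ord fin])
    fix g h x assume gh: "g \<in> carrier ?Z" "h \<in> carrier ?Z" "x \<in> Y"
    then have nn: "g \<ge> 0" "h \<ge> 0" using q0 by (auto simp: carrier_integer_mod_group)
    have "nat ((g + h) mod int q) = (nat g + nat h) mod q"
      using nn by (simp add: nat_mod_distrib nat_add_distrib)
    then have "(f ^^ nat (g \<otimes>\<^bsub>?Z\<^esub> h)) x = (f ^^ (nat g + nat h)) x"
      using pm gh by simp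
    then show "(f ^^ nat (g \<otimes>\<^bsub>?Z\<^esub> h)) x = (f ^^ nat g) ((f ^^ nat h) x)"
      by (simp add: funpow_add)
  qed (use clk in auto)
  moreover have "{x \<in> Y. \<forall>g\<in>carrier ?Z. (f ^^ nat g) x = x} = {x \<in> Y. f x = x}"
  proof -
    have "(f ^^ k) x = x" if "f x = x" for k x using that by (induction k) auto
    moreover have "1 \<in> carrier ?Z" using q0 by simp
    ultimately show ?thesis by (auto dest: bspec[of _ _ 1])
  qed
  ultimately show ?thesis by simp
qed

section \<open>Subgroup criteria, coset actions and Cauchy's theorem in finite groups\<close>

lemma (in group) mult_inv_cancel:
  assumes "x \<in> carrier G" "y \<in> carrier G"
  shows "x \<otimes> (inv x \<otimes> y) = y" "inv x \<otimes> (x \<otimes> y) = y"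
  using assms by (simp_all add: m_assoc[symmetric])

lemmas (in group) group_word_simps = m_assoc inv_mult_group mult_inv_cancel

text \<open>Powers of an element repeat in a finite set closed under products, so the inverse is
  itself a positive power.\<close>

lemma (in group) finite_subgroupI:
  assumes "finite H" "H \<subseteq> carrier G" "H \<noteq> {}" and cl: "\<And>x y. \<lbrakk>x \<in> H; y \<in> H\<rbrakk> \<Longrightarrow> x \<otimes> y \<in> H"
  shows "subgroup H G"
proof (rule subgroupI)
  fix a assume a: "a \<in> H"
  then have aG: "a \<in> carrier G" using assms by auto
  have pw: "a [^] Suc n \<in> H" for n
  proof (induction n)
    case 0
    then show ?case using a aG by simp
  next
    case (Suc n)
    have "a [^] Suc (Suc n) = a [^] Suc n \<otimes> a" by simp
    then show ?case using cl[OF Suc a] by simp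
  qed
  have "\<not> inj_on (\<lambda>n. a [^] Suc n) UNIV"
    using assms(1) pw finite_imageD[of "\<lambda>n. a [^] Suc n" "UNIV :: nat set"]
    by (metis (mono_tags, lifting) finite_subset image_subset_iff infinite_UNIV_nat)
  then obtain m n :: nat where mn: "m < n" "a [^] Suc m = a [^] Suc n"
    by (metis (mono_tags, lifting) inj_on_def linorder_neqE_nat)
  then have "a [^] (n - m) = \<one>"
  proof -
    have "a [^] Suc m \<otimes> a [^] (n - m) = a [^] (Suc m + (n - m))"
      using aG by (rule nat_pow_mult)
    moreover have "Suc m + (n - m) = Suc n" using mn by simp
    ultimately have "a [^] Suc m \<otimes> a [^] (n - m) = a [^] Suc m" using mn by simp
    then show ?thesis using aG by (simp del: nat_pow_Suc)
  qed
  \<comment> \<open>Doubling keeps the exponent at least 2, so the inverse becomes a power with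
    exponent \<open>Suc e\<close>; only positive powers of \<open>a\<close> are known to lie in
    \<open>H\<close>.\<close>
  then have "a [^] ((n - m) * 2) = \<one>"
    using aG by (metis nat_pow_one nat_pow_pow)
  moreover have "\<exists>e. (n - m) * 2 = Suc (Suc e)" using mn by presburger
  ultimately obtain e where "a [^] Suc e \<otimes> a = \<one>" by (metis nat_pow_Suc)
  then have "inv a = a [^] Suc e" using aG by (simp add: inv_equality del: nat_pow_Suc)
  then show "inv a \<in> H" using pw by simp
qed (use assms in auto)

text \<open>\<open>P\<close> acts on the cosets of \<open>H\<close> by right multiplication with
  inverses. Two cases matter: \<open>H\<close> Sylow and \<open>P\<close> normal, where the index is
  prime to \<open>p\<close>, and \<open>P = H\<close> inside a \<open>p\<close>-group, where it is
  divisible by \<open>p\<close>.\<close>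

lemma (in group) p_subgroup_fixed_rcosets:
  fixes p :: nat
  assumes p: "Factorial_Ring.prime p" and fin: "finite (carrier G)"
    and H: "subgroup H G" and P: "subgroup P G" and k: "card P = p ^ k"
  shows "[card {Y \<in> rcosets H. \<forall>h\<in>P. Y #> inv h = Y} = card (rcosets H)] (mod p)"
proof -
  let ?E = "rcosets H"
  interpret H: subgroup H G by fact
  interpret P: subgroup P G by fact
  let ?G = "G\<lparr>carrier := P\<rparr>"
  have cl: "Y #> inv h \<in> ?E" if hY: "h \<in> P" "Y \<in> ?E" for h Y
  proof -
    obtain a where a: "a \<in> carrier G" "Y = H #> a" using hY by (auto simp: RCOSETS_def)
    have "Y #> inv h = H #> (a \<otimes> inv h)" using a hY H.subset by (simp add: coset_mult_assoc)
    then show ?thesis using a hY by (auto simp: RCOSETS_def)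
  qed
  have sub: "Y \<subseteq> carrier G" if "Y \<in> ?E" for Y
    using that H.subset by (auto simp: RCOSETS_def r_coset_def)
  have "[card {Y \<in> ?E. \<forall>h\<in>carrier ?G. Y #> inv h = Y} = card ?E] (mod p)"
  proof (rule p_group_action_fixed[OF p])
    show "order ?G = p ^ k" using k by (simp add: order_def)
    show "finite ?E" using fin by (simp add: RCOSETS_def)
    show "group ?G" using P.subgroup_is_group is_group by blast
    show "\<And>g Y. g \<in> carrier ?G \<Longrightarrow> Y \<in> ?E \<Longrightarrow> Y #> inv g \<in> ?E" using cl by simp
    show "Y #> inv \<one>\<^bsub>?G\<^esub> = Y" if "Y \<in> ?E" for Y using sub that by simp
    fix g h Y assume a: "g \<in> carrier ?G" "h \<in> carrier ?G" "Y \<in> ?E"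
    then show "Y #> inv (g \<otimes>\<^bsub>?G\<^esub> h) = Y #> inv h #> inv g"
      using sub by (simp add: coset_mult_assoc inv_mult_group)
  qed
  then show ?thesis by simp
qed

lemma (in group) fixed_rcosetD:
  assumes H: "subgroup H G" and P: "subgroup P G" and a: "a \<in> carrier G"
    and fx: "\<forall>h\<in>P. (H #> a) #> inv h = H #> a" and h: "h \<in> P"
  shows "a \<otimes> h \<otimes> inv a \<in> H"
proof -
  interpret H: subgroup H G by fact
  interpret P: subgroup P G by fact
  have "(H #> a) #> inv (inv h) = H #> a" using fx h by blast
  then have "H #> (a \<otimes> h) = H #> a" using a h H.subset by (simp add: coset_mult_assoc)
  then have "a \<otimes> h \<in> H #> a" using a h H rcos_self by (metis P.mem_carrier m_closed)
  then obtain h' where h': "h' \<in> H" "a \<otimes> h = h' \<otimes> a" by (auto simp: r_coset_def)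
  have "h' \<otimes> a \<otimes> inv a = h'" using h' a by (simp add: m_assoc)
  then show ?thesis using h' by simp
qed

text \<open>The number of cosets of \<open>T\<close> is prime to \<open>p\<close>, so
  \<open>N\<close> fixes one of them; this puts a conjugate of \<open>N\<close> into
  \<open>T\<close>, and normality turns the conjugate into \<open>N\<close>.\<close>

lemma (in group) normal_p_subgroup_le_sylow:
  fixes p :: nat
  assumes p: "Factorial_Ring.prime p" and fin: "finite (carrier G)"
    and T: "sylow_subgroup p T G" and N: "subgroup N G" and k: "card N = p ^ k"
    and nrm: "\<And>g x. \<lbrakk>g \<in> carrier G; x \<in> N\<rbrakk> \<Longrightarrow> inv g \<otimes> x \<otimes> g \<in> N"
  shows "N \<subseteq> T"
proof
  fix x assume x: "x \<in> N"
  have Ts: "subgroup T G" and cT: "card T = p ^ multiplicity p (order G)"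
    using T by (auto simp: sylow_subgroup_def)
  interpret T: subgroup T G by fact
  interpret N: subgroup N G by fact
  let ?F = "{Y \<in> rcosets T. \<forall>h\<in>N. Y #> inv h = Y}"
  have "order G \<noteq> 0" using fin by (metis not_gr0 order_gt_0_iff_finite)
  then have "\<not> p dvd order G div p ^ multiplicity p (order G)"
    using p by (metis multiplicity_decompose not_prime_unit)
  moreover have "card (rcosets T) = order G div p ^ multiplicity p (order G)"
    using lagrange[OF Ts] cT p by (metis nonzero_mult_div_cancel_right not_prime_0 power_not_zero)
  ultimately have "\<not> p dvd card ?F"
    using cong_dvd_iff[OF p_subgroup_fixed_rcosets[OF p fin Ts N k]] by simp
  then have "?F \<noteq> {}" by (metis card.empty dvd_0_right)
  then obtain Y where Y: "Y \<in> ?F" by blast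
  then have "Y \<in> rcosets T" by simp
  then obtain a where a: "a \<in> carrier G" "Y = T #> a" by (auto simp: RCOSETS_def)
  have "inv a \<otimes> x \<otimes> a \<in> N" using nrm a x by blast
  then have "a \<otimes> (inv a \<otimes> x \<otimes> a) \<otimes> inv a \<in> T"
    using fixed_rcosetD[OF Ts N a(1)] Y a by blast
  then show "x \<in> T" using a x by (simp add: group_word_simps)
qed

section \<open>Finite p-groups and the growth of normalizers\<close>

locale finite_p_group = group +
  fixes p :: nat
  assumes prime_p: "Factorial_Ring.prime p"
    and order_eq_power: "\<exists>n. order G = p ^ n"
begin

lemma finite_carrier: "finite (carrier G)"
  using order_eq_power prime_p by (metis order_gt_0_iff_finite prime_gt_0_nat zero_less_power)

lemma finite_subgroup: "subgroup H G \<Longrightarrow> finite H"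
  using finite_carrier subgroup.subset finite_subset by blast

lemma finite_p_group_subgroup:
  assumes "subgroup H G"
  shows "finite_p_group (G\<lparr>carrier := H\<rparr>) p"
proof -
  obtain n where "order G = p ^ n" using order_eq_power by blast
  then have "card H dvd p ^ n" using lagrange[OF assms] by (metis dvd_triv_right)
  then obtain k where "card H = p ^ k" using divides_primepow_nat[OF prime_p] by blast
  then show ?thesis
    using subgroup.subgroup_is_group[OF assms is_group] prime_p
    by (auto simp: finite_p_group_def finite_p_group_axioms_def order_def)
qed

lemma card_subgroup_power: "subgroup H G \<Longrightarrow> \<exists>k. card H = p ^ k"
  using finite_p_group.order_eq_power[OF finite_p_group_subgroup, of H] by (simp add: order_def)

lemma card_mult_p_le:
  assumes "subgroup H G" "subgroup K G" "H \<subset> K"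
  shows "p * card H dvd card K"
proof -
  obtain i j where ij: "card H = p ^ i" "card K = p ^ j" using card_subgroup_power assms by meson
  have "card H < card K" using assms finite_subgroup psubset_card_mono by blast
  then have "i < j" using ij power_less_imp_less_exp[of p i j] prime_gt_1_nat[OF prime_p] by simp
  then show ?thesis using ij by (metis Suc_leI le_imp_power_dvd power_Suc)
qed

lemma subgroup_eqI_card: "subgroup K G \<Longrightarrow> H \<subseteq> K \<Longrightarrow> card K \<le> card H \<Longrightarrow> H = K"
  using finite_subgroup by (metis card_seteq)

text \<open>Only one inclusion is demanded: for \<open>x\<close> in a finite group conjugation is
  injective, so the inclusion is an equality.\<close>

definition normalizes :: "'a \<Rightarrow> 'a set \<Rightarrow> bool" where
  "normalizes x H \<longleftrightarrow> (\<forall>h\<in>H. x \<otimes> h \<otimes> inv x \<in> H)"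

text \<open>The cosets of \<open>H\<close> fixed by \<open>H\<close> are divisible by
  \<open>p\<close> in number and include \<open>H\<close> itself, so there is a second one; its
  representative normalizes \<open>H\<close>.\<close>

lemma proper_subgroup_normalized:
  assumes H: "subgroup H G" and neq: "H \<noteq> carrier G"
  shows "\<exists>x\<in>carrier G - H. normalizes x H"
proof -
  let ?F = "{Y \<in> rcosets H. \<forall>h\<in>H. Y #> inv h = Y}"
  interpret H: subgroup H G by fact
  obtain k where k: "card H = p ^ k" using card_subgroup_power H by blast
  have pE: "p dvd card (rcosets H)"
  proof -
    obtain n where n: "order G = p ^ n" using order_eq_power by blast
    have lag: "card (rcosets H) * card H = p ^ n" using lagrange[OF H] n by simp
    then obtain j where j: "card (rcosets H) = p ^ j"
      using divides_primepow_nat[OF prime_p] by (metis dvd_triv_left)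
    have "card H < order G"
      using H.subset neq finite_carrier by (metis order_def psubsetI psubset_card_mono)
    then have "card (rcosets H) \<noteq> 1" using lag n by auto
    with j show ?thesis by (cases j) auto
  qed
  have "[card ?F = card (rcosets H)] (mod p)"
    by (rule p_subgroup_fixed_rcosets[OF prime_p finite_carrier H H k])
  then have "p dvd card ?F" using pE by (simp add: cong_dvd_iff)
  moreover have HF: "H \<in> ?F"
    using H.subgroup_in_rcosets[OF is_group] H coset_join2 by auto
  moreover have "finite ?F" using finite_carrier by (simp add: RCOSETS_def)
  ultimately have "card ?F \<noteq> 1" "card ?F \<noteq> 0" using prime_p by (auto simp: card_gt_0_iff)
  have "\<not> ?F \<subseteq> {H}"
  proof
    assume "?F \<subseteq> {H}"
    moreover have "{H} \<subseteq> ?F" using HF by (simp only: insert_subset empty_subsetI simp_thms)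
    ultimately have "?F = {H}" by (rule subset_antisym)
    then have "card ?F = 1" by (simp only: card.insert card.empty) simp
    then show False using \<open>card ?F \<noteq> 1\<close> by contradiction
  qed
  then obtain Y where Y: "Y \<in> ?F" "Y \<noteq> H" by blast
  then have "Y \<in> rcosets H" by simp
  then obtain a where a: "a \<in> carrier G" "Y = H #> a" by (auto simp: RCOSETS_def)
  have "a \<notin> H" using Y a coset_join2 H by blast
  moreover have "a \<otimes> h \<otimes> inv a \<in> H" if h: "h \<in> H" for h
    using fixed_rcosetD[OF H H a(1) _ h] Y a by blast
  ultimately show ?thesis using a by (auto simp: normalizes_def)
qed

end

text \<open>If another prime divided the order, Cauchy's theorem, taken from Sylow's theorem with
  exponent 1, would produce a forbidden element.\<close>

lemma (in group) order_prime_powerI: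
  fixes p :: nat
  assumes p: "Factorial_Ring.prime p" and fin: "finite (carrier G)"
    and no: "\<And>q x. \<lbrakk>Factorial_Ring.prime q; q \<noteq> p; x \<in> carrier G; x [^] q = \<one>\<rbrakk> \<Longrightarrow> x = \<one>"
  shows "\<exists>k. order G = p ^ k"
proof -
  have "order G \<noteq> 0" using fin by (metis not_gr0 order_gt_0_iff_finite)
  then obtain m where m: "order G = p ^ multiplicity p (order G) * m" "\<not> p dvd m"
    using p by (metis multiplicity_decompose' not_prime_unit)
  have "m = 1"
  proof (rule ccontr)
    assume "m \<noteq> 1"
    then obtain q where q: "Factorial_Ring.prime q" "q dvd m" using prime_factor_nat by blast
    then have qp: "q \<noteq> p" using m by auto
    obtain r where "m = q * r" using q by (elim dvdE)
    then have "order G = q ^ 1 * (p ^ multiplicity p (order G) * r)"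
      using m(1) by (metis mult.left_commute power_one_right)
    then obtain H where H: "subgroup H G" "card H = q ^ 1"
      using sylow_thm[OF q(1) is_group _ fin, of 1] by blast
    interpret H: subgroup H G by fact
    have fH: "finite H" using fin H.subset finite_subset by blast
    have "card H \<noteq> 1" using H q by auto
    then have "\<not> H \<subseteq> {\<one>}" using H.one_closed by (metis card_1_singleton_iff is_singletonI is_singleton_altdef subset_singletonD empty_iff)
    then obtain x where x: "x \<in> H" "x \<noteq> \<one>" by blast
    have "x [^]\<^bsub>G\<lparr>carrier := H\<rparr>\<^esub> order (G\<lparr>carrier := H\<rparr>) = \<one>\<^bsub>G\<lparr>carrier := H\<rparr>\<^esub>"
      using group.pow_order_eq_1[OF H.subgroup_is_group[OF is_group]] x by simp
    then have "x [^] q = \<one>" using H by (simp add: order_def nat_pow_consistent[symmetric])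
    then show False using no[OF q(1) qp] x by simp
  qed
  then show ?thesis using m by (metis mult_1_right)
qed

text \<open>Powers of a product \<open>x \<otimes> y\<close> when \<open>y \<otimes> x = x \<otimes> y \<otimes> k\<close> with \<open>k\<close> central: the commutator
  occurs \<open>n choose 2\<close> times, a multiple of \<open>n\<close> for odd \<open>n\<close>.\<close>

lemma (in group) pow_mult_class_two:
  assumes x: "x \<in> carrier G" and y: "y \<in> carrier G" and k: "k \<in> carrier G"
    and com: "y \<otimes> x = x \<otimes> y \<otimes> k" and kx: "k \<otimes> x = x \<otimes> k" and ky: "k \<otimes> y = y \<otimes> k"
  shows "(x \<otimes> y) [^] n = x [^] n \<otimes> y [^] n \<otimes> k [^] (n * (n - 1) div 2 :: nat)"
    and "y \<otimes> x [^] n = x [^] n \<otimes> y \<otimes> k [^] (n :: nat)"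
    and "y [^] n \<otimes> x = x \<otimes> y [^] n \<otimes> k [^] (n :: nat)"
proof -
  have kyn: "k [^] i \<otimes> y [^] j = y [^] j \<otimes> k [^] i" for i j :: nat
    using ky y k by (metis nat_pow_closed pow_mult_distrib group_commutes_pow)
  have kxn: "k [^] i \<otimes> x [^] j = x [^] j \<otimes> k [^] i" for i j :: nat
    using kx x k by (metis nat_pow_closed pow_mult_distrib group_commutes_pow)
  have kx1: "k [^] i \<otimes> x = x \<otimes> k [^] i" for i :: nat using kxn[of i 1] x by simp
  have ky1: "k [^] i \<otimes> y = y \<otimes> k [^] i" for i :: nat using kyn[of i 1] y by simp
  have ky2: "k [^] i \<otimes> (y \<otimes> z) = y \<otimes> (k [^] i \<otimes> z)" if "z \<in> carrier G" for i :: nat and z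
  proof -
    have "k [^] i \<otimes> y \<otimes> z = y \<otimes> k [^] i \<otimes> z" by (simp only: ky1)
    then show ?thesis using that y k by (simp add: m_assoc)
  qed
  show yn: "y [^] n \<otimes> x = x \<otimes> y [^] n \<otimes> k [^] n" for n :: nat
  proof (induction n)
    case 0
    then show ?case using x by simp
  next
    case (Suc n)
    have "y [^] Suc n \<otimes> x = y [^] n \<otimes> (x \<otimes> y \<otimes> k)" using x y k com by (simp add: m_assoc)
    also have "\<dots> = (y [^] n \<otimes> x) \<otimes> y \<otimes> k" using x y k by (simp add: m_assoc)
    also have "\<dots> = x \<otimes> y [^] n \<otimes> (k [^] n \<otimes> y) \<otimes> k" using x y k Suc by (simp add: m_assoc)
    also have "\<dots> = x \<otimes> y [^] Suc n \<otimes> k [^] Suc n" using x y k ky1 by (simp add: m_assoc)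
    finally show ?case .
  qed
  show "y \<otimes> x [^] n = x [^] n \<otimes> y \<otimes> k [^] n"
  proof (induction n)
    case 0
    then show ?case using y by simp
  next
    case (Suc n)
    have "y \<otimes> x [^] Suc n = (y \<otimes> x [^] n) \<otimes> x" using x y k by (simp add: m_assoc)
    also have "\<dots> = x [^] n \<otimes> y \<otimes> (k [^] n \<otimes> x)" using x y k Suc by (simp add: m_assoc)
    also have "\<dots> = x [^] n \<otimes> (y \<otimes> x) \<otimes> k [^] n" using x y k kx1 by (simp add: m_assoc)
    also have "\<dots> = x [^] n \<otimes> x \<otimes> y \<otimes> (k \<otimes> k [^] n)" using x y k com by (simp add: m_assoc)
    also have "k \<otimes> k [^] n = k [^] Suc n" using k by (simp add: nat_pow_Suc2[symmetric] del: nat_pow_Suc)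
    finally show ?case using x y k by (simp add: m_assoc)
  qed
  show "(x \<otimes> y) [^] n = x [^] n \<otimes> y [^] n \<otimes> k [^] (n * (n - 1) div 2)"
  proof (induction n)
    case 0
    then show ?case by simp
  next
    case (Suc n)
    let ?e = "n * (n - 1) div 2"
    have e: "Suc n * (Suc n - 1) div 2 = n + ?e"
    proof (cases n)
      case (Suc m)
      have "Suc n * n = n * 2 + n * (n - 1)" using Suc by (simp add: algebra_simps)
      then show ?thesis by simp
    qed simp
    have "(x \<otimes> y) [^] Suc n = x [^] n \<otimes> y [^] n \<otimes> (k [^] ?e \<otimes> x) \<otimes> y"
      using x y k Suc by (simp add: m_assoc)
    also have "\<dots> = x [^] n \<otimes> (y [^] n \<otimes> x) \<otimes> (k [^] ?e \<otimes> y)" using x y k kx1 by (simp add: m_assoc)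
    also have "\<dots> = x [^] n \<otimes> x \<otimes> y [^] n \<otimes> (k [^] n \<otimes> y) \<otimes> k [^] ?e" using x y k yn ky1 ky2 by (simp add: m_assoc)
    also have "\<dots> = x [^] Suc n \<otimes> y [^] Suc n \<otimes> (k [^] n \<otimes> k [^] ?e)" using x y k ky1 by (simp add: m_assoc)
    also have "k [^] n \<otimes> k [^] ?e = k [^] (Suc n * (Suc n - 1) div 2)" using k e by (simp add: nat_pow_mult)
    finally show ?case .
  qed
qed

lemma (in group) pow_mult_class_two_odd:
  fixes n :: nat
  assumes "x \<in> carrier G" "y \<in> carrier G" "k \<in> carrier G"
    and "y \<otimes> x = x \<otimes> y \<otimes> k" "k \<otimes> x = x \<otimes> k" "k \<otimes> y = y \<otimes> k"
    and "odd n" "k [^] n = \<one>"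
  shows "(x \<otimes> y) [^] n = x [^] n \<otimes> y [^] n"
proof -
  obtain m where m: "n = 2 * m + 1" using \<open>odd n\<close> by (elim oddE)
  have "n * (n - 1) div 2 = n * m" using m by simp
  then have "k [^] (n * (n - 1) div 2) = (k [^] n) [^] m" using assms(3) by (simp only: nat_pow_pow)
  then have "k [^] (n * (n - 1) div 2) = \<one>" using assms(8) by simp
  then show ?thesis using pow_mult_class_two(1)[OF assms(1-6), of n] assms by simp
qed

section \<open>Adjoining elements and subgroups of index p\<close>

context finite_p_group
begin

lemma p_gt_1: "p > 1" using prime_p prime_gt_1_nat by auto

lemma pow_card_eq_one: "x \<in> carrier G \<Longrightarrow> \<exists>n. x [^] (p ^ n) = \<one>"
  using order_eq_power pow_order_eq_1 by metis

lemma inv_eq_nat_pow: assumes "x \<in> carrier G" shows "\<exists>k::nat. inv x = x [^] k"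
proof -
  obtain n where n: "x [^] (p ^ n) = \<one>" using pow_card_eq_one assms by blast
  have "Suc (p ^ n - 1) = p ^ n" using p_gt_1 by simp
  then have "x [^] (p ^ n - 1) \<otimes> x = \<one>" using n by (metis nat_pow_Suc)
  then show ?thesis using assms by (metis inv_equality nat_pow_closed)
qed

lemma subgroup_pow: "subgroup H G \<Longrightarrow> x \<in> H \<Longrightarrow> x [^] (n::nat) \<in> H"
  by (induction n) (auto simp: subgroup.one_closed subgroup.m_closed)

lemma normalizes_closed: "normalizes x H \<Longrightarrow> h \<in> H \<Longrightarrow> x \<otimes> h \<otimes> inv x \<in> H"
  by (simp add: normalizes_def)

lemma normalizes_mult:
  assumes "subgroup H G" "x \<in> carrier G" "y \<in> carrier G" "normalizes x H" "normalizes y H"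
  shows "normalizes (x \<otimes> y) H"
proof -
  have "x \<otimes> y \<otimes> h \<otimes> inv (x \<otimes> y) \<in> H" if h: "h \<in> H" for h
  proof -
    have "x \<otimes> (y \<otimes> h \<otimes> inv y) \<otimes> inv x \<in> H" using assms h by (simp add: normalizes_def)
    then show ?thesis using assms h subgroup.mem_carrier[OF assms(1) h] by (simp add: group_word_simps)
  qed
  then show ?thesis by (simp add: normalizes_def)
qed

lemma normalizes_mem: "subgroup H G \<Longrightarrow> x \<in> H \<Longrightarrow> normalizes x H"
  by (simp add: normalizes_def subgroup.m_closed subgroup.m_inv_closed)

lemma normalizes_pow:
  "subgroup H G \<Longrightarrow> x \<in> carrier G \<Longrightarrow> normalizes x H \<Longrightarrow> normalizes (x [^] (n::nat)) H"
  by (induction n) (simp_all add: normalizes_mult normalizes_mem subgroup.one_closed)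

lemma normalizes_inv:
  "subgroup H G \<Longrightarrow> x \<in> carrier G \<Longrightarrow> normalizes x H \<Longrightarrow> normalizes (inv x) H"
  using inv_eq_nat_pow normalizes_pow by metis

lemma normalizes_swap:
  assumes "subgroup H G" "x \<in> carrier G" "normalizes x H" "h \<in> H"
  shows "\<exists>h'\<in>H. x \<otimes> h = h' \<otimes> x" "\<exists>h'\<in>H. h \<otimes> x = x \<otimes> h'"
proof -
  have hG: "h \<in> carrier G" using assms subgroup.mem_carrier by metis
  have "x \<otimes> h \<otimes> inv x \<in> H" using assms normalizes_closed by blast
  moreover have "x \<otimes> h = x \<otimes> h \<otimes> inv x \<otimes> x" using assms hG by (simp add: m_assoc)
  ultimately show "\<exists>h'\<in>H. x \<otimes> h = h' \<otimes> x" by blast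
  have "inv x \<otimes> h \<otimes> inv (inv x) \<in> H" using assms normalizes_inv normalizes_closed by blast
  moreover have "h \<otimes> x = x \<otimes> (inv x \<otimes> h \<otimes> x)" using assms hG by (simp add: group_word_simps)
  ultimately show "\<exists>h'\<in>H. h \<otimes> x = x \<otimes> h'" using assms by auto
qed

lemma subgroup_normalizing:
  assumes "subgroup H G" "subgroup K G"
  shows "subgroup {x \<in> K. normalizes x H} G"
proof (rule finite_subgroupI)
  have KG: "K \<subseteq> carrier G" using assms subgroup.subset by blast
  show "finite {x \<in> K. normalizes x H}" using finite_subgroup[OF assms(2)] by simp
  show "{x \<in> K. normalizes x H} \<subseteq> carrier G" using KG by blast
  have "\<one> \<in> {x \<in> K. normalizes x H}"
    using assms by (simp add: subgroup.one_closed normalizes_mem)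
  then show "{x \<in> K. normalizes x H} \<noteq> {}" by blast
  fix x y assume "x \<in> {x \<in> K. normalizes x H}" "y \<in> {x \<in> K. normalizes x H}"
  then show "x \<otimes> y \<in> {x \<in> K. normalizes x H}"
    using subsetD[OF KG] normalizes_mult[OF assms(1)] subgroup.m_closed[OF assms(2)] by simp
qed

text \<open>The subgroup generated by \<open>H\<close> and \<open>x\<close> when \<open>x\<close>
  normalizes \<open>H\<close>; natural exponents cover inverses because elements have finite
  order.\<close>

definition adjoin :: "'a set \<Rightarrow> 'a \<Rightarrow> 'a set" where
  "adjoin H x = {h \<otimes> x [^] i | h i. h \<in> H \<and> i \<in> (UNIV :: nat set)}"

lemma adjoin_least: "subgroup K G \<Longrightarrow> H \<subseteq> K \<Longrightarrow> x \<in> K \<Longrightarrow> adjoin H x \<subseteq> K"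
  by (auto simp: adjoin_def subgroup.m_closed subgroup_pow)

text \<open>For the order: reducing exponents modulo \<open>p\<close> leaves at most
  \<open>p * card H\<close> products, and a subgroup properly containing \<open>H\<close> has at
  least that many elements.\<close>

lemma
  assumes H: "subgroup H G" and x: "x \<in> carrier G" and nx: "normalizes x H"
  shows subgroup_adjoin: "subgroup (adjoin H x) G"
    and adjoin_incl: "H \<subseteq> adjoin H x" "x \<in> adjoin H x"
    and card_adjoin: "x \<notin> H \<Longrightarrow> x [^] p \<in> H \<Longrightarrow> card (adjoin H x) = p * card H"
proof -
  interpret H: subgroup H G by fact
  have pc: "adjoin H x \<subseteq> carrier G" using x by (auto simp: adjoin_def)
  show i1: "H \<subseteq> adjoin H x"
  proof
    fix h assume h: "h \<in> H"
    then have "h = h \<otimes> x [^] (0::nat)" by simp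
    with h show "h \<in> adjoin H x" unfolding adjoin_def by blast
  qed
  have "x = \<one> \<otimes> x [^] (1::nat)" using x by simp
  then show i2: "x \<in> adjoin H x" unfolding adjoin_def using H.one_closed by blast
  show sg: "subgroup (adjoin H x) G"
  proof (rule finite_subgroupI)
    show "finite (adjoin H x)" using finite_carrier pc finite_subset by blast
    show "adjoin H x \<subseteq> carrier G" by fact
    show "adjoin H x \<noteq> {}" using i2 by blast
    fix a b assume "a \<in> adjoin H x" "b \<in> adjoin H x"
    then obtain h i h' j where ab: "h \<in> H" "a = h \<otimes> x [^] (i::nat)" "h' \<in> H" "b = h' \<otimes> x [^] (j::nat)"
      by (auto simp: adjoin_def)
    obtain h'' where h'': "h'' \<in> H" "x [^] i \<otimes> h' = h'' \<otimes> x [^] i"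
      using normalizes_swap(1)[OF H _ normalizes_pow[OF H x nx], of i h'] x ab by auto
    have "a \<otimes> b = h \<otimes> (x [^] i \<otimes> h') \<otimes> x [^] j" using ab x by (simp add: m_assoc)
    also have "\<dots> = (h \<otimes> h'') \<otimes> x [^] (i + j)"
      using ab h'' x by (simp add: m_assoc nat_pow_mult[symmetric])
    finally show "a \<otimes> b \<in> adjoin H x" using ab h'' unfolding adjoin_def by blast
  qed
  assume xH: "x \<notin> H" and xp: "x [^] p \<in> H"
  have "adjoin H x \<subseteq> (\<lambda>(h, i). h \<otimes> x [^] i) ` (H \<times> {..<p})"
  proof
    fix a assume "a \<in> adjoin H x"
    then obtain h i where hi: "h \<in> H" "a = h \<otimes> x [^] (i::nat)" by (auto simp: adjoin_def)
    have "x [^] i = (x [^] p) [^] (i div p) \<otimes> x [^] (i mod p)"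
      using x by (simp add: nat_pow_pow nat_pow_mult)
    then have "a = (h \<otimes> (x [^] p) [^] (i div p)) \<otimes> x [^] (i mod p)"
      using hi x by (simp add: m_assoc)
    moreover have "h \<otimes> (x [^] p) [^] (i div p) \<in> H" using hi xp H subgroup_pow by blast
    moreover have "i mod p < p" using p_gt_1 by simp
    ultimately show "a \<in> (\<lambda>(h, i). h \<otimes> x [^] i) ` (H \<times> {..<p})" by auto
  qed
  then have "card (adjoin H x) \<le> card (H \<times> {..<p})"
    by (intro surj_card_le finite_cartesian_product finite_subgroup[OF H] finite_lessThan)
  then have "card (adjoin H x) \<le> p * card H" by (simp add: card_cartesian_product mult.commute)
  moreover have "p * card H dvd card (adjoin H x)"
    using card_mult_p_le[OF H sg] i1 i2 xH by blast
  moreover have "card (adjoin H x) \<noteq> 0" using sg finite_subgroup i2 by auto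
  ultimately show "card (adjoin H x) = p * card H" using dvd_imp_le by force
qed

text \<open>The sequence of powers \<open>y [^] (p ^ j)\<close> ends at the identity, which lies in
  \<open>H\<close>, so it has a last member outside.\<close>

lemma last_power_outside:
  assumes H: "subgroup H G" and y: "y \<in> carrier G" "y \<notin> H"
  shows "\<exists>j. y [^] (p ^ j) \<notin> H \<and> (y [^] (p ^ j)) [^] p \<in> H"
proof (rule ccontr)
  assume no: "\<not> ?thesis"
  have "y [^] (p ^ j) \<notin> H" for j
  proof (induction j)
    case 0
    then show ?case using y by simp
  next
    case (Suc j)
    then have "(y [^] (p ^ j)) [^] p \<notin> H" using no by blast
    then show ?case using y by (simp add: nat_pow_pow mult.commute)
  qed
  then show False using pow_card_eq_one[OF y(1)] subgroup.one_closed[OF H] by metis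
qed

lemma proper_subgroup_extension:
  assumes H: "subgroup H G" and K: "subgroup K G" and lt: "H \<subset> K"
  shows "\<exists>x\<in>K - H. normalizes x H \<and> x [^] p \<in> H"
proof -
  interpret K: finite_p_group "G\<lparr>carrier := K\<rparr>" p using finite_p_group_subgroup[OF K] .
  have "subgroup H (G\<lparr>carrier := K\<rparr>)" using H K lt subgroup_incl by blast
  then obtain y where y: "y \<in> K - H" "K.normalizes y H"
    using K.proper_subgroup_normalized[of H] lt by auto
  have yG: "y \<in> carrier G" using y K subgroup.mem_carrier by fast
  have ny: "normalizes y H"
    using y m_inv_consistent[OF K, of y] by (auto simp: normalizes_def K.normalizes_def)
  obtain j where "y [^] (p ^ j) \<notin> H" "(y [^] (p ^ j)) [^] p \<in> H"
    using last_power_outside[OF H yG] y by blast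
  moreover have "y [^] (p ^ j) \<in> K" using y K subgroup_pow by blast
  moreover have "normalizes (y [^] (p ^ j)) H" using normalizes_pow[OF H yG ny] .
  ultimately show ?thesis by blast
qed

text \<open>Adjoining an element that has order \<open>p\<close> modulo the subgroup multiplies the
  order by exactly \<open>p\<close>, so every power of \<open>p\<close> on the way is met.\<close>

lemma subgroup_of_card_between:
  assumes H: "subgroup H G" and K: "subgroup K G" and HK: "H \<subseteq> K"
    and le: "card H \<le> p ^ m" "p ^ m \<le> card K"
  shows "\<exists>L. subgroup L G \<and> H \<subseteq> L \<and> L \<subseteq> K \<and> card L = p ^ m"
proof -
  obtain i where i: "card H = p ^ i" using card_subgroup_power[OF H] by blast
  have im: "i \<le> m" using le i p_gt_1 by (metis power_increasing_iff)
  show ?thesis using H HK i im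
  proof (induction "m - i" arbitrary: H i)
    case 0
    then show ?case using le by (intro exI[of _ H]) auto
  next
    case (Suc r)
    then have "card H < p ^ m" using p_gt_1 by simp
    then have "H \<subset> K" using le(2) Suc.prems by auto
    then obtain x where x: "x \<in> K - H" "normalizes x H" "x [^] p \<in> H"
      using proper_subgroup_extension[OF Suc.prems(1) K] by blast
    have xG: "x \<in> carrier G" using x K subgroup.mem_carrier by fast
    have "subgroup (adjoin H x) G" "H \<subseteq> adjoin H x" "card (adjoin H x) = p ^ Suc i"
      using subgroup_adjoin[OF Suc.prems(1) xG x(2)] adjoin_incl[OF Suc.prems(1) xG x(2)]
        card_adjoin[OF Suc.prems(1) xG x(2)] x Suc.prems by auto
    moreover have "adjoin H x \<subseteq> K" using adjoin_least[OF K] x Suc.prems by blast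
    moreover have "r = m - Suc i" "Suc i \<le> m" using Suc by auto
    ultimately show ?case using Suc.hyps(1)[of "Suc i" "adjoin H x"] by blast
  qed
qed

text \<open>The part of \<open>Q\<close> normalizing \<open>M\<close> is strictly larger than
  \<open>M\<close>, and prime index leaves no room below \<open>Q\<close>.\<close>

lemma index_p_normalizes:
  assumes M: "subgroup M G" and Q: "subgroup Q G" and MQ: "M \<subseteq> Q" and c: "card Q = p * card M"
    and x: "x \<in> Q"
  shows "normalizes x M"
proof -
  have c0: "card M > 0" using finite_subgroup[OF M] subgroup.one_closed[OF M] card_gt_0_iff by blast
  have "M \<subset> Q" using MQ c c0 p_gt_1 by auto
  then obtain y where y: "y \<in> Q - M" "normalizes y M" using proper_subgroup_extension[OF M Q] by blast
  let ?N = "{x \<in> Q. normalizes x M}"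
  have N: "subgroup ?N G" using subgroup_normalizing[OF M Q] .
  have "M \<subset> ?N" using MQ y normalizes_mem[OF M] by blast
  then have "p * card M dvd card ?N" using card_mult_p_le[OF M N] by blast
  moreover have "card ?N > 0" using finite_subgroup[OF N] subgroup.one_closed[OF N] card_gt_0_iff by blast
  ultimately have "card Q \<le> card ?N" using c by (simp add: dvd_imp_le)
  then have "?N = Q" using subgroup_eqI_card[OF Q, of ?N] by blast
  then show ?thesis using x by blast
qed

lemma index_p_power:
  assumes M: "subgroup M G" and Q: "subgroup Q G" and MQ: "M \<subseteq> Q" and c: "card Q = p * card M"
    and x: "x \<in> Q"
  shows "x [^] p \<in> M"
proof -
  let ?Q = "G\<lparr>carrier := Q\<rparr>"
  interpret Q: finite_p_group ?Q p using finite_p_group_subgroup[OF Q] .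
  have Ms: "subgroup M ?Q" using M Q MQ subgroup_incl by blast
  have "M \<lhd> ?Q"
    using Ms index_p_normalizes[OF M Q MQ c] m_inv_consistent[OF Q]
    by (auto simp: Q.normal_inv_iff normalizes_def)
  then interpret M: normal M ?Q .
  have c0: "card M > 0" using finite_subgroup[OF M] subgroup.one_closed[OF M] card_gt_0_iff by blast
  have ord: "order (?Q Mod M) = p"
  proof -
    have "card (rcosets\<^bsub>?Q\<^esub> M) * card M = p * card M" using Q.lagrange[OF Ms] c by (simp add: order_def)
    then show ?thesis using c0 by (simp add: order_def FactGroup_def)
  qed
  interpret F: group "?Q Mod M" by (rule M.factorgroup_is_group)
  have xq: "x \<in> carrier ?Q" using x by simp
  then have "M #>\<^bsub>?Q\<^esub> x \<in> carrier (?Q Mod M)" by (auto simp: FactGroup_def RCOSETS_def)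
  then have "(M #>\<^bsub>?Q\<^esub> x) [^]\<^bsub>?Q Mod M\<^esub> p = M"
    using F.pow_order_eq_1[of "M #>\<^bsub>?Q\<^esub> x"] ord by (simp add: FactGroup_def)
  moreover have "(M #>\<^bsub>?Q\<^esub> x) [^]\<^bsub>?Q Mod M\<^esub> p = M #>\<^bsub>?Q\<^esub> (x [^]\<^bsub>?Q\<^esub> p)"
    using hom_nat_pow[OF M.r_coset_hom_Mod xq Q.is_group F.is_group, of p] by simp
  ultimately have "M #>\<^bsub>?Q\<^esub> (x [^]\<^bsub>?Q\<^esub> p) = M" by simp
  then have "x [^]\<^bsub>?Q\<^esub> p \<in> M" using Q.coset_join1[OF _ _ Ms] Q.nat_pow_closed[OF xq] by blast
  then show ?thesis by (simp add: nat_pow_consistent[symmetric])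
qed

lemma index_p_decomp:
  assumes M: "subgroup M G" and Q: "subgroup Q G" and MQ: "M \<subseteq> Q" and c: "card Q = p * card M"
    and x: "x \<in> Q" "x \<notin> M" and y: "y \<in> Q"
  shows "\<exists>m\<in>M. \<exists>i::nat. y = m \<otimes> x [^] i"
proof -
  have xG: "x \<in> carrier G" using x Q subgroup.mem_carrier by fast
  have nx: "normalizes x M" using index_p_normalizes[OF M Q MQ c x(1)] .
  have "card (adjoin M x) = card Q"
    using card_adjoin[OF M xG nx x(2) index_p_power[OF M Q MQ c x(1)]] c by simp
  then have "adjoin M x = Q" using subgroup_eqI_card[OF Q adjoin_least[OF Q MQ x(1)]] by simp
  then show ?thesis using y by (auto simp: adjoin_def)
qed

text \<open>By Bezout, an exponent \<open>i\<close> prime to \<open>p\<close> would express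
  \<open>x\<close> through \<open>x [^] i\<close> and \<open>x [^] p\<close>, both in
  \<open>M\<close>.\<close>

lemma pow_mem_iff:
  assumes M: "subgroup M G" and x: "x \<in> carrier G" "x \<notin> M" "x [^] p \<in> M"
  shows "x [^] (i::nat) \<in> M \<longleftrightarrow> p dvd i"
proof
  assume "p dvd i"
  then obtain j where "i = p * j" by (elim dvdE)
  then have "x [^] i = (x [^] p) [^] j" using x by (simp add: nat_pow_pow)
  then show "x [^] i \<in> M" using subgroup_pow[OF M x(3)] by simp
next
  assume i: "x [^] i \<in> M"
  show "p dvd i"
  proof (rule ccontr)
    assume "\<not> p dvd i"
    then have "coprime p i" using prime_p prime_imp_coprime_nat by blast
    then obtain s t where "i * s = p * t + 1"
      using coprime_bezout_strong[of i p] p_gt_1 by (metis coprime_commute less_numeral_extra(4))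
    then have "(x [^] i) [^] s = (x [^] p) [^] t \<otimes> x"
      using x by (simp add: nat_pow_pow)
    moreover have "(x [^] i) [^] s \<in> M" "(x [^] p) [^] t \<in> M" using i x M subgroup_pow by auto
    moreover have "inv ((x [^] p) [^] t) \<otimes> ((x [^] p) [^] t \<otimes> x) = x" using x by (simp add: mult_inv_cancel)
    ultimately have "x \<in> M" using M by (metis subgroup.m_closed subgroup.m_inv_closed)
    then show False using x by blast
  qed
qed

text \<open>Class equation for conjugation: the number of central elements is divisible by
  \<open>p\<close>, so it is not 1.\<close>

lemma center_nontrivial:
  assumes "carrier G \<noteq> {\<one>}"
  shows "\<exists>z\<in>carrier G. z \<noteq> \<one> \<and> (\<forall>g\<in>carrier G. g \<otimes> z = z \<otimes> g)"
proof (rule ccontr)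
  assume no: "\<not> ?thesis"
  obtain n where n: "order G = p ^ n" using order_eq_power by blast
  let ?F = "{x \<in> carrier G. \<forall>g\<in>carrier G. g \<otimes> x \<otimes> inv g = x}"
  have "[card ?F = card (carrier G)] (mod p)"
    by (rule p_group_action_fixed[OF prime_p n finite_carrier is_group])
      (simp_all add: group_word_simps)
  moreover have "p dvd card (carrier G)"
  proof -
    have "n \<noteq> 0" using n assms order_one_triv_iff by (metis power_0)
    then show ?thesis using n by (simp add: order_def)
  qed
  ultimately have "p dvd card ?F" by (simp add: cong_dvd_iff)
  moreover have "?F = {\<one>}"
  proof -
    have "x = \<one>" if x: "x \<in> ?F" for x
    proof -
      have "g \<otimes> x = x \<otimes> g" if g: "g \<in> carrier G" for g
      proof -
        have "g \<otimes> x \<otimes> inv g \<otimes> g = x \<otimes> g" using x g by simp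
        then show ?thesis using x g by (simp add: m_assoc)
      qed
      then show ?thesis using no x by blast
    qed
    moreover have "\<one> \<in> ?F" by simp
    ultimately show ?thesis by blast
  qed
  ultimately show False using p_gt_1 by simp
qed

end

section \<open>Automorphisms of order prime to \<open>p\<close>\<close>

text \<open>In a \<open>p\<close>-group these are the maximal subgroups of \<open>Q\<close>; their
  intersection is the Frattini subgroup.\<close>

definition index_p_subgroup :: "('a, 'b) monoid_scheme \<Rightarrow> nat \<Rightarrow> 'a set \<Rightarrow> 'a set \<Rightarrow> bool" where
  "index_p_subgroup G p Q M \<longleftrightarrow> subgroup M G \<and> M \<subseteq> Q \<and> card Q = p * card M"

lemma carrier_BijGroup: "carrier (BijGroup Y) = Bij Y"
  by (simp add: BijGroup_def)

text \<open>Translates between group powers, used for orders, and iterates, used in all periodicity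
  hypotheses.\<close>

lemma BijGroup_pow:
  "f \<in> Bij Y \<Longrightarrow> x \<in> Y \<Longrightarrow> (f [^]\<^bsub>BijGroup Y\<^esub> (n::nat)) x = (f ^^ n) x"
proof (induction n arbitrary: x)
  case 0
  then show ?case by (simp add: BijGroup_def)
next
  case (Suc n)
  interpret B: group "BijGroup Y" by (rule group_BijGroup)
  have fn: "f [^]\<^bsub>BijGroup Y\<^esub> n \<in> Bij Y"
    using B.nat_pow_closed[of f n] Suc.prems by (simp only: carrier_BijGroup)
  have fx: "f x \<in> Y" using Suc.prems Bij_imp_funcset by blast
  have mult: "(g \<otimes>\<^bsub>BijGroup Y\<^esub> f) x = g (f x)" if "g \<in> Bij Y" for g
    using that Suc.prems by (simp add: BijGroup_def compose_def)
  have "(f [^]\<^bsub>BijGroup Y\<^esub> Suc n) x = (f [^]\<^bsub>BijGroup Y\<^esub> n) (f x)"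
    using mult[OF fn] by (simp only: Group.nat_pow_Suc)
  also have "\<dots> = (f ^^ n) (f x)" using Suc.IH[OF Suc.prems(1) fx] .
  finally show ?case by (simp only: funpow_Suc_right o_apply)
qed

lemma finite_Bij: "finite Y \<Longrightarrow> finite (Bij Y)"
proof -
  assume "finite Y"
  then have "finite (Y \<rightarrow>\<^sub>E Y)" by (intro finite_PiE) auto
  moreover have "Bij Y \<subseteq> (Y \<rightarrow>\<^sub>E Y)"
    by (auto simp: PiE_def Bij_imp_extensional dest: Bij_imp_funcset)
  ultimately show ?thesis by (rule rev_finite_subset)
qed

lemma (in group) hom_pow:
  assumes "\<alpha> \<in> hom G G" "x \<in> carrier G"
  shows "\<alpha> (x [^] (n::nat)) = \<alpha> x [^] n"
  using hom_nat_pow[OF assms is_group is_group] .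

lemma (in group) mult_right_eq_oneD:
  assumes "a = a \<otimes> b" "a \<in> carrier G" "b \<in> carrier G"
  shows "b = \<one>"
proof -
  have "a \<otimes> b = a \<otimes> \<one>" using assms by simp
  then show ?thesis using assms l_cancel[of a b \<one>] by blast
qed

lemma (in group) endo_simps:
  assumes "\<alpha> \<in> hom G G"
  shows "x \<in> carrier G \<Longrightarrow> \<alpha> x \<in> carrier G"
    and "x \<in> carrier G \<Longrightarrow> y \<in> carrier G \<Longrightarrow> \<alpha> (x \<otimes> y) = \<alpha> x \<otimes> \<alpha> y"
    and "\<alpha> \<one> = \<one>"
    and "x \<in> carrier G \<Longrightarrow> \<alpha> (inv x) = inv (\<alpha> x)"
proof -
  interpret group_hom G G \<alpha> using assms is_group by (simp add: group_hom_def group_hom_axioms_def)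
  show "x \<in> carrier G \<Longrightarrow> \<alpha> x \<in> carrier G" by simp
  show "x \<in> carrier G \<Longrightarrow> y \<in> carrier G \<Longrightarrow> \<alpha> (x \<otimes> y) = \<alpha> x \<otimes> \<alpha> y" by simp
  show "\<alpha> \<one> = \<one>" by simp
  show "x \<in> carrier G \<Longrightarrow> \<alpha> (inv x) = inv (\<alpha> x)" by simp
qed

section \<open>Maximal subgroups as kernels of homomorphisms to the integers modulo p\<close>

context finite_p_group
begin

lemma exists_index_p_subgroup:
  assumes "subgroup H G" "subgroup Q G" "H \<subset> Q"
  shows "\<exists>M. index_p_subgroup G p Q M \<and> H \<subseteq> M"
proof -
  obtain i j where ij: "card H = p ^ i" "card Q = p ^ j" using card_subgroup_power assms by meson
  have "card H < card Q" using assms finite_subgroup psubset_card_mono by blast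
  then have lt: "i < j" using ij power_less_imp_less_exp[of p i j] p_gt_1 by simp
  then obtain k where k: "j = Suc k" by (cases j) auto
  have "card H \<le> p ^ k" "p ^ k \<le> card Q" using ij lt k p_gt_1 by (auto intro: power_increasing)
  then obtain M where "subgroup M G" "H \<subseteq> M" "M \<subseteq> Q" "card M = p ^ k"
    using subgroup_of_card_between[of H Q k] assms by blast
  then show ?thesis using ij k by (auto simp: index_p_subgroup_def)
qed

text \<open>A homomorphism from \<open>Q\<close> onto the integers modulo \<open>p\<close> with
  kernel \<open>M\<close>, given by natural representatives, so that computations in
  \<open>Q/M\<close> become congruences. An element of value 1 generates \<open>Q/M\<close>.\<close>

definition index_hom :: "'a set \<Rightarrow> 'a set \<Rightarrow> ('a \<Rightarrow> nat) \<Rightarrow> bool" where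
  "index_hom Q M \<phi> \<longleftrightarrow> (\<forall>x\<in>Q. \<forall>y\<in>Q. [\<phi> (x \<otimes> y) = \<phi> x + \<phi> y] (mod p)) \<and>
     (\<forall>x\<in>Q. x \<in> M \<longleftrightarrow> p dvd \<phi> x) \<and> (\<exists>x\<in>Q. [\<phi> x = 1] (mod p))"

lemma index_homD:
  assumes "index_hom Q M \<phi>"
  shows "x \<in> Q \<Longrightarrow> y \<in> Q \<Longrightarrow> [\<phi> (x \<otimes> y) = \<phi> x + \<phi> y] (mod p)"
    and "x \<in> Q \<Longrightarrow> x \<in> M \<longleftrightarrow> p dvd \<phi> x"
    and "\<exists>x\<in>Q. [\<phi> x = 1] (mod p)"
  using assms by (auto simp: index_hom_def)

lemma index_hom_diff:
  assumes Q: "subgroup Q G" and \<phi>: "index_hom Q M \<phi>" and xy: "x \<in> Q" "y \<in> Q"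
  shows "inv x \<otimes> y \<in> M \<longleftrightarrow> [\<phi> x = \<phi> y] (mod p)"
proof -
  have G: "x \<in> carrier G" "y \<in> carrier G" using xy Q subgroup.mem_carrier by metis+
  have d: "inv x \<otimes> y \<in> Q" using xy Q by (simp add: subgroup.m_closed subgroup.m_inv_closed)
  have "[\<phi> (x \<otimes> (inv x \<otimes> y)) = \<phi> x + \<phi> (inv x \<otimes> y)] (mod p)"
    using index_homD(1)[OF \<phi> xy(1) d] .
  then have e: "[\<phi> y = \<phi> x + \<phi> (inv x \<otimes> y)] (mod p)" using G by (simp add: mult_inv_cancel)
  have "[\<phi> x = \<phi> y] (mod p) \<longleftrightarrow> [\<phi> x + 0 = \<phi> x + \<phi> (inv x \<otimes> y)] (mod p)"
    using e by (metis add_0_right cong_sym cong_trans)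
  also have "\<dots> \<longleftrightarrow> p dvd \<phi> (inv x \<otimes> y)"
    by (metis cong_0_iff cong_add_lcancel_nat cong_sym)
  finally show ?thesis using index_homD(2)[OF \<phi> d] by simp
qed

text \<open>For \<open>z\<close> in \<open>Q\<close> outside \<open>M\<close>, every element is
  \<open>m \<otimes> z [^] i\<close> with \<open>i\<close> unique modulo \<open>p\<close>; the
  exponent is the homomorphism, additive because \<open>z\<close> normalizes
  \<open>M\<close>.\<close>

lemma exists_index_hom:
  assumes Q: "subgroup Q G" and M: "index_p_subgroup G p Q M"
  shows "\<exists>\<phi>. index_hom Q M \<phi>"
proof -
  have Ms: "subgroup M G" and MQ: "M \<subseteq> Q" and c: "card Q = p * card M"
    using M by (auto simp: index_p_subgroup_def)
  have "card M > 0" using finite_subgroup[OF Ms] subgroup.one_closed[OF Ms] card_gt_0_iff by blast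
  then have "M \<noteq> Q" using c p_gt_1 by auto
  then obtain z where z: "z \<in> Q" "z \<notin> M" using MQ by blast
  have zG: "z \<in> carrier G" using z Q subgroup.mem_carrier by metis
  have MG: "m \<in> carrier G" if "m \<in> M" for m using that Ms subgroup.mem_carrier by metis
  have zp: "z [^] p \<in> M" using index_p_power[OF Ms Q MQ c z(1)] .
  have uniq: "[i = j] (mod p)" if "m \<in> M" "m' \<in> M" "m \<otimes> z [^] i = m' \<otimes> z [^] j" for m m' and i j :: nat
  proof -
    have main: "[i = j] (mod p)" if le: "i \<le> j" and m: "m \<in> M" "m' \<in> M"
      and eq: "m \<otimes> z [^] i = m' \<otimes> z [^] j" for m m' and i j :: nat
    proof -
      have "m' \<otimes> z [^] j = m' \<otimes> z [^] (j - i) \<otimes> z [^] i"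
        using le m MG zG by (simp add: m_assoc nat_pow_mult)
      then have "m = m' \<otimes> z [^] (j - i)" using eq m MG zG by simp
      then have "z [^] (j - i) = inv m' \<otimes> m" using m MG zG by (simp add: mult_inv_cancel)
      then have "z [^] (j - i) \<in> M" using m Ms by (simp add: subgroup.m_closed subgroup.m_inv_closed)
      then have "p dvd j - i" using pow_mem_iff[OF Ms zG z(2) zp] by simp
      then obtain t where "j - i = p * t" by (elim dvdE)
      then have "j = i + p * t" using le by simp
      then show ?thesis by (simp add: cong_def)
    qed
    show ?thesis
      using main[of i j m m'] main[of j i m' m] that cong_sym by (metis nle_le)
  qed
  \<comment> \<open>An arbitrary exponent is chosen; by \<open>uniq\<close> all choices agree modulo
    \<open>p\<close>.\<close>
  define \<phi> where "\<phi> x = (SOME i::nat. \<exists>m\<in>M. x = m \<otimes> z [^] i)" for x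
  have \<phi>: "\<exists>m\<in>M. x = m \<otimes> z [^] \<phi> x" if "x \<in> Q" for x
  proof -
    have "\<exists>i::nat. \<exists>m\<in>M. x = m \<otimes> z [^] i" using index_p_decomp[OF Ms Q MQ c z that] by blast
    from someI_ex[OF this] show ?thesis by (simp only: \<phi>_def)
  qed
  have "[\<phi> (x \<otimes> y) = \<phi> x + \<phi> y] (mod p)" if xy: "x \<in> Q" "y \<in> Q" for x y
  proof -
    obtain a b d where a: "a \<in> M" "x = a \<otimes> z [^] \<phi> x" and b: "b \<in> M" "y = b \<otimes> z [^] \<phi> y"
      and d: "d \<in> M" "x \<otimes> y = d \<otimes> z [^] \<phi> (x \<otimes> y)"
      using \<phi>[OF xy(1)] \<phi>[OF xy(2)] \<phi>[OF subgroup.m_closed[OF Q xy]] by blast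
    obtain b' where b': "b' \<in> M" "z [^] \<phi> x \<otimes> b = b' \<otimes> z [^] \<phi> x"
      using normalizes_swap(1)[OF Ms _ index_p_normalizes[OF Ms Q MQ c subgroup_pow[OF Q z(1)]] b(1)] zG
      by blast
    have "x \<otimes> y = (a \<otimes> z [^] \<phi> x) \<otimes> (b \<otimes> z [^] \<phi> y)" using a(2) b(2) by simp
    also have "\<dots> = a \<otimes> (z [^] \<phi> x \<otimes> b) \<otimes> z [^] \<phi> y"
      using a(1) b(1) MG zG by (simp add: m_assoc)
    also have "\<dots> = (a \<otimes> b') \<otimes> z [^] (\<phi> x + \<phi> y)"
      using a(1) b(1) b' MG zG by (simp add: m_assoc nat_pow_mult[symmetric])
    finally show ?thesis using uniq d a(1) b'(1) Ms subgroup.m_closed by metis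
  qed
  moreover have "x \<in> M \<longleftrightarrow> p dvd \<phi> x" if x: "x \<in> Q" for x
  proof -
    obtain m where m: "m \<in> M" "x = m \<otimes> z [^] \<phi> x" using \<phi>[OF x] by blast
    have "x \<in> M \<longleftrightarrow> z [^] \<phi> x \<in> M"
    proof
      assume "x \<in> M"
      then have "inv m \<otimes> x \<in> M" using m Ms by (simp add: subgroup.m_closed subgroup.m_inv_closed)
      moreover have "inv m \<otimes> (m \<otimes> z [^] \<phi> x) = z [^] \<phi> x" using m(1) MG zG by (simp add: mult_inv_cancel)
      ultimately show "z [^] \<phi> x \<in> M" using m(2) by simp
    next
      assume "z [^] \<phi> x \<in> M"
      then show "x \<in> M" using m Ms subgroup.m_closed by metis
    qed
    then show ?thesis using pow_mem_iff[OF Ms zG z(2) zp] by simp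
  qed
  moreover have "[\<phi> z = 1] (mod p)"
  proof -
    obtain m where m: "m \<in> M" "z = m \<otimes> z [^] \<phi> z" using \<phi>[OF z(1)] by blast
    have "m \<otimes> z [^] \<phi> z = \<one> \<otimes> z [^] (1::nat)" using m(2) zG by simp
    then show ?thesis using uniq[OF m(1) subgroup.one_closed[OF Ms]] by blast
  qed
  ultimately have "index_hom Q M \<phi>" using z unfolding index_hom_def by blast
  then show ?thesis by blast
qed

section \<open>Fixed points of automorphisms of prime period q different from p\<close>

lemma pow_coprime_eq_one:
  assumes "x \<in> carrier G" "x [^] q = \<one>" "Factorial_Ring.prime q" "q \<noteq> p"
  shows "x = \<one>"
proof -
  obtain n where "x [^] (p ^ n) = \<one>" using pow_card_eq_one assms(1) by blast
  then have "ord x dvd q" "ord x dvd p ^ n" using assms pow_eq_id by auto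
  moreover have "coprime q (p ^ n)"
    using primes_coprime[OF assms(3) prime_p assms(4)] by simp
  ultimately have "ord x = 1" using coprime_common_divisor[of q "p ^ n" "ord x"] by simp
  then show ?thesis using assms ord_eq_1 by simp
qed

definition coprime_aut :: "nat \<Rightarrow> ('a \<Rightarrow> 'a) \<Rightarrow> bool" where
  "coprime_aut q \<alpha> \<longleftrightarrow> Factorial_Ring.prime q \<and> q \<noteq> p \<and> \<alpha> \<in> hom G G \<and> (\<forall>x\<in>carrier G. (\<alpha> ^^ q) x = x)"

lemma coprime_autD:
  assumes "coprime_aut q \<alpha>"
  shows "Factorial_Ring.prime q" "q \<noteq> p" "\<alpha> \<in> hom G G" "x \<in> carrier G \<Longrightarrow> (\<alpha> ^^ q) x = x"
    "x \<in> carrier G \<Longrightarrow> \<alpha> x \<in> carrier G"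
  using assms endo_simps(1)[of \<alpha>] by (auto simp: coprime_aut_def)

lemma coprime_aut_inj:
  assumes "coprime_aut q \<alpha>"
  shows "inj_on \<alpha> (carrier G)"
proof
  fix x y assume xy: "x \<in> carrier G" "y \<in> carrier G" "\<alpha> x = \<alpha> y"
  have "q > 0" using coprime_autD(1)[OF assms] prime_gt_0_nat by blast
  then obtain r where "q = Suc r" by (cases q) auto
  then have "(\<alpha> ^^ q) x = (\<alpha> ^^ q) y" using xy by (simp only: funpow_Suc_right o_apply)
  then show "x = y" using coprime_autD(4)[OF assms] xy by simp
qed

text \<open>With \<open>c = inv x \<otimes> \<alpha> x\<close> fixed, iteration gives
  \<open>\<alpha>^n x = x \<otimes> c^n\<close>. The period forces \<open>c^q\<close> to be trivial,
  and so \<open>c\<close> is trivial in a \<open>p\<close>-group.\<close>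

lemma coprime_aut_fix_commutator:
  assumes \<alpha>: "coprime_aut q \<alpha>" and x: "x \<in> carrier G" and fx: "\<alpha> (inv x \<otimes> \<alpha> x) = inv x \<otimes> \<alpha> x"
  shows "\<alpha> x = x"
proof -
  let ?c = "inv x \<otimes> \<alpha> x"
  have cG: "?c \<in> carrier G" using x coprime_autD[OF \<alpha>] by simp
  have \<alpha>x: "\<alpha> x = x \<otimes> ?c" using x coprime_autD(5)[OF \<alpha>] by (simp add: mult_inv_cancel)
  have "(\<alpha> ^^ n) x = x \<otimes> ?c [^] n" for n
  proof (induction n)
    case 0
    then show ?case using x by simp
  next
    case (Suc n)
    have "(\<alpha> ^^ Suc n) x = \<alpha> (x \<otimes> ?c [^] n)" using Suc by simp
    also have "\<dots> = \<alpha> x \<otimes> \<alpha> ?c [^] n"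
      using x cG endo_simps(2)[OF coprime_autD(3)[OF \<alpha>]] hom_pow[OF coprime_autD(3)[OF \<alpha>]] by simp
    also have "\<dots> = (x \<otimes> ?c) \<otimes> ?c [^] n" by (simp only: fx \<alpha>x[symmetric])
    also have "\<dots> = x \<otimes> (?c \<otimes> ?c [^] n)" by (rule m_assoc) (use x cG in auto)
    also have "?c \<otimes> ?c [^] n = ?c [^] Suc n" using cG by (simp add: nat_pow_Suc2[symmetric] del: nat_pow_Suc)
    finally show ?case .
  qed
  then have "x \<otimes> ?c [^] q = x" using coprime_autD(4)[OF \<alpha> x] by simp
  then have "?c [^] q = \<one>" using x cG by (simp add: r_cancel_one')
  then have "?c = \<one>" using pow_coprime_eq_one cG coprime_autD[OF \<alpha>] by blast
  then show ?thesis using \<alpha>x x by simp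
qed

lemma subgroup_fixed:
  assumes \<alpha>: "\<alpha> \<in> hom G G" and H: "subgroup H G"
  shows "subgroup {x \<in> H. \<alpha> x = x} G"
proof (rule finite_subgroupI)
  have HG: "H \<subseteq> carrier G" using H subgroup.subset by blast
  show "finite {x \<in> H. \<alpha> x = x}" using finite_subgroup[OF H] by simp
  show "{x \<in> H. \<alpha> x = x} \<subseteq> carrier G" using HG by blast
  have "\<one> \<in> {x \<in> H. \<alpha> x = x}" using endo_simps(3)[OF \<alpha>] H subgroup.one_closed by auto
  then show "{x \<in> H. \<alpha> x = x} \<noteq> {}" by blast
  fix x y assume "x \<in> {x \<in> H. \<alpha> x = x}" "y \<in> {x \<in> H. \<alpha> x = x}"
  then show "x \<otimes> y \<in> {x \<in> H. \<alpha> x = x}"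
    using endo_simps(2)[OF \<alpha>] subgroup.m_closed[OF H] by (simp add: subsetD[OF HG])
qed

text \<open>\<open>\<alpha>\<close> permutes the coset of \<open>x\<close>, whose size is a power of
  \<open>p\<close>, with prime period \<open>q\<close>; the number of fixed points is therefore
  nonzero modulo \<open>q\<close>.\<close>

lemma coprime_aut_fixed_in_coset:
  assumes \<alpha>: "coprime_aut q \<alpha>" and M: "subgroup M G" and inv: "\<alpha> ` M \<subseteq> M"
    and x: "x \<in> carrier G" and xM: "inv x \<otimes> \<alpha> x \<in> M"
  shows "\<exists>m\<in>M. \<alpha> (x \<otimes> m) = x \<otimes> m"
proof -
  let ?Y = "(\<lambda>m. x \<otimes> m) ` M"
  have MG: "M \<subseteq> carrier G" using M subgroup.subset by blast
  have q: "Factorial_Ring.prime q" "q \<noteq> p" using coprime_autD[OF \<alpha>] by auto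
  have "[card {y \<in> ?Y. \<alpha> y = y} = card ?Y] (mod q)"
  proof (rule prime_period_fixed_points[OF q(1)])
    show "finite ?Y" using finite_subgroup[OF M] by simp
    show "(\<alpha> ^^ q) y = y" if "y \<in> ?Y" for y using that coprime_autD(4)[OF \<alpha>] x MG by auto
    fix y assume "y \<in> ?Y"
    then obtain m where m: "m \<in> M" "y = x \<otimes> m" by blast
    have mG: "m \<in> carrier G" "\<alpha> m \<in> carrier G" "\<alpha> x \<in> carrier G"
      using m(1) x MG coprime_autD(5)[OF \<alpha>] by blast+
    have "\<alpha> y = \<alpha> x \<otimes> \<alpha> m"
      unfolding m(2) by (rule endo_simps(2)[OF coprime_autD(3)[OF \<alpha>] x mG(1)])
    also have "\<dots> = x \<otimes> ((inv x \<otimes> \<alpha> x) \<otimes> \<alpha> m)"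
      using x mG by (simp add: m_assoc mult_inv_cancel)
    finally have "\<alpha> y = x \<otimes> ((inv x \<otimes> \<alpha> x) \<otimes> \<alpha> m)" .
    moreover have "(inv x \<otimes> \<alpha> x) \<otimes> \<alpha> m \<in> M"
      using subgroup.m_closed[OF M xM] m inv by blast
    ultimately show "\<alpha> y \<in> ?Y" by blast
  qed
  moreover have "card ?Y = card M" using x MG by (intro card_image) (auto simp: inj_on_def subset_iff)
  moreover obtain k where "card M = p ^ k" using card_subgroup_power M by blast
  moreover have "\<not> q dvd p ^ k"
    using q prime_p by (metis prime_dvd_power primes_dvd_imp_eq)
  ultimately have "\<not> q dvd card {y \<in> ?Y. \<alpha> y = y}" by (simp add: cong_dvd_iff)
  then have "{y \<in> ?Y. \<alpha> y = y} \<noteq> {}" by (metis card.empty dvd_0_right)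
  then show ?thesis by blast
qed

text \<open>If the fixed points in \<open>Q\<close> were proper, they would lie in a maximal
  \<open>M\<close>; but \<open>\<alpha>\<close> is trivial on \<open>Q/M\<close>, so cosets other
  than \<open>M\<close> contain fixed points too.\<close>

lemma coprime_aut_trivial_mod_index_p:
  assumes \<alpha>: "coprime_aut q \<alpha>" and Q: "subgroup Q G"
    and inv: "\<And>M. index_p_subgroup G p Q M \<Longrightarrow> \<alpha> ` M \<subseteq> M"
    and triv: "\<And>M x. index_p_subgroup G p Q M \<Longrightarrow> x \<in> Q \<Longrightarrow> inv x \<otimes> \<alpha> x \<in> M"
    and x: "x \<in> Q"
  shows "\<alpha> x = x"
proof (rule ccontr)
  assume ne: "\<alpha> x \<noteq> x"
  let ?F = "{x \<in> Q. \<alpha> x = x}"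
  have "subgroup ?F G" by (rule subgroup_fixed[OF coprime_autD(3)[OF \<alpha>] Q])
  then obtain M where M: "index_p_subgroup G p Q M" "?F \<subseteq> M"
    using exists_index_p_subgroup[OF _ Q, of ?F] ne x by blast
  have Ms: "subgroup M G" "M \<subseteq> Q" "card Q = p * card M" using M(1) by (auto simp: index_p_subgroup_def)
  have "card M > 0" using finite_subgroup[OF Ms(1)] subgroup.one_closed[OF Ms(1)] card_gt_0_iff by blast
  then have "M \<noteq> Q" using Ms p_gt_1 by auto
  then obtain y where y: "y \<in> Q" "y \<notin> M" using Ms by blast
  have yG: "y \<in> carrier G" using y Q subgroup.mem_carrier by metis
  obtain m where m: "m \<in> M" "\<alpha> (y \<otimes> m) = y \<otimes> m"
    using coprime_aut_fixed_in_coset[OF \<alpha> Ms(1) inv[OF M(1)] yG triv[OF M(1) y(1)]] by blast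
  have "y \<otimes> m \<in> ?F" using m y Ms(2) subgroup.m_closed[OF Q] by blast
  then have "y \<otimes> m \<in> M" using M by blast
  then have "(y \<otimes> m) \<otimes> inv m \<in> M" using m Ms by (metis subgroup.m_closed subgroup.m_inv_closed)
  moreover have "(y \<otimes> m) \<otimes> inv m = y" using yG subgroup.mem_carrier[OF Ms(1) m(1)] by (simp add: m_assoc)
  ultimately show False using y by simp
qed

text \<open>Iterates are included because the inverse of \<open>\<alpha>\<close> is available as
  \<open>\<alpha>^(q - 1)\<close>.\<close>

lemma coprime_aut_image_index_p:
  assumes \<alpha>: "coprime_aut q \<alpha>" and H: "subgroup H G" and inv: "\<alpha> ` H \<subseteq> H" and M: "index_p_subgroup G p H M"
  shows "index_p_subgroup G p H ((\<alpha> ^^ n) ` M)"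
proof (induction n)
  case 0
  then show ?case using M by simp
next
  case (Suc n)
  let ?M = "(\<alpha> ^^ n) ` M"
  have M': "subgroup ?M G" "?M \<subseteq> H" "card H = p * card ?M" using Suc by (auto simp: index_p_subgroup_def)
  interpret group_hom G G \<alpha>
    using coprime_autD(3)[OF \<alpha>] is_group by (simp add: group_hom_def group_hom_axioms_def)
  have "subgroup (\<alpha> ` ?M) G" using subgroup_img_is_subgroup[OF M'(1)] .
  moreover have "\<alpha> ` ?M \<subseteq> H" using M' inv by blast
  moreover have "card (\<alpha> ` ?M) = card ?M"
    by (rule card_image, rule inj_on_subset[OF coprime_aut_inj[OF \<alpha>]]) (use M' H subgroup.subset in blast)
  ultimately have "index_p_subgroup G p H (\<alpha> ` ?M)" using M' by (simp add: index_p_subgroup_def)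
  then show ?case by (simp add: image_image)
qed

text \<open>The Frattini subgroup \<open>\<Phi>\<close> of a minimal counterexample \<open>H\<close> is fixed pointwise, so all
  \<open>x\<inverse> \<alpha>(x)\<close> centralize it. Either its centralizer is proper, hence fixed, or \<open>\<Phi>\<close> is central,
  \<open>H\<close> has class two and \<open>x\<inverse> \<alpha>(x)\<close> has order \<open>p\<close>; in both cases \<open>\<alpha>\<close> fixes \<open>x\<inverse> \<alpha>(x)\<close>.\<close>

lemma coprime_aut_trivial_of_omega:
  assumes odd: "odd p" and \<alpha>: "coprime_aut q \<alpha>"
    and om: "\<And>x. \<lbrakk>x \<in> carrier G; x [^] p = \<one>\<rbrakk> \<Longrightarrow> \<alpha> x = x"
    and H: "subgroup H G" and inv: "\<alpha> ` H \<subseteq> H" and x: "x \<in> H"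
  shows "\<alpha> x = x"
  using H inv x
proof (induction "card H" arbitrary: H x rule: less_induct)
  case less
  note H = less.prems(1) and inv = less.prems(2)
  note hm = coprime_autD(3)[OF \<alpha>]
  have HG: "H \<subseteq> carrier G" using H subgroup.subset by blast
  have IH: "\<alpha> y = y" if "subgroup K G" "K \<subset> H" "\<alpha> ` K \<subseteq> K" "y \<in> K" for K y
    using less.hyps[of K y] that finite_subgroup[OF H] psubset_card_mono by blast
  show ?case
  proof (cases "H = {\<one>}")
    case True
    then show ?thesis using less.prems endo_simps(3)[OF hm] by simp
  next
    case False
    define \<Phi> where "\<Phi> = {x \<in> H. \<forall>M. index_p_subgroup G p H M \<longrightarrow> x \<in> M}"
    have \<Phi>M: "y \<in> M" if "y \<in> \<Phi>" "index_p_subgroup G p H M" for y M using that by (auto simp: \<Phi>_def)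
    have ips: "subgroup M G" "M \<subseteq> H" "card H = p * card M" if "index_p_subgroup G p H M" for M
      using that by (auto simp: index_p_subgroup_def)
    have \<Phi>H: "\<Phi> \<subseteq> H" by (auto simp: \<Phi>_def)
    have \<Phi>s: "subgroup \<Phi> G"
    proof (rule finite_subgroupI)
      show "finite \<Phi>" using finite_subgroup[OF H] \<Phi>H finite_subset by blast
      show "\<Phi> \<subseteq> carrier G" using \<Phi>H HG by blast
      have "\<one> \<in> \<Phi>" using H ips(1) subgroup.one_closed by (fastforce simp: \<Phi>_def)
      then show "\<Phi> \<noteq> {}" by blast
      show "\<And>x y. x \<in> \<Phi> \<Longrightarrow> y \<in> \<Phi> \<Longrightarrow> x \<otimes> y \<in> \<Phi>"
        using H ips(1) subgroup.m_closed unfolding \<Phi>_def by fast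
    qed
    have "{\<one>} \<subset> H" using False subgroup.one_closed[OF H] by blast
    then obtain M0 where M0: "index_p_subgroup G p H M0"
      using exists_index_p_subgroup[OF triv_subgroup H] by blast
    have "M0 \<noteq> H"
    proof -
      have "card M0 > 0" using finite_subgroup ips(1)[OF M0] subgroup.one_closed card_gt_0_iff by blast
      then show ?thesis using ips(3)[OF M0] p_gt_1 by auto
    qed
    then have \<Phi>ne: "\<Phi> \<subset> H" using \<Phi>M[OF _ M0] ips(2)[OF M0] \<Phi>H by blast
    have \<Phi>inv: "\<alpha> ` \<Phi> \<subseteq> \<Phi>"
    proof
      fix z assume "z \<in> \<alpha> ` \<Phi>"
      then obtain y where y: "y \<in> \<Phi>" "z = \<alpha> y" by blast
      have "z \<in> M" if M: "index_p_subgroup G p H M" for M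
      proof -
        have "q > 0" using coprime_autD(1)[OF \<alpha>] prime_gt_0_nat by blast
        then obtain r where r: "q = Suc r" by (cases q) auto
        \<comment> \<open>\<open>\<alpha>^r\<close> inverts \<open>\<alpha>\<close>, so
          \<open>y\<close> is tested against the preimage of \<open>M\<close> under
          \<open>\<alpha>\<close>, again a maximal subgroup.\<close>
        have "y \<in> (\<alpha> ^^ r) ` M" using \<Phi>M[OF y(1) coprime_aut_image_index_p[OF \<alpha> H inv M]] .
        then obtain m where m: "m \<in> M" "y = (\<alpha> ^^ r) m" by blast
        then have "z = (\<alpha> ^^ q) m" using y r by simp
        then show ?thesis using m coprime_autD(4)[OF \<alpha>] ips[OF M] HG by auto
      qed
      moreover have "z \<in> H" using y \<Phi>H inv by blast
      ultimately show "z \<in> \<Phi>" by (auto simp: \<Phi>_def)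
    qed
    have \<Phi>fix: "\<alpha> y = y" if "y \<in> \<Phi>" for y using IH[OF \<Phi>s \<Phi>ne \<Phi>inv that] .
    have \<Phi>norm: "normalizes y \<Phi>" if y: "y \<in> H" for y
    proof -
      have "y \<otimes> h \<otimes> inv y \<in> \<Phi>" if h: "h \<in> \<Phi>" for h
      proof -
        have "y \<otimes> h \<otimes> inv y \<in> H" using y h \<Phi>H H by (meson subgroup.m_closed subgroup.m_inv_closed subsetD)
        moreover have "y \<otimes> h \<otimes> inv y \<in> M" if M: "index_p_subgroup G p H M" for M
          using index_p_normalizes[OF ips(1)[OF M] H ips(2,3)[OF M] y] \<Phi>M[OF h M] normalizes_closed by blast
        ultimately show ?thesis by (auto simp: \<Phi>_def)
      qed
      then show ?thesis by (simp add: normalizes_def)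
    qed
    let ?c = "\<lambda>y. inv y \<otimes> \<alpha> y"
    have cH: "?c y \<in> H" if "y \<in> H" for y
      using that inv H by (meson image_subset_iff subgroup.m_closed subgroup.m_inv_closed)
    \<comment> \<open>The conjugate of \<open>z\<close> by \<open>y\<close> lies in
      \<open>\<Phi>\<close> and is fixed, so \<open>y\<close> and \<open>\<alpha> y\<close>
      conjugate \<open>z\<close> in the same way.\<close>
    have ccent: "?c y \<otimes> z = z \<otimes> ?c y" if yz: "y \<in> H" "z \<in> \<Phi>" for y z
    proof -
      have yG: "y \<in> carrier G" "z \<in> carrier G" "\<alpha> y \<in> carrier G"
        using yz HG \<Phi>H coprime_autD(5)[OF \<alpha>] by blast+
      have "\<alpha> (y \<otimes> z \<otimes> inv y) = y \<otimes> z \<otimes> inv y"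
        using \<Phi>fix normalizes_closed[OF \<Phi>norm[OF yz(1)] yz(2)] by blast
      then have e: "\<alpha> y \<otimes> z \<otimes> inv (\<alpha> y) = y \<otimes> z \<otimes> inv y"
        using endo_simps[OF hm] yG \<Phi>fix[OF yz(2)] by simp
      have "\<alpha> y \<otimes> z = \<alpha> y \<otimes> z \<otimes> inv (\<alpha> y) \<otimes> \<alpha> y" using yG by (simp add: m_assoc)
      also have "\<dots> = y \<otimes> (z \<otimes> (inv y \<otimes> \<alpha> y))" using yG by (simp only: e) (simp add: m_assoc)
      finally have "inv y \<otimes> (\<alpha> y \<otimes> z) = z \<otimes> (inv y \<otimes> \<alpha> y)" using yG by (simp add: mult_inv_cancel)
      then show ?thesis using yG by (simp add: m_assoc)
    qed
    let ?C = "{y \<in> H. \<forall>z\<in>\<Phi>. y \<otimes> z = z \<otimes> y}"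
    have Cs: "subgroup ?C G"
    proof (rule finite_subgroupI)
      show "finite ?C" using finite_subgroup[OF H] by simp
      show "?C \<subseteq> carrier G" using HG by blast
      have "\<one> \<in> ?C" using H subgroup.one_closed \<Phi>H HG by fastforce
      then show "?C \<noteq> {}" by blast
      fix a b assume ab: "a \<in> ?C" "b \<in> ?C"
      have "a \<otimes> b \<otimes> z = z \<otimes> (a \<otimes> b)" if z: "z \<in> \<Phi>" for z
      proof -
        have G: "a \<in> carrier G" "b \<in> carrier G" "z \<in> carrier G" using ab z HG \<Phi>H by blast+
        have "a \<otimes> b \<otimes> z = a \<otimes> (b \<otimes> z)" using G by (simp add: m_assoc)
        also have "b \<otimes> z = z \<otimes> b" using ab z by blast
        also have "a \<otimes> (z \<otimes> b) = (a \<otimes> z) \<otimes> b" using G by (simp add: m_assoc)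
        also have "a \<otimes> z = z \<otimes> a" using ab z by blast
        finally show ?thesis using G by (simp add: m_assoc)
      qed
      then show "a \<otimes> b \<in> ?C" using ab H subgroup.m_closed by auto
    qed
    have Cinv: "\<alpha> ` ?C \<subseteq> ?C"
    proof
      fix w assume "w \<in> \<alpha> ` ?C"
      then obtain y where y: "y \<in> ?C" "w = \<alpha> y" by blast
      have "w \<otimes> z = z \<otimes> w" if z: "z \<in> \<Phi>" for z
      proof -
        have "\<alpha> (y \<otimes> z) = \<alpha> (z \<otimes> y)" using y z by simp
        moreover have "y \<in> carrier G" "z \<in> carrier G" using y z HG \<Phi>H by blast+
        ultimately show ?thesis using y(2) \<Phi>fix[OF z] endo_simps(2)[OF hm] by simp
      qed
      then show "w \<in> ?C" using y inv by blast
    qed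
    have "\<alpha> (?c x) = ?c x"
    proof (cases "?C = H")
      case False
      then have "?C \<subset> H" by blast
      moreover have "?c x \<in> ?C" using cH ccent less.prems(3) by blast
      ultimately show ?thesis using IH[OF Cs _ Cinv] by blast
    next
      case True
      have cen: "y \<otimes> z = z \<otimes> y" if "y \<in> H" "z \<in> \<Phi>" for y z using True that by blast
      have pw: "y [^] p \<in> \<Phi>" if y: "y \<in> H" for y
      proof -
        have "y [^] p \<in> M" if M: "index_p_subgroup G p H M" for M
          using index_p_power[OF ips(1)[OF M] H ips(2,3)[OF M] y] .
        then show ?thesis using subgroup_pow[OF H y] by (auto simp: \<Phi>_def)
      qed
      have comm: "inv (a \<otimes> b) \<otimes> (b \<otimes> a) \<in> \<Phi>" if ab: "a \<in> H" "b \<in> H" for a b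
      proof -
        have G: "a \<in> carrier G" "b \<in> carrier G" using ab HG by auto
        have "inv (a \<otimes> b) \<otimes> (b \<otimes> a) \<in> M" if M: "index_p_subgroup G p H M" for M
        proof -
          obtain \<phi> where \<phi>: "index_hom H M \<phi>" using exists_index_hom[OF H M] by blast
          have "[\<phi> (a \<otimes> b) = \<phi> (b \<otimes> a)] (mod p)"
            using index_homD(1)[OF \<phi> ab] index_homD(1)[OF \<phi> ab(2,1)]
            by (metis add.commute cong_sym cong_trans)
          then show ?thesis using index_hom_diff[OF H \<phi>] ab H subgroup.m_closed by metis
        qed
        then show ?thesis using ab H by (simp add: \<Phi>_def subgroup.m_closed subgroup.m_inv_closed)
      qed
      let ?x = "inv x" and ?y = "\<alpha> x"
      let ?k = "inv (?x \<otimes> ?y) \<otimes> (?y \<otimes> ?x)"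
      have xH: "?x \<in> H" "?y \<in> H" using less.prems inv H subgroup.m_inv_closed by auto
      have G: "x \<in> carrier G" "?x \<in> carrier G" "?y \<in> carrier G" using xH HG less.prems by auto
      have k: "?k \<in> \<Phi>" using comm xH by blast
      have kG: "?k \<in> carrier G" using G by simp
      have e1: "?y \<otimes> ?x = ?x \<otimes> ?y \<otimes> ?k" using G by (simp add: group_word_simps)
      have e2: "?k \<otimes> ?x = ?x \<otimes> ?k" "?k \<otimes> ?y = ?y \<otimes> ?k" using cen[OF _ k] xH by metis+
      \<comment> \<open>\<open>?y [^] p\<close> lies in \<open>\<Phi>\<close>, which is central
        here, so the commutator factor \<open>?k [^] p\<close> must be trivial.\<close>
      have "?y [^] p \<otimes> ?x = ?x \<otimes> ?y [^] p \<otimes> ?k [^] p"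
        by (rule pow_mult_class_two(3)[OF G(2,3) kG e1 e2])
      moreover have "?y [^] p \<otimes> ?x = ?x \<otimes> ?y [^] p" using cen[OF xH(1) pw[OF xH(2)]] by (rule sym)
      ultimately have "?x \<otimes> ?y [^] p = ?x \<otimes> ?y [^] p \<otimes> ?k [^] p" by (simp only:)
      then have kp: "?k [^] p = \<one>" by (rule mult_right_eq_oneD) (use G kG in auto)
      have "?c x [^] p = ?x [^] p \<otimes> ?y [^] p"
        by (rule pow_mult_class_two_odd[OF G(2,3) kG e1 e2 odd kp])
      also have "?y [^] p = \<alpha> (x [^] p)" using hom_pow[OF hm G(1)] by simp
      also have "\<dots> = x [^] p" using \<Phi>fix pw less.prems by blast
      also have "?x [^] p \<otimes> x [^] p = \<one>" using G by (simp add: nat_pow_inv)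
      finally have "?c x [^] p = \<one>" .
      then show ?thesis using om[of "?c x"] G by simp
    qed
    then show ?thesis using coprime_aut_fix_commutator[OF \<alpha>] less.prems HG by blast
  qed
qed

end

section \<open>Coprime automorphisms that preserve all maximal subgroups\<close>

context finite_p_group
begin

text \<open>Modulo \<open>A \<inter> B\<close> the group \<open>Q\<close> is a plane whose lines are
  preserved. A linear map preserving the lines of \<open>a\<close>, \<open>b\<close> and
  \<open>a \<otimes> b\<close> is a scalar, and it is 1 on the line of \<open>A\<close>. So
  \<open>inv b \<otimes> \<alpha> b\<close> lies in \<open>A\<close> and is fixed, which forces
  \<open>b\<close> to be fixed.\<close>

lemma coprime_aut_trivial_on_adjacent:
  assumes \<alpha>: "coprime_aut q \<alpha>" and Q: "subgroup Q G"
    and A: "index_p_subgroup G p Q A" and B: "index_p_subgroup G p Q B" and AB: "A \<noteq> B"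
    and inv: "\<And>M. index_p_subgroup G p Q M \<Longrightarrow> \<alpha> ` M \<subseteq> M"
    and triv: "\<And>x. x \<in> A \<Longrightarrow> \<alpha> x = x" and x: "x \<in> Q"
  shows "\<alpha> x = x"
proof -
  note hm = coprime_autD(3)[OF \<alpha>]
  have As: "subgroup A G" "A \<subseteq> Q" "card Q = p * card A" using A by (auto simp: index_p_subgroup_def)
  have Bs: "subgroup B G" "B \<subseteq> Q" "card Q = p * card B" using B by (auto simp: index_p_subgroup_def)
  have QG: "y \<in> carrier G" if "y \<in> Q" for y using that Q subgroup.mem_carrier by metis
  have cAB: "card A = card B" using As Bs p_gt_1 by simp
  obtain b where b: "b \<in> B" "b \<notin> A"
    using cAB AB subgroup_eqI_card[OF As(1), of B] by auto
  obtain a where a: "a \<in> A" "a \<notin> B"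
    using cAB AB subgroup_eqI_card[OF Bs(1), of A] by auto
  have aQ: "a \<in> Q" and bQ: "b \<in> Q" using a b As Bs by auto
  have aG: "a \<in> carrier G" and bG: "b \<in> carrier G" using aQ bQ QG by auto
  let ?D = "A \<inter> B"
  have Ds: "subgroup ?D G" using As Bs subgroups_Inter_pair by blast
  have abQ: "a \<otimes> b \<in> Q" using aQ bQ Q subgroup.m_closed by metis
  have abG: "a \<otimes> b \<in> carrier G" using abQ QG by blast
  have abA: "a \<otimes> b \<notin> A"
  proof
    assume "a \<otimes> b \<in> A"
    then have "inv a \<otimes> (a \<otimes> b) \<in> A" using a As subgroup.m_closed[OF As(1)] subgroup.m_inv_closed[OF As(1)] by blast
    then show False using b aG bG by (simp add: mult_inv_cancel)
  qed
  have nD: "normalizes (a \<otimes> b) ?D"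
    using index_p_normalizes[OF As(1) Q As(2,3) abQ] index_p_normalizes[OF Bs(1) Q Bs(2,3) abQ]
    by (simp add: normalizes_def)
  have pD: "(a \<otimes> b) [^] p \<in> ?D"
    using index_p_power[OF As(1) Q As(2,3) abQ] index_p_power[OF Bs(1) Q Bs(2,3) abQ] by blast
  let ?E = "adjoin ?D (a \<otimes> b)"
  have Es: "subgroup ?E G" "?D \<subseteq> ?E" "a \<otimes> b \<in> ?E" "card ?E = p * card ?D"
    using subgroup_adjoin[OF Ds abG nD] adjoin_incl[OF Ds abG nD] card_adjoin[OF Ds abG nD _ pD] abA by auto
  have "p * card ?D dvd card A" using card_mult_p_le[OF Ds As(1)] a by blast
  moreover have c0: "card A > 0" using finite_subgroup[OF As(1)] a card_gt_0_iff by blast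
  ultimately have "card ?E \<le> card A" using Es(4) by (simp add: dvd_imp_le)
  also have "\<dots> < card Q" using As(3) c0 p_gt_1 by simp
  finally have "?E \<noteq> Q" by blast
  moreover have "?E \<subseteq> Q" using adjoin_least[OF Q] As abQ by blast
  \<comment> \<open>\<open>M\<close> is the third line, through
    \<open>a \<otimes> b\<close>.\<close>
  ultimately obtain M where M: "index_p_subgroup G p Q M" "?E \<subseteq> M"
    using exists_index_p_subgroup[OF Es(1) Q] by blast
  have Ms: "subgroup M G" "M \<subseteq> Q" "card Q = p * card M" using M by (auto simp: index_p_subgroup_def)
  let ?c = "inv b \<otimes> \<alpha> b"
  have \<alpha>b: "\<alpha> b \<in> B" using inv[OF B] b by blast
  have \<alpha>bG: "\<alpha> b \<in> carrier G" using coprime_autD(5)[OF \<alpha> bG] .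
  have cB: "?c \<in> B" using \<alpha>b b subgroup.m_closed[OF Bs(1)] subgroup.m_inv_closed[OF Bs(1)] by blast
  have cG: "?c \<in> carrier G" using cB Bs QG by blast
  have cM: "?c \<in> M"
  proof -
    have "\<alpha> (a \<otimes> b) \<in> M" using inv[OF M(1)] M(2) Es(3) by blast
    then have "inv (a \<otimes> b) \<otimes> \<alpha> (a \<otimes> b) \<in> M"
      using M(2) Es(3) subgroup.m_closed[OF Ms(1)] subgroup.m_inv_closed[OF Ms(1)] by blast
    moreover have "\<alpha> (a \<otimes> b) = a \<otimes> \<alpha> b" using endo_simps(2)[OF hm aG bG] triv[OF a(1)] by simp
    ultimately show ?thesis using aG bG \<alpha>bG by (simp add: group_word_simps)
  qed
  \<comment> \<open>The lines of \<open>B\<close> and \<open>M\<close> meet only in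
    \<open>A \<inter> B\<close>: otherwise \<open>M\<close> would absorb \<open>b\<close>, then
    \<open>a\<close>, then all of \<open>Q\<close>.\<close>
  have "?c \<in> A"
  proof (rule ccontr)
    assume cA: "?c \<notin> A"
    obtain a1 i where a1: "a1 \<in> A" "b = a1 \<otimes> ?c [^] (i::nat)"
      using index_p_decomp[OF As(1) Q As(2,3) _ cA bQ] cB Bs by blast
    have a1G: "a1 \<in> carrier G" using a1 As QG by blast
    have "a1 = b \<otimes> inv (?c [^] i)" using a1G cG by (subst a1(2)) (simp add: m_assoc)
    then have "a1 \<in> B"
      using b(1) subgroup_pow[OF Bs(1) cB] subgroup.m_closed[OF Bs(1)] subgroup.m_inv_closed[OF Bs(1)] by simp
    then have "a1 \<in> M" using a1 Es(2) M(2) by blast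
    then have bM: "b \<in> M" using a1(2) subgroup_pow[OF Ms(1) cM] subgroup.m_closed[OF Ms(1)] by metis
    have "(a \<otimes> b) \<otimes> inv b \<in> M"
      using bM Es(3) M(2) subgroup.m_closed[OF Ms(1)] subgroup.m_inv_closed[OF Ms(1)] by blast
    then have aM: "a \<in> M" using aG bG by (simp add: m_assoc)
    have AM: "A \<subseteq> M"
    proof
      fix y assume y: "y \<in> A"
      obtain b' j where b': "b' \<in> B" "y = b' \<otimes> a [^] (j::nat)"
        using index_p_decomp[OF Bs(1) Q Bs(2,3) aQ a(2)] y As by blast
      have b'G: "b' \<in> carrier G" using b' Bs QG by blast
      have "b' = y \<otimes> inv (a [^] j)" using b'G aG by (subst b'(2)) (simp add: m_assoc)
      then have "b' \<in> A"
        using y subgroup_pow[OF As(1) a(1)] subgroup.m_closed[OF As(1)] subgroup.m_inv_closed[OF As(1)] by simp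
      then have "b' \<in> M" using b' Es(2) M(2) by blast
      then show "y \<in> M" using b'(2) subgroup_pow[OF Ms(1) aM] subgroup.m_closed[OF Ms(1)] by metis
    qed
    have "Q \<subseteq> M"
    proof
      fix y assume "y \<in> Q"
      then obtain m j where "m \<in> A" "y = m \<otimes> b [^] (j::nat)"
        using index_p_decomp[OF As(1) Q As(2,3) bQ b(2)] by blast
      then show "y \<in> M" using AM subgroup_pow[OF Ms(1) bM] subgroup.m_closed[OF Ms(1)] by blast
    qed
    then have "Q = M" using Ms by blast
    moreover have "card M > 0" using finite_subgroup[OF Ms(1)] aM card_gt_0_iff by blast
    ultimately show False using Ms(3) p_gt_1 by simp
  qed
  then have \<alpha>bb: "\<alpha> b = b" using coprime_aut_fix_commutator[OF \<alpha> bG] triv by blast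
  obtain m i where m: "m \<in> A" "x = m \<otimes> b [^] (i::nat)"
    using index_p_decomp[OF As(1) Q As(2,3) bQ b(2) x] by blast
  have "m \<in> carrier G" using m As QG by blast
  then show ?thesis using m(2) endo_simps(2)[OF hm] hom_pow[OF hm bG] \<alpha>bb triv[OF m(1)] bG by simp
qed

text \<open>The maximal subgroups of \<open>adjoin A c\<close> have order \<open>card A\<close>, so
  all are preserved. As \<open>A\<close> is nontrivial, one of them contains \<open>c\<close>, and
  it differs from \<open>A\<close>.\<close>

lemma coprime_aut_trivial_of_adjoin:
  assumes \<alpha>: "coprime_aut q \<alpha>" and A: "subgroup A G" "A \<noteq> {\<one>}"
    and c: "c \<in> carrier G" "c \<notin> A" "c [^] p = \<one>" "normalizes c A"
    and inv: "\<And>M. \<lbrakk>subgroup M G; card M = card A\<rbrakk> \<Longrightarrow> \<alpha> ` M \<subseteq> M"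
    and triv: "\<And>x. x \<in> A \<Longrightarrow> \<alpha> x = x"
  shows "\<alpha> c = c"
proof -
  let ?Q = "adjoin A c"
  have "c [^] p \<in> A" using c(3) subgroup.one_closed[OF A(1)] by simp
  then have Q: "subgroup ?Q G" "A \<subseteq> ?Q" "c \<in> ?Q" "card ?Q = p * card A"
    using subgroup_adjoin[OF A(1) c(1,4)] adjoin_incl[OF A(1) c(1,4)] card_adjoin[OF A(1) c(1,4,2)] by auto
  let ?C = "adjoin {\<one>} c"
  have n1: "normalizes c {\<one>}" using c by (simp add: normalizes_def)
  have c1: "c \<noteq> \<one>" using c subgroup.one_closed[OF A(1)] by blast
  have C: "subgroup ?C G" "c \<in> ?C" "card ?C = p"
    using subgroup_adjoin[OF triv_subgroup c(1) n1] adjoin_incl[OF triv_subgroup c(1) n1]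
      card_adjoin[OF triv_subgroup c(1) n1] c c1 by auto
  obtain k where k: "card A = p ^ k" using card_subgroup_power A by blast
  have "k \<noteq> 0"
  proof
    assume "k = 0"
    then obtain y where "A = {y}" using k by (auto simp: card_1_singleton_iff)
    then show False using A subgroup.one_closed[OF A(1)] by auto
  qed
  then have "p \<le> card A" using k p_gt_1 by (metis One_nat_def Suc_leI power_increasing_iff bot_nat_0.not_eq_extremum power_one_right)
  then have "card ?C \<le> p ^ k" "p ^ k \<le> card ?Q" using C Q k p_gt_1 by auto
  moreover have "?C \<subseteq> ?Q" using adjoin_least[OF Q(1)] subgroup.one_closed[OF Q(1)] Q(3) by blast
  ultimately obtain B where B: "subgroup B G" "?C \<subseteq> B" "B \<subseteq> ?Q" "card B = p ^ k"
    using subgroup_of_card_between[OF C(1) Q(1)] by blast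
  have iA: "index_p_subgroup G p ?Q A" using A Q by (simp add: index_p_subgroup_def)
  have iB: "index_p_subgroup G p ?Q B" using B Q k by (simp add: index_p_subgroup_def)
  have ne: "A \<noteq> B" using c B C by blast
  have "\<alpha> ` M \<subseteq> M" if "index_p_subgroup G p ?Q M" for M
    using that inv[of M] Q(4) p_gt_1 by (simp add: index_p_subgroup_def)
  then show ?thesis using coprime_aut_trivial_on_adjacent[OF \<alpha> Q(1) iA iB ne _ triv Q(3)] by blast
qed

section \<open>Elements of order p in cyclic and noncyclic p-groups\<close>

lemma adjoin_one_pow:
  assumes "y \<in> carrier G"
  shows "adjoin {\<one>} y = {y [^] i | i. i \<in> (UNIV::nat set)}" "subgroup {y [^] i | i. i \<in> (UNIV::nat set)} G"
proof -
  have "normalizes y {\<one>}" using assms by (simp add: normalizes_def)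
  then have "subgroup (adjoin {\<one>} y) G" using subgroup_adjoin[OF triv_subgroup assms] by blast
  moreover show "adjoin {\<one>} y = {y [^] i | i. i \<in> (UNIV::nat set)}"
    using assms by (auto simp: adjoin_def)
  ultimately show "subgroup {y [^] i | i. i \<in> (UNIV::nat set)} G" by simp
qed

text \<open>A minimal noncyclic subgroup \<open>H\<close> has two cyclic maximal subgroups \<open>\<langle>m\<rangle>\<close> and \<open>\<langle>n\<rangle>\<close>, whose
  intersection is central of index \<open>p\<^sup>2\<close>. Then \<open>n\<^sup>p\<close> is a \<open>p\<close>-th power \<open>m\<^sup>p\<^sup>i\<close>, and
  \<open>m\<^sup>-\<^sup>i n\<close> has order \<open>p\<close> and lies outside \<open>\<langle>m\<rangle>\<close>.\<close>

lemma noncyclic_two_order_p: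
  assumes odd: "odd p" and H: "subgroup H G"
    and nc: "\<And>y. y \<in> H \<Longrightarrow> \<exists>x\<in>H. \<forall>i::nat. x \<noteq> y [^] i"
  shows "\<exists>z\<in>H. \<exists>e\<in>H. z \<noteq> \<one> \<and> z [^] p = \<one> \<and> e [^] p = \<one> \<and> (\<forall>i::nat. e \<noteq> z [^] i)"
  using H nc
proof (induction "card H" arbitrary: H rule: less_induct)
  case less
  note H = less.prems(1) and nc = less.prems(2)
  show ?case
  proof (cases "\<exists>K. subgroup K G \<and> K \<subset> H \<and> (\<forall>y\<in>K. \<exists>x\<in>K. \<forall>i::nat. x \<noteq> y [^] i)")
    case True
    then obtain K where K: "subgroup K G" "K \<subset> H" "\<And>y. y \<in> K \<Longrightarrow> \<exists>x\<in>K. \<forall>i::nat. x \<noteq> y [^] i" by blast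
    have "card K < card H" using K finite_subgroup[OF H] psubset_card_mono by blast
    then have "\<exists>z\<in>K. \<exists>e\<in>K. z \<noteq> \<one> \<and> z [^] p = \<one> \<and> e [^] p = \<one> \<and> (\<forall>i::nat. e \<noteq> z [^] i)"
      using less.hyps K by blast
    then show ?thesis using K by blast
  next
    case False
    have cyc: "\<exists>y\<in>K. K = {y [^] i | i. i \<in> (UNIV::nat set)}" if K: "subgroup K G" "K \<subset> H" for K
    proof -
      obtain y where y: "y \<in> K" "\<And>x. x \<in> K \<Longrightarrow> \<exists>i::nat. x = y [^] i" using False K by blast
      then have "K = {y [^] i | i. i \<in> (UNIV::nat set)}" using subgroup_pow[OF K(1) y(1)] by blast
      then show ?thesis using y by blast
    qed
    have HG: "x \<in> carrier G" if "x \<in> H" for x using that H subgroup.mem_carrier by metis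
    have "H \<noteq> {\<one>}" using nc[of \<one>] by (metis nat_pow_0 singletonD singletonI)
    then have "{\<one>} \<subset> H" using subgroup.one_closed[OF H] by blast
    then obtain M where M: "index_p_subgroup G p H M" using exists_index_p_subgroup[OF triv_subgroup H] by blast
    have Ms: "subgroup M G" "M \<subseteq> H" "card H = p * card M" using M by (auto simp: index_p_subgroup_def)
    have ltp: "K \<subset> H" if "index_p_subgroup G p H K" for K
    proof -
      have K: "subgroup K G" "K \<subseteq> H" "card H = p * card K" using that by (auto simp: index_p_subgroup_def)
      have "card K > 0" using finite_subgroup[OF K(1)] subgroup.one_closed[OF K(1)] card_gt_0_iff by blast
      then show ?thesis using K p_gt_1 by auto
    qed
    obtain m where m: "m \<in> M" "M = {m [^] i | i. i \<in> (UNIV::nat set)}" using cyc[OF Ms(1) ltp[OF M]] by blast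
    obtain y where y: "y \<in> H" "y \<notin> M" using ltp[OF M] by blast
    have gy: "subgroup {y [^] i | i. i \<in> (UNIV::nat set)} G" using adjoin_one_pow(2) HG y by blast
    have "{y [^] i | i. i \<in> (UNIV::nat set)} \<subset> H" using nc[OF y(1)] subgroup_pow[OF H y(1)] by blast
    then obtain N where N: "index_p_subgroup G p H N" "{y [^] i | i. i \<in> (UNIV::nat set)} \<subseteq> N"
      using exists_index_p_subgroup[OF gy H] by blast
    have Ns: "subgroup N G" "N \<subseteq> H" "card H = p * card N" using N by (auto simp: index_p_subgroup_def)
    obtain n where n: "n \<in> N" "N = {n [^] i | i. i \<in> (UNIV::nat set)}" using cyc[OF Ns(1) ltp[OF N(1)]] by blast
    have "y = y [^] (1::nat)" using HG y by simp
    then have yN: "y \<in> N" using N(2) by blast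
    have nM: "n \<notin> M"
    proof
      assume "n \<in> M"
      then have "N \<subseteq> M" using n(2) subgroup_pow[OF Ms(1)] by blast
      then show False using yN y by blast
    qed
    have mN: "m \<notin> N"
    proof
      assume "m \<in> N"
      then have "M \<subseteq> N" using m(2) subgroup_pow[OF Ns(1)] by blast
      moreover have "card M = card N" using Ms Ns p_gt_1 by simp
      ultimately have "M = N" using subgroup_eqI_card[OF Ns(1)] by simp
      then show False using yN y by blast
    qed
    have mH: "m \<in> H" and nH: "n \<in> H" using m n Ms Ns by auto
    have mG: "m \<in> carrier G" and nG: "n \<in> carrier G" using mH nH HG by auto
    have cen: "d \<otimes> m = m \<otimes> d" "d \<otimes> n = n \<otimes> d" if dd: "d \<in> M" "d \<in> N" for d
    proof -
      obtain i j where ij: "d = m [^] (i::nat)" "d = n [^] (j::nat)" using dd m(2) n(2) by blast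
      show "d \<otimes> m = m \<otimes> d" using nat_pow_Suc2[OF mG, of i] by (simp add: ij(1))
      show "d \<otimes> n = n \<otimes> d" using nat_pow_Suc2[OF nG, of j] by (simp add: ij(2))
    qed
    let ?k = "inv (m \<otimes> n) \<otimes> (n \<otimes> m)"
    have mem: "?k \<in> K" if K: "index_p_subgroup G p H K" for K
    proof -
      obtain \<phi> where \<phi>: "index_hom H K \<phi>" using exists_index_hom[OF H K] by blast
      have "[\<phi> (m \<otimes> n) = \<phi> (n \<otimes> m)] (mod p)"
        using index_homD(1)[OF \<phi> mH nH] index_homD(1)[OF \<phi> nH mH]
        by (metis add.commute cong_sym cong_trans)
      then show ?thesis
        using index_hom_diff[OF H \<phi> subgroup.m_closed[OF H mH nH] subgroup.m_closed[OF H nH mH]] by blast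
    qed
    have kM: "?k \<in> M" and kN: "?k \<in> N" using mem M N by auto
    have kG: "?k \<in> carrier G" using mG nG by simp
    have e1: "n \<otimes> m = m \<otimes> n \<otimes> ?k" using mG nG by (simp add: group_word_simps)
    note e2 = cen[OF kM kN]
    have np: "n [^] p \<in> M" "n [^] p \<in> N"
      using index_p_power[OF Ms(1) H Ms(2,3) nH] index_p_power[OF Ns(1) H Ns(2,3) nH] by auto
    have kp: "?k [^] p = \<one>"
    proof -
      have "n [^] p \<otimes> m = m \<otimes> n [^] p \<otimes> ?k [^] p"
        by (rule pow_mult_class_two(3)[OF mG nG kG e1 e2])
      moreover have "n [^] p \<otimes> m = m \<otimes> n [^] p" using cen(1)[OF np] .
      ultimately have "m \<otimes> n [^] p = m \<otimes> n [^] p \<otimes> ?k [^] p" by (simp only:)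
      then show ?thesis by (rule mult_right_eq_oneD) (use mG nG kG in auto)
    qed
    obtain j where j: "n [^] p = m [^] (j::nat)" using np(1) m(2) by blast
    \<comment> \<open>\<open>m\<close> has order \<open>p\<close> modulo \<open>N\<close>, and
      \<open>m [^] j = n [^] p\<close> lies in \<open>N\<close>; hence \<open>j\<close> is a
      multiple of \<open>p\<close>.\<close>
    have "m [^] p \<in> N" using index_p_power[OF Ns(1) H Ns(2,3) mH] .
    then have "p dvd j" using pow_mem_iff[OF Ns(1) mG mN] np(2) j by simp
    then obtain i where i: "j = p * i" by (elim dvdE)
    obtain i' where i': "inv (m [^] i) = m [^] (i'::nat)"
    proof -
      have "inv (m [^] i) \<in> M" using m(1) subgroup_pow[OF Ms(1)] subgroup.m_inv_closed[OF Ms(1)] by blast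
      then show thesis using m(2) that by blast
    qed
    let ?e = "m [^] i' \<otimes> n"
    have f1: "n \<otimes> m [^] i' = m [^] i' \<otimes> n \<otimes> ?k [^] i'"
      by (rule pow_mult_class_two(2)[OF mG nG kG e1 e2])
    have kiM: "?k [^] i' \<in> M" and kiN: "?k [^] i' \<in> N"
      using kM kN subgroup_pow Ms(1) Ns(1) by auto
    have "?k [^] i' \<otimes> m [^] i' = m [^] i' \<otimes> ?k [^] i'"
    proof -
      have "m [^] i' \<in> M" using m(2) by blast
      obtain r where "?k [^] i' = m [^] (r::nat)" using kiM m(2) by blast
      then show ?thesis using mG by (simp add: nat_pow_mult add.commute)
    qed
    note f2 = this cen(2)[OF kiM kiN]
    have "(?k [^] i') [^] p = (?k [^] p) [^] i'" using kG by (simp only: nat_pow_pow mult.commute)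
    then have f3: "(?k [^] i') [^] p = \<one>" using kp by simp
    have "?e [^] p = (m [^] i') [^] p \<otimes> n [^] p"
      using mG nG kG by (intro pow_mult_class_two_odd[OF _ _ _ f1 f2 odd f3]) auto
    also have "\<dots> = (inv (m [^] i)) [^] p \<otimes> (m [^] i) [^] p"
      using mG by (simp only: i' j i nat_pow_pow mult.commute)
    also have "\<dots> = \<one>" using mG by (simp add: nat_pow_inv)
    finally have ep: "?e [^] p = \<one>" .
    have miM: "m [^] i' \<in> M" using m(2) by blast
    have eM: "?e \<notin> M"
    proof
      assume "?e \<in> M"
      then have "inv (m [^] i') \<otimes> ?e \<in> M"
        using miM subgroup.m_closed[OF Ms(1)] subgroup.m_inv_closed[OF Ms(1)] by blast
      then show False using nM mG nG by (simp add: mult_inv_cancel)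
    qed
    \<comment> \<open>A trivial \<open>M\<close> would make \<open>n\<close> a generator of
      \<open>H\<close>.\<close>
    have m1: "m \<noteq> \<one>"
    proof
      assume "m = \<one>"
      then have M1: "M = {\<one>}" using m by auto
      have "\<exists>r::nat. x = n [^] r" if x: "x \<in> H" for x
        using index_p_decomp[OF Ms(1) H Ms(2,3) nH nM x] M1 nG by auto
      then show False using nc[OF nH] by blast
    qed
    \<comment> \<open>The last nontrivial term of the powers \<open>m [^] (p ^ r)\<close> has order
      \<open>p\<close> and serves as \<open>z\<close>; \<open>?e\<close> is not among its powers
      since it lies outside \<open>M\<close>.\<close>
    then obtain r where r: "m [^] (p ^ r) \<notin> {\<one>}" "(m [^] (p ^ r)) [^] p \<in> {\<one>}"
      using last_power_outside[OF triv_subgroup mG] by blast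
    have zM: "m [^] (p ^ r) \<in> M" using m(2) by blast
    have "\<forall>i::nat. ?e \<noteq> (m [^] (p ^ r)) [^] i" using eM subgroup_pow[OF Ms(1) zM] by metis
    moreover have "?e \<in> H" using miM Ms nH subgroup.m_closed[OF H] by blast
    moreover have "m [^] (p ^ r) \<in> H" using zM Ms by blast
    ultimately show ?thesis using r ep by blast
  qed
qed

text \<open>A cyclic \<open>p\<close>-group has one subgroup of order \<open>p\<close>. If
  \<open>y\<close> has order \<open>p^m\<close>, both exponents are multiples of
  \<open>p^(m - 1)\<close>, and the cofactor of \<open>j\<close> is invertible modulo
  \<open>p\<close>.\<close>

lemma order_p_in_cyclic:
  assumes y: "y \<in> carrier G" and z: "(y [^] j) [^] p = \<one>" "y [^] j \<noteq> \<one>" and e: "(y [^] i) [^] p = \<one>"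
  shows "\<exists>k::nat. y [^] (i::nat) = (y [^] (j::nat)) [^] k"
proof -
  obtain n where "y [^] (p ^ n) = \<one>" using pow_card_eq_one y by blast
  then have "ord y dvd p ^ n" using y pow_eq_id by simp
  then obtain m where m: "ord y = p ^ m" using divides_primepow_nat[OF prime_p] by blast
  have d: "p ^ m dvd j * p" "p ^ m dvd i * p" "\<not> p ^ m dvd j"
    using y z e pow_eq_id m by (auto simp: nat_pow_pow)
  then obtain m' where m': "m = Suc m'" by (cases m) auto
  have "p ^ m' dvd j" "p ^ m' dvd i" using d m' p_gt_1 by (auto simp: mult.commute)
  then obtain j' i' where ji: "j = p ^ m' * j'" "i = p ^ m' * i'" by (metis dvdE)
  have "\<not> p dvd j'" using d(3) ji m' p_gt_1 by (simp add: mult.commute)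
  then have "coprime p j'" using prime_p prime_imp_coprime_nat by blast
  then obtain s t where st: "j' * s = p * t + 1"
    using coprime_bezout_strong[of j' p] p_gt_1 by (metis coprime_commute less_numeral_extra(4))
  have "j * (s * i') = p ^ m' * i' * (j' * s)" using ji by simp
  also have "\<dots> = i + ord y * (t * i')" using st ji m m' by (simp add: algebra_simps)
  finally have "y [^] (j * (s * i')) = y [^] i \<otimes> (y [^] ord y) [^] (t * i')"
    using y by (simp only: nat_pow_mult nat_pow_pow nat_pow_closed)
  then have "y [^] i = (y [^] j) [^] (s * i')" using y by (simp add: nat_pow_pow)
  then show ?thesis by blast
qed

end

section \<open>Automorphisms acting trivially modulo the Frattini subgroup\<close>

text \<open>Iterated Fermat; this form also covers bases divisible by \<open>p\<close>.\<close>

lemma cong_power_prime_power: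
  fixes a p :: nat
  assumes "Factorial_Ring.prime p"
  shows "[a ^ (p ^ k) = a] (mod p)"
proof (induction k)
  case 0
  then show ?case by simp
next
  case (Suc k)
  have fermat: "[b ^ p = b] (mod p)" for b :: nat
  proof (cases "p dvd b")
    case True
    then have "p dvd b ^ p" using assms prime_gt_0_nat by (metis dvd_power dvd_trans)
    then show ?thesis using True by (simp add: cong_def dvd_eq_mod_eq_0)
  next
    case False
    have "[b ^ (p - 1) * b = 1 * b] (mod p)" using fermat_theorem[OF assms False] cong_scalar_right by blast
    moreover have "b ^ (p - 1) * b = b ^ p" using assms prime_gt_0_nat by (metis power_minus_mult)
    ultimately show ?thesis by simp
  qed
  have "[(a ^ (p ^ k)) ^ p = a ^ (p ^ k)] (mod p)" using fermat .
  then show ?case using Suc by (simp add: power_mult[symmetric] mult.commute) (metis cong_trans)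
qed

definition preserves :: "('a \<Rightarrow> 'a) set \<Rightarrow> 'a set \<Rightarrow> bool" where
  "preserves A Y \<longleftrightarrow> (\<forall>\<alpha>\<in>A. \<alpha> ` Y \<subseteq> Y)"

section \<open>Controlling subgroups\<close>

context finite_p_group
begin

text \<open>Designed so that \<open>A\<close> acts on the Frattini quotient of \<open>Q\<close> by
  scalars on each factor \<open>Q/M\<close>, while the last clause ensures that no coprime
  automorphism is lost on passing from the group to \<open>Q\<close>.\<close>

definition controlling :: "('a \<Rightarrow> 'a) set \<Rightarrow> 'a set \<Rightarrow> bool" where
  "controlling A Q \<longleftrightarrow> subgroup Q G \<and> Q \<noteq> {\<one>} \<and> preserves A Q \<and>
     (\<forall>M. index_p_subgroup G p Q M \<longrightarrow> preserves A M) \<and>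
     (\<forall>q. \<forall>\<alpha>\<in>A. coprime_aut q \<alpha> \<longrightarrow> (\<forall>x\<in>Q. \<alpha> x = x) \<longrightarrow> (\<forall>x\<in>carrier G. \<alpha> x = x))"

lemma controllingD:
  assumes "controlling A Q"
  shows "subgroup Q G" "Q \<noteq> {\<one>}" "\<alpha> \<in> A \<Longrightarrow> \<alpha> ` Q \<subseteq> Q"
    "index_p_subgroup G p Q M \<Longrightarrow> \<alpha> \<in> A \<Longrightarrow> \<alpha> ` M \<subseteq> M"
    "\<lbrakk>\<alpha> \<in> A; coprime_aut q \<alpha>; \<And>x. x \<in> Q \<Longrightarrow> \<alpha> x = x; x \<in> carrier G\<rbrakk> \<Longrightarrow> \<alpha> x = x"
  using assms by (auto simp: controlling_def preserves_def image_subset_iff)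

text \<open>In the cyclic case endomorphisms are power maps and \<open>Q\<close> is the whole group.
  Otherwise \<open>Q\<close> of order \<open>p^(d + 1)\<close> is noncyclic, so its maximal
  subgroups cover it, and invariance of these subgroups gives invariance of
  \<open>Q\<close>.\<close>

lemma exists_controlling:
  assumes odd: "odd p" and d: "d > 0" "p ^ d < order G" and A: "A \<subseteq> hom G G"
    and inv: "\<And>H. \<lbrakk>subgroup H G; card H = p ^ d\<rbrakk> \<Longrightarrow> preserves A H"
    and nrm: "\<And>H x. \<lbrakk>subgroup H G; card H = p ^ d; x \<in> carrier G\<rbrakk> \<Longrightarrow> normalizes x H"
  shows "\<exists>Q. controlling A Q"
proof (cases "\<exists>y\<in>carrier G. \<forall>x\<in>carrier G. \<exists>i::nat. x = y [^] i")
  case True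
  then obtain y where y: "y \<in> carrier G" "\<And>x. x \<in> carrier G \<Longrightarrow> \<exists>i::nat. x = y [^] i" by blast
  have all: "\<alpha> ` H \<subseteq> H" if H: "subgroup H G" and \<alpha>: "\<alpha> \<in> A" for H \<alpha>
  proof
    fix w assume "w \<in> \<alpha> ` H"
    then obtain x where x: "x \<in> H" "w = \<alpha> x" by blast
    have hm: "\<alpha> \<in> hom G G" using \<alpha> A by blast
    have xG: "x \<in> carrier G" using x H subgroup.mem_carrier by metis
    obtain i where i: "x = y [^] (i::nat)" using y(2)[OF xG] by blast
    obtain j where j: "\<alpha> y = y [^] (j::nat)" using y(2)[OF endo_simps(1)[OF hm y(1)]] by blast
    have "w = \<alpha> y [^] i" using x i hom_pow[OF hm y(1)] by simp
    also have "\<dots> = x [^] j" using y(1) by (simp only: i j nat_pow_pow mult.commute)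
    finally show "w \<in> H" using subgroup_pow[OF H x(1)] by simp
  qed
  have "carrier G \<noteq> {\<one>}"
  proof
    assume "carrier G = {\<one>}"
    then have "order G = 1" by (simp add: order_def)
    moreover have "p ^ d \<ge> 1" using p_gt_1 by simp
    ultimately show False using d by simp
  qed
  moreover have "preserves A H" if "subgroup H G" for H
    using all[OF that] unfolding preserves_def by blast
  ultimately have "controlling A (carrier G)"
    using subgroup_self unfolding controlling_def index_p_subgroup_def by blast
  then show ?thesis by blast
next
  case False
  then have "\<exists>z\<in>carrier G. \<exists>e\<in>carrier G. z \<noteq> \<one> \<and> z [^] p = \<one> \<and> e [^] p = \<one> \<and> (\<forall>i::nat. e \<noteq> z [^] i)"
    by (intro noncyclic_two_order_p[OF odd subgroup_self]) blast
  then obtain z e where ze: "z \<in> carrier G" "e \<in> carrier G" "z \<noteq> \<one>" "z [^] p = \<one>" "e [^] p = \<one>"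
    "\<And>i::nat. e \<noteq> z [^] i" by blast
  have pd: "p \<le> p ^ d" using d(1) p_gt_1 by (cases d) auto
  let ?Z = "adjoin {\<one>} z"
  have nz: "normalizes z {\<one>}" using ze by (simp add: normalizes_def)
  have Z: "subgroup ?Z G" "z \<in> ?Z" "card ?Z = p"
    using subgroup_adjoin[OF triv_subgroup ze(1) nz] adjoin_incl[OF triv_subgroup ze(1) nz]
      card_adjoin[OF triv_subgroup ze(1) nz] ze by auto
  obtain A0 where A0: "subgroup A0 G" "?Z \<subseteq> A0" "card A0 = p ^ d"
    using subgroup_of_card_between[OF Z(1) subgroup_self subgroup.subset[OF Z(1)], of d] Z(3) pd d(2)
    by (auto simp: order_def)
  obtain n where n: "order G = p ^ n" using order_eq_power by blast
  have dn: "p ^ Suc d \<le> order G"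
    using d(2) n p_gt_1 by (metis Suc_leI power_increasing_iff power_less_imp_less_exp)
  \<comment> \<open>\<open>A0\<close> already contains \<open>z\<close> and has order
    \<open>p^d\<close>; the one remaining factor \<open>p\<close> is spent on \<open>e\<close>
    unless \<open>e\<close> is in \<open>A0\<close>.\<close>
  obtain Q where Q: "subgroup Q G" "z \<in> Q" "e \<in> Q" "card Q = p ^ Suc d"
  proof (cases "e \<in> A0")
    case True
    obtain Q where "subgroup Q G" "A0 \<subseteq> Q" "card Q = p ^ Suc d"
      using subgroup_of_card_between[OF A0(1) subgroup_self subgroup.subset[OF A0(1)], of "Suc d"] dn A0(3) p_gt_1
      by (auto simp: order_def)
    then show thesis using that[of Q] True A0 Z by blast
  next
    case False
    have ne: "normalizes e A0" using nrm A0 ze by blast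
    have "e [^] p \<in> A0" using ze subgroup.one_closed[OF A0(1)] by simp
    then have "card (adjoin A0 e) = p ^ Suc d" using card_adjoin[OF A0(1) ze(2) ne False] A0(3) by simp
    moreover have "A0 \<subseteq> adjoin A0 e" "e \<in> adjoin A0 e" "subgroup (adjoin A0 e) G"
      using adjoin_incl[OF A0(1) ze(2) ne] subgroup_adjoin[OF A0(1) ze(2) ne] by auto
    ultimately show thesis using that[of "adjoin A0 e"] A0(2) Z(2) by blast
  qed
  have iM: "subgroup M G" "M \<subseteq> Q" "card M = p ^ d" if "index_p_subgroup G p Q M" for M
    using that Q(4) p_gt_1 by (auto simp: index_p_subgroup_def)
  have Minv: "\<alpha> ` M \<subseteq> M" if "index_p_subgroup G p Q M" "\<alpha> \<in> A" for M \<alpha>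
    using inv[of M] iM[OF that(1)] that(2) unfolding preserves_def by blast
  have cover: "\<exists>M. index_p_subgroup G p Q M \<and> y \<in> M" if y: "y \<in> Q" for y
  proof -
    have yG: "y \<in> carrier G" using y Q subgroup.mem_carrier by metis
    let ?Y = "{y [^] i | i. i \<in> (UNIV::nat set)}"
    have Ys: "subgroup ?Y G" using adjoin_one_pow(2)[OF yG] .
    have YQ: "?Y \<subseteq> Q" using subgroup_pow[OF Q(1) y] by blast
    \<comment> \<open>A cyclic group has a single subgroup of order \<open>p\<close>, whereas
      \<open>z\<close> and \<open>e\<close> generate two.\<close>
    have "?Y \<noteq> Q"
    proof
      assume "?Y = Q"
      then have "z \<in> ?Y" "e \<in> ?Y" using Q by auto
      then obtain i j where "z = y [^] (j::nat)" "e = y [^] (i::nat)" by blast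
      then show False using order_p_in_cyclic[OF yG, of j i] ze by metis
    qed
    then obtain M where M: "index_p_subgroup G p Q M" "?Y \<subseteq> M"
      using exists_index_p_subgroup[OF Ys Q(1)] YQ by blast
    have "y = y [^] (1::nat)" using yG by simp
    then have "y \<in> ?Y" by blast
    then show ?thesis using M by blast
  qed
  have "\<alpha> x = x" if \<alpha>: "\<alpha> \<in> A" "coprime_aut q \<alpha>" and fx: "\<forall>x\<in>Q. \<alpha> x = x" and x: "x \<in> carrier G" for \<alpha> q x
  proof (rule coprime_aut_trivial_of_omega[OF odd \<alpha>(2) _ subgroup_self _ x])
    show "\<alpha> ` carrier G \<subseteq> carrier G" using coprime_autD(5)[OF \<alpha>(2)] by blast
    fix c assume c: "c \<in> carrier G" "c [^] p = \<one>"
    show "\<alpha> c = c"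
    proof (cases "c \<in> Q")
      case True
      then show ?thesis using fx by blast
    next
      case False
      \<comment> \<open>For \<open>c\<close> of order \<open>p\<close> outside \<open>Q\<close>, any
        maximal subgroup of \<open>Q\<close> serves as the fixed part: it has order
        \<open>p^d\<close>, and so have the maximal subgroups of \<open>adjoin A' c\<close>.\<close>
      obtain A' where A': "index_p_subgroup G p Q A'" using cover Q by blast
      note A's = iM[OF A']
      have "A' \<noteq> {\<one>}" using A's(3) pd p_gt_1 by auto
      moreover have "c \<notin> A'" using False A's by blast
      moreover have "normalizes c A'" using nrm A's c by blast
      moreover have "\<And>M. subgroup M G \<Longrightarrow> card M = card A' \<Longrightarrow> \<alpha> ` M \<subseteq> M"
        using inv A's \<alpha> unfolding preserves_def by metis
      moreover have "\<And>x. x \<in> A' \<Longrightarrow> \<alpha> x = x" using fx A's by blast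
      ultimately show ?thesis using coprime_aut_trivial_of_adjoin[OF \<alpha>(2) A's(1)] c by blast
    qed
  qed
  moreover have "preserves A Q"
    unfolding preserves_def using cover Minv iM(2) by blast
  moreover have "Q \<noteq> {\<one>}" using Q(2) ze(3) by blast
  ultimately have "controlling A Q"
    using Q(1) Minv unfolding controlling_def preserves_def by blast
  then show ?thesis by blast
qed

text \<open>\<open>\<alpha>\<close> acts on \<open>Q/M\<close>, cyclic of order \<open>p\<close>
  with generator the class of \<open>z\<close>, so the scalar is the exponent of
  \<open>\<alpha> z\<close>.\<close>

lemma index_hom_scalar:
  assumes Q: "subgroup Q G" and M: "index_p_subgroup G p Q M" and \<phi>: "index_hom Q M \<phi>"
    and \<alpha>: "\<alpha> \<in> hom G G" "\<alpha> ` Q \<subseteq> Q" "\<alpha> ` M \<subseteq> M"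
  shows "\<exists>a. \<forall>x\<in>Q. [\<phi> (\<alpha> x) = a * \<phi> x] (mod p)"
proof -
  have Ms: "subgroup M G" and MQ: "M \<subseteq> Q" and c: "card Q = p * card M"
    using M by (auto simp: index_p_subgroup_def)
  obtain z where z: "z \<in> Q" "[\<phi> z = 1] (mod p)" using index_homD(3)[OF \<phi>] by blast
  have zM: "z \<notin> M"
    using index_homD(2)[OF \<phi> z(1)] z(2) p_gt_1 by (metis cong_dvd_iff nat_dvd_1_iff_1 less_irrefl)
  have QG: "y \<in> carrier G" if "y \<in> Q" for y using that Q subgroup.mem_carrier by metis
  have pw: "[\<phi> (y [^] i) = i * \<phi> y] (mod p)" if y: "y \<in> Q" for y and i :: nat
  proof (induction i)
    case 0
    have "p dvd \<phi> \<one>" using index_homD(2)[OF \<phi> subgroup.one_closed[OF Q]] subgroup.one_closed[OF Ms] by blast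
    then show ?case by (simp add: cong_0_iff)
  next
    case (Suc i)
    have "[\<phi> (y [^] i \<otimes> y) = \<phi> (y [^] i) + \<phi> y] (mod p)" using index_homD(1)[OF \<phi> subgroup_pow[OF Q y] y] .
    also have "[\<phi> (y [^] i) + \<phi> y = i * \<phi> y + \<phi> y] (mod p)" using cong_add[OF Suc cong_refl] .
    finally show ?case by (simp add: add.commute)
  qed
  have "[\<phi> (\<alpha> x) = \<phi> (\<alpha> z) * \<phi> x] (mod p)" if x: "x \<in> Q" for x
  proof -
    obtain m i where m: "m \<in> M" "x = m \<otimes> z [^] (i::nat)"
      using index_p_decomp[OF Ms Q MQ c z(1) zM x] by blast
    have mQ: "m \<in> Q" using m MQ by blast
    have ziQ: "z [^] i \<in> Q" using subgroup_pow[OF Q z(1)] .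
    have \<alpha>Q: "\<alpha> z \<in> Q" "\<alpha> m \<in> Q" "\<alpha> m \<in> M" using \<alpha> z mQ m by auto
    have m0: "[\<phi> m = 0] (mod p)" "[\<phi> (\<alpha> m) = 0] (mod p)"
      using index_homD(2)[OF \<phi> mQ] index_homD(2)[OF \<phi> \<alpha>Q(2)] m(1) \<alpha>Q(3) by (simp_all add: cong_0_iff)
    have "[\<phi> x = \<phi> m + \<phi> (z [^] i)] (mod p)" unfolding m(2) using index_homD(1)[OF \<phi> mQ ziQ] .
    also have "[\<phi> m + \<phi> (z [^] i) = 0 + i * 1] (mod p)"
      using m0(1) cong_trans[OF pw[OF z(1)] cong_scalar_left[OF z(2)]] by (rule cong_add)
    finally have xi: "[\<phi> x = i] (mod p)" by simp
    have "\<alpha> x = \<alpha> m \<otimes> (\<alpha> z) [^] i"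
      unfolding m(2) using endo_simps(2)[OF \<alpha>(1)] hom_pow[OF \<alpha>(1)] QG mQ z(1) by simp
    then have "[\<phi> (\<alpha> x) = \<phi> (\<alpha> m) + \<phi> (\<alpha> z [^] i)] (mod p)"
      using index_homD(1)[OF \<phi> \<alpha>Q(2) subgroup_pow[OF Q \<alpha>Q(1)]] by simp
    also have "[\<phi> (\<alpha> m) + \<phi> (\<alpha> z [^] i) = 0 + i * \<phi> (\<alpha> z)] (mod p)"
      using m0(2) pw[OF \<alpha>Q(1)] by (rule cong_add)
    also have "[0 + i * \<phi> (\<alpha> z) = \<phi> (\<alpha> z) * \<phi> x] (mod p)"
      using cong_scalar_left[OF xi, of "\<phi> (\<alpha> z)"] by (simp add: mult.commute cong_sym)
    finally show ?thesis .
  qed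
  then show ?thesis by blast
qed

text \<open>The kernel of the action of \<open>A\<close> on \<open>Q\<close> modulo its Frattini
  subgroup.\<close>

definition frattini_kernel :: "('a \<Rightarrow> 'a) set \<Rightarrow> 'a set \<Rightarrow> ('a \<Rightarrow> 'a) set" where
  "frattini_kernel A Q = {\<alpha> \<in> A. \<forall>M x. index_p_subgroup G p Q M \<longrightarrow> x \<in> Q \<longrightarrow> inv x \<otimes> \<alpha> x \<in> M}"

text \<open>Each \<open>\<alpha>\<close> multiplies every \<open>index_hom\<close> by a scalar
  \<open>a\<close>; lying in the kernel means \<open>a = 1\<close> for all of them. The claims
  reflect that scalars multiply, that \<open>a^(p^k) = a\<close>, that coprime elements of the
  kernel are trivial on \<open>Q\<close> and so everywhere, that \<open>a^(p - 1) = 1\<close>, and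
  that scalars commute.\<close>

lemma
  assumes A: "subgroup A (BijGroup (carrier G))" "A \<subseteq> hom G G" and Q: "controlling A Q"
  shows subgroup_frattini_kernel: "subgroup (frattini_kernel A Q) (BijGroup (carrier G))"
    and frattini_kernel_p_power: "\<lbrakk>\<alpha> \<in> A; \<And>x. x \<in> carrier G \<Longrightarrow> (\<alpha> ^^ (p ^ k)) x = x\<rbrakk> \<Longrightarrow> \<alpha> \<in> frattini_kernel A Q"
    and card_frattini_kernel: "\<exists>k. card (frattini_kernel A Q) = p ^ k"
    and frattini_kernel_power: "\<alpha> \<in> A \<Longrightarrow> \<alpha> [^]\<^bsub>BijGroup (carrier G)\<^esub> (p - 1) \<in> frattini_kernel A Q"
    and frattini_kernel_commutator: "\<lbrakk>\<alpha> \<in> A; \<beta> \<in> A\<rbrakk> \<Longrightarrow>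
      \<exists>\<nu>\<in>frattini_kernel A Q. \<forall>x\<in>carrier G. \<alpha> (\<beta> x) = \<beta> (\<alpha> (\<nu> x))"
proof -
  let ?B = "BijGroup (carrier G)" and ?N = "frattini_kernel A Q"
  interpret B: group ?B by (rule group_BijGroup)
  have Qs: "subgroup Q G" using controllingD(1)[OF Q] .
  have QG: "y \<in> carrier G" if "y \<in> Q" for y using that Qs subgroup.mem_carrier by metis
  have AB: "\<alpha> \<in> Bij (carrier G)" if "\<alpha> \<in> A" for \<alpha>
    using that subgroup.subset[OF A(1)] by (auto simp: BijGroup_def)
  have AQ: "\<alpha> x \<in> Q" if "\<alpha> \<in> A" "x \<in> Q" for \<alpha> x using controllingD(3)[OF Q that(1)] that(2) by blast
  have mult: "(\<alpha> \<otimes>\<^bsub>?B\<^esub> \<beta>) x = \<alpha> (\<beta> x)" if "\<alpha> \<in> A" "\<beta> \<in> A" "x \<in> carrier G" for \<alpha> \<beta> x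
    using AB that by (simp add: BijGroup_def compose_def)
  have clA: "\<alpha> \<otimes>\<^bsub>?B\<^esub> \<beta> \<in> A" if "\<alpha> \<in> A" "\<beta> \<in> A" for \<alpha> \<beta> using subgroup.m_closed[OF A(1)] that .
  have NA: "?N \<subseteq> A" by (auto simp: frattini_kernel_def)
  have finA: "finite A" by (rule finite_subset[OF subsetI finite_Bij[OF finite_carrier]]) (rule AB)
  have iter: "(\<alpha> ^^ n) x \<in> Q" if "\<alpha> \<in> A" "x \<in> Q" for \<alpha> x n using AQ that by (induction n) auto
  have Nchar: "\<alpha> \<in> ?N \<longleftrightarrow> \<alpha> \<in> A \<and> (\<forall>M \<phi>. index_p_subgroup G p Q M \<longrightarrow> index_hom Q M \<phi> \<longrightarrow>
      (\<forall>x\<in>Q. [\<phi> (\<alpha> x) = \<phi> x] (mod p)))" for \<alpha>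
  proof
    assume N: "\<alpha> \<in> ?N"
    then have \<alpha>: "\<alpha> \<in> A" using NA by blast
    have "[\<phi> (\<alpha> x) = \<phi> x] (mod p)" if "index_p_subgroup G p Q M" "index_hom Q M \<phi>" "x \<in> Q" for M \<phi> x
    proof -
      have "inv x \<otimes> \<alpha> x \<in> M" using N that by (simp add: frattini_kernel_def)
      then have "[\<phi> x = \<phi> (\<alpha> x)] (mod p)"
        using index_hom_diff[OF Qs that(2,3) AQ[OF \<alpha> that(3)]] by blast
      then show ?thesis by (rule cong_sym)
    qed
    then show "\<alpha> \<in> A \<and> (\<forall>M \<phi>. index_p_subgroup G p Q M \<longrightarrow> index_hom Q M \<phi> \<longrightarrow>
      (\<forall>x\<in>Q. [\<phi> (\<alpha> x) = \<phi> x] (mod p)))" using \<alpha> by blast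
  next
    assume a: "\<alpha> \<in> A \<and> (\<forall>M \<phi>. index_p_subgroup G p Q M \<longrightarrow> index_hom Q M \<phi> \<longrightarrow>
      (\<forall>x\<in>Q. [\<phi> (\<alpha> x) = \<phi> x] (mod p)))"
    have "inv x \<otimes> \<alpha> x \<in> M" if M: "index_p_subgroup G p Q M" and x: "x \<in> Q" for M x
    proof -
      obtain \<phi> where \<phi>: "index_hom Q M \<phi>" using exists_index_hom[OF Qs M] by blast
      have "[\<phi> (\<alpha> x) = \<phi> x] (mod p)" using a M \<phi> x by blast
      then have "[\<phi> x = \<phi> (\<alpha> x)] (mod p)" by (rule cong_sym)
      then show ?thesis using index_hom_diff[OF Qs \<phi> x AQ] a x by blast
    qed
    then show "\<alpha> \<in> ?N" using a by (simp add: frattini_kernel_def)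
  qed
  have scal: "\<exists>a. \<forall>x\<in>Q. [\<phi> (\<alpha> x) = a * \<phi> x] (mod p)"
    if "\<alpha> \<in> A" "index_p_subgroup G p Q M" "index_hom Q M \<phi>" for \<alpha> M \<phi>
    using index_hom_scalar[OF Qs that(2,3)] A(2) controllingD(3,4)[OF Q] that by blast
  have scal_pow: "[\<phi> ((\<alpha> ^^ n) x) = a ^ n * \<phi> x] (mod p)"
    if "\<alpha> \<in> A" "\<forall>x\<in>Q. [\<phi> (\<alpha> x) = a * \<phi> x] (mod p)" "x \<in> Q" for \<alpha> \<phi> a x n
  proof (induction n)
    case 0
    then show ?case by simp
  next
    case (Suc n)
    have "[\<phi> (\<alpha> ((\<alpha> ^^ n) x)) = a * \<phi> ((\<alpha> ^^ n) x)] (mod p)" using that iter by blast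
    also have "[a * \<phi> ((\<alpha> ^^ n) x) = a * (a ^ n * \<phi> x)] (mod p)" using cong_scalar_left[OF Suc] .
    finally show ?case by (simp add: mult.assoc)
  qed
  show Ns: "subgroup ?N ?B"
  proof (rule B.finite_subgroupI)
    show "finite ?N" using finA NA finite_subset by blast
    show "?N \<subseteq> carrier ?B" using NA AB by (auto simp: carrier_BijGroup)
    have one: "\<one>\<^bsub>?B\<^esub> \<in> A" using subgroup.one_closed[OF A(1)] .
    have "\<one>\<^bsub>?B\<^esub> x = x" if "x \<in> carrier G" for x using that by (simp add: BijGroup_def)
    then have "\<one>\<^bsub>?B\<^esub> \<in> ?N" unfolding Nchar using one QG by simp
    then show "?N \<noteq> {}" by blast
    fix \<alpha> \<beta> assume ab: "\<alpha> \<in> ?N" "\<beta> \<in> ?N"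
    then have abA: "\<alpha> \<in> A" "\<beta> \<in> A" using NA by auto
    have "[\<phi> ((\<alpha> \<otimes>\<^bsub>?B\<^esub> \<beta>) x) = \<phi> x] (mod p)" if "index_p_subgroup G p Q M" "index_hom Q M \<phi>" "x \<in> Q" for M \<phi> x
    proof -
      have "[\<phi> (\<alpha> (\<beta> x)) = \<phi> (\<beta> x)] (mod p)" using ab(1) that AQ[OF abA(2)] unfolding Nchar by blast
      also have "[\<phi> (\<beta> x) = \<phi> x] (mod p)" using ab(2) that unfolding Nchar by blast
      finally show ?thesis using mult[OF abA] QG that by simp
    qed
    then show "\<alpha> \<otimes>\<^bsub>?B\<^esub> \<beta> \<in> ?N" unfolding Nchar using clA[OF abA] by blast
  qed
  show "\<alpha> \<in> ?N" if \<alpha>: "\<alpha> \<in> A" and per: "\<And>x. x \<in> carrier G \<Longrightarrow> (\<alpha> ^^ (p ^ k)) x = x"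
  proof -
    have "[\<phi> (\<alpha> x) = \<phi> x] (mod p)" if M: "index_p_subgroup G p Q M" and \<phi>: "index_hom Q M \<phi>" and x: "x \<in> Q" for M \<phi> x
    proof -
      obtain a where a: "\<forall>x\<in>Q. [\<phi> (\<alpha> x) = a * \<phi> x] (mod p)" using scal[OF \<alpha> M \<phi>] by blast
      obtain z where z: "z \<in> Q" "[\<phi> z = 1] (mod p)" using index_homD(3)[OF \<phi>] by blast
      have "[\<phi> z = a ^ (p ^ k) * \<phi> z] (mod p)" using scal_pow[OF \<alpha> a z(1), of "p ^ k"] per QG[OF z(1)] by simp
      also have "[a ^ (p ^ k) * \<phi> z = a * 1] (mod p)"
        using cong_power_prime_power[OF prime_p] z(2) by (rule cong_mult)
      finally have "[a = 1] (mod p)" using z(2) by (metis cong_sym cong_trans mult_1_right)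
      then have "[a * \<phi> x = 1 * \<phi> x] (mod p)" by (rule cong_scalar_right)
      then show ?thesis using a x by (metis cong_trans mult_1)
    qed
    then show ?thesis unfolding Nchar using \<alpha> by blast
  qed
  show "\<exists>k. card ?N = p ^ k"
  proof -
    let ?NG = "?B\<lparr>carrier := ?N\<rparr>"
    interpret NG: group ?NG using subgroup.subgroup_is_group[OF Ns B.is_group] .
    have "\<exists>k. order ?NG = p ^ k"
    proof (rule NG.order_prime_powerI[OF prime_p])
      show "finite (carrier ?NG)" using finA NA finite_subset by auto
      fix q \<alpha> assume q: "Factorial_Ring.prime q" "q \<noteq> p" and \<alpha>: "\<alpha> \<in> carrier ?NG" "\<alpha> [^]\<^bsub>?NG\<^esub> q = \<one>\<^bsub>?NG\<^esub>"
      have \<alpha>N: "\<alpha> \<in> ?N" and \<alpha>A: "\<alpha> \<in> A" using \<alpha>(1) NA by auto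
      have "\<alpha> [^]\<^bsub>?B\<^esub> q = \<one>\<^bsub>?B\<^esub>" using \<alpha>(2) B.nat_pow_consistent by simp
      then have "(\<alpha> ^^ q) x = x" if "x \<in> carrier G" for x
        using BijGroup_pow[OF AB[OF \<alpha>A] that, of q] that by (simp add: BijGroup_def)
      then have cop: "coprime_aut q \<alpha>" using q \<alpha>A A(2) by (auto simp: coprime_aut_def)
      have trQ: "\<alpha> x = x" if "x \<in> Q" for x
      proof (rule coprime_aut_trivial_mod_index_p[OF cop Qs _ _ that])
        show "\<And>M. index_p_subgroup G p Q M \<Longrightarrow> \<alpha> ` M \<subseteq> M" using controllingD(4)[OF Q _ \<alpha>A] .
        show "\<And>M x. index_p_subgroup G p Q M \<Longrightarrow> x \<in> Q \<Longrightarrow> inv x \<otimes> \<alpha> x \<in> M"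
          using \<alpha>N by (auto simp: frattini_kernel_def)
      qed
      have "\<alpha> x = x" if "x \<in> carrier G" for x using controllingD(5)[OF Q \<alpha>A cop trQ that] .
      then have "\<alpha> = (\<lambda>x\<in>carrier G. x)"
        using Bij_imp_extensional[OF AB[OF \<alpha>A]] by (intro extensionalityI) auto
      then show "\<alpha> = \<one>\<^bsub>?NG\<^esub>" by (simp add: BijGroup_def)
    qed
    then show ?thesis by (simp add: order_def)
  qed
  \<comment> \<open>A positive power of \<open>\<alpha>\<close> is the identity, so a power of
    \<open>a\<close> is 1 modulo \<open>p\<close>. This permits Fermat and the cancellation in the
    commutator claim.\<close>
  have unit: "\<not> p dvd a" if \<alpha>: "\<alpha> \<in> A" and M: "index_p_subgroup G p Q M" and \<phi>: "index_hom Q M \<phi>"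
    and a: "\<forall>x\<in>Q. [\<phi> (\<alpha> x) = a * \<phi> x] (mod p)" for \<alpha> M \<phi> a
  proof
    assume pa: "p dvd a"
    obtain n :: nat where n: "\<alpha> [^]\<^bsub>?B\<lparr>carrier := A\<rparr>\<^esub> n = \<one>\<^bsub>?B\<^esub>" "n > 0"
    proof -
      interpret AG: group "?B\<lparr>carrier := A\<rparr>" using subgroup.subgroup_is_group[OF A(1) B.is_group] .
      have "order (?B\<lparr>carrier := A\<rparr>) > 0" using finA AG.order_gt_0_iff_finite by simp
      then show thesis using that[of "order (?B\<lparr>carrier := A\<rparr>)"] AG.pow_order_eq_1[of \<alpha>] \<alpha> by simp
    qed
    obtain z where z: "z \<in> Q" "[\<phi> z = 1] (mod p)" using index_homD(3)[OF \<phi>] by blast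
    have "\<alpha> [^]\<^bsub>?B\<^esub> n = \<one>\<^bsub>?B\<^esub>" using n B.nat_pow_consistent by simp
    then have "(\<alpha> ^^ n) z = z" using BijGroup_pow[OF AB[OF \<alpha>] QG[OF z(1)], of n] QG[OF z(1)] by (simp add: BijGroup_def)
    then have "[\<phi> z = a ^ n * \<phi> z] (mod p)" using scal_pow[OF \<alpha> a z(1), of n] by simp
    moreover have "p dvd a ^ n * \<phi> z" using pa n(2) by (meson dvd_mult2 dvd_power dvd_trans)
    ultimately have "p dvd \<phi> z" by (simp add: cong_dvd_iff)
    then show False using z(2) p_gt_1 by (metis cong_dvd_iff nat_dvd_1_iff_1 less_irrefl)
  qed
  show "\<alpha> [^]\<^bsub>?B\<^esub> (p - 1) \<in> ?N" if \<alpha>: "\<alpha> \<in> A"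
  proof -
    have mem: "\<alpha> [^]\<^bsub>?B\<^esub> (p - 1) \<in> A"
    proof -
      have "\<alpha> [^]\<^bsub>?B\<^esub> n \<in> A" for n :: nat
        using subgroup.one_closed[OF A(1)] clA[OF _ \<alpha>] by (induction n) simp_all
      then show ?thesis .
    qed
    have "[\<phi> ((\<alpha> [^]\<^bsub>?B\<^esub> (p - 1)) x) = \<phi> x] (mod p)"
      if M: "index_p_subgroup G p Q M" and \<phi>: "index_hom Q M \<phi>" and x: "x \<in> Q" for M \<phi> x
    proof -
      obtain a where a: "\<forall>x\<in>Q. [\<phi> (\<alpha> x) = a * \<phi> x] (mod p)" using scal[OF \<alpha> M \<phi>] by blast
      have "[a ^ (p - 1) = 1] (mod p)" using fermat_theorem[OF prime_p unit[OF \<alpha> M \<phi> a]] .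
      then have "[a ^ (p - 1) * \<phi> x = 1 * \<phi> x] (mod p)" by (rule cong_scalar_right)
      then show ?thesis
        using scal_pow[OF \<alpha> a x, of "p - 1"] BijGroup_pow[OF AB[OF \<alpha>] QG[OF x], of "p - 1"]
        by (metis cong_trans mult_1)
    qed
    then show ?thesis unfolding Nchar using mem by blast
  qed
  show "\<exists>\<nu>\<in>?N. \<forall>x\<in>carrier G. \<alpha> (\<beta> x) = \<beta> (\<alpha> (\<nu> x))" if \<alpha>: "\<alpha> \<in> A" and \<beta>: "\<beta> \<in> A"
  proof -
    let ?\<nu> = "inv\<^bsub>?B\<^esub> (\<beta> \<otimes>\<^bsub>?B\<^esub> \<alpha>) \<otimes>\<^bsub>?B\<^esub> (\<alpha> \<otimes>\<^bsub>?B\<^esub> \<beta>)"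
    have \<nu>A: "?\<nu> \<in> A" using clA[OF \<beta> \<alpha>] clA[OF \<alpha> \<beta>] clA subgroup.m_inv_closed[OF A(1)] by blast
    have car: "\<alpha> \<in> carrier ?B" "\<beta> \<in> carrier ?B" using AB \<alpha> \<beta> by (auto simp: carrier_BijGroup)
    have "(\<beta> \<otimes>\<^bsub>?B\<^esub> \<alpha>) \<otimes>\<^bsub>?B\<^esub> ?\<nu> = \<alpha> \<otimes>\<^bsub>?B\<^esub> \<beta>"
      using car B.mult_inv_cancel(1)[of "\<beta> \<otimes>\<^bsub>?B\<^esub> \<alpha>" "\<alpha> \<otimes>\<^bsub>?B\<^esub> \<beta>"] by blast
    moreover have \<nu>G: "?\<nu> x \<in> carrier G" if "x \<in> carrier G" for x
      using Bij_imp_funcset[OF AB[OF \<nu>A]] that by blast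
    ultimately have eq: "\<alpha> (\<beta> x) = \<beta> (\<alpha> (?\<nu> x))" if "x \<in> carrier G" for x
      using mult[OF clA[OF \<beta> \<alpha>] \<nu>A that] mult[OF \<alpha> \<beta> that] mult[OF \<beta> \<alpha> \<nu>G[OF that]] by simp
    have "[\<phi> (?\<nu> x) = \<phi> x] (mod p)"
      if M: "index_p_subgroup G p Q M" and \<phi>: "index_hom Q M \<phi>" and x: "x \<in> Q" for M \<phi> x
    proof -
      obtain a where a: "\<forall>x\<in>Q. [\<phi> (\<alpha> x) = a * \<phi> x] (mod p)" using scal[OF \<alpha> M \<phi>] by blast
      obtain b where b: "\<forall>x\<in>Q. [\<phi> (\<beta> x) = b * \<phi> x] (mod p)" using scal[OF \<beta> M \<phi>] by blast
      have two: "[\<phi> (\<gamma> (\<delta> y)) = c * (e * \<phi> y)] (mod p)"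
        if "\<gamma> \<in> A" "\<delta> \<in> A" "y \<in> Q" "\<forall>x\<in>Q. [\<phi> (\<gamma> x) = c * \<phi> x] (mod p)" "\<forall>x\<in>Q. [\<phi> (\<delta> x) = e * \<phi> x] (mod p)"
        for \<gamma> \<delta> y c e
      proof -
        have "[\<phi> (\<gamma> (\<delta> y)) = c * \<phi> (\<delta> y)] (mod p)" using that AQ by blast
        also have "[c * \<phi> (\<delta> y) = c * (e * \<phi> y)] (mod p)" by (rule cong_scalar_left) (use that in blast)
        finally show ?thesis .
      qed
      have "[b * (a * \<phi> (?\<nu> x)) = \<phi> (\<beta> (\<alpha> (?\<nu> x)))] (mod p)" using two[OF \<beta> \<alpha> AQ[OF \<nu>A x] b a] by (rule cong_sym)
      also have "\<phi> (\<beta> (\<alpha> (?\<nu> x))) = \<phi> (\<alpha> (\<beta> x))" using eq[OF QG[OF x]] by simp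
      also have "[\<phi> (\<alpha> (\<beta> x)) = a * (b * \<phi> x)] (mod p)" using two[OF \<alpha> \<beta> x a b] .
      finally have "[(b * a) * \<phi> (?\<nu> x) = (b * a) * \<phi> x] (mod p)" by (simp add: ac_simps)
      moreover have "coprime p (b * a)"
        using prime_imp_coprime_nat[OF prime_p unit[OF \<alpha> M \<phi> a]]
          prime_imp_coprime_nat[OF prime_p unit[OF \<beta> M \<phi> b]] by simp
      then have "coprime (b * a) p" by (simp only: coprime_commute)
      ultimately show ?thesis by (simp add: cong_mult_lcancel_nat)
    qed
    then have "?\<nu> \<in> ?N" unfolding Nchar using \<nu>A by blast
    then show ?thesis using eq by blast
  qed
qed

end

section \<open>Invariant series with cyclic factors\<close>

text \<open>Multiplication by a primitive root \<open>g\<close> permutes the nonzero residues, so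
  the sum equals \<open>g^e\<close> times itself, and \<open>g^e\<close> is not 1 modulo
  \<open>p\<close>.\<close>

lemma prime_dvd_power_sum:
  fixes p e :: nat
  assumes p: "Factorial_Ring.prime p" and e: "0 < e" "e < p - 1"
  shows "p dvd (\<Sum>m\<in>{1..<p}. m ^ e)"
proof -
  obtain g where g: "residue_primroot p g" using prime_primitive_root_exists[OF prime_gt_1_nat[OF p] p] by blast
  have cop: "coprime p g" and og: "Pocklington.ord p g = p - 1"
    using g totient_prime[OF p] by (auto simp: residue_primroot_def)
  have ge: "[g ^ e \<noteq> 1] (mod p)"
    using e ord_divides[of g e p] og by (metis dvd_imp_le not_le)
  let ?h = "\<lambda>m. (g * m) mod p"
  have p1: "p > 1" using p prime_gt_1_nat by blast
  have into: "?h ` {1..<p} \<subseteq> {1..<p}"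
  proof
    fix y assume "y \<in> ?h ` {1..<p}"
    then obtain m where m: "1 \<le> m" "m < p" "y = ?h m" by auto
    have "\<not> p dvd m" using m by (simp add: nat_dvd_not_less)
    then have "\<not> p dvd g * m" using cop by (metis coprime_dvd_mult_right_iff)
    then have "y \<noteq> 0" using m by (simp add: dvd_eq_mod_eq_0)
    then show "y \<in> {1..<p}" using m p1 by auto
  qed
  have inj: "inj_on ?h {1..<p}"
  proof
    fix a b assume ab: "a \<in> {1..<p}" "b \<in> {1..<p}" "?h a = ?h b"
    then have "[g * a = g * b] (mod p)" by (simp add: cong_def)
    then have "[a = b] (mod p)" using cop by (simp add: cong_mult_lcancel_nat coprime_commute)
    then show "a = b" using ab by (simp add: cong_def)
  qed
  have bij: "?h ` {1..<p} = {1..<p}" using endo_inj_surj[OF _ into inj] by simp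
  let ?S = "\<Sum>m\<in>{1..<p}. m ^ e"
  have "?S = (\<Sum>m\<in>?h ` {1..<p}. m ^ e)" using bij by simp
  also have "\<dots> = (\<Sum>m\<in>{1..<p}. (?h m) ^ e)" using inj by (simp add: sum.reindex)
  finally have S: "?S = (\<Sum>m\<in>{1..<p}. (?h m) ^ e)" .
  have "[(\<Sum>m\<in>{1..<p}. (?h m) ^ e) = (\<Sum>m\<in>{1..<p}. (g * m) ^ e)] (mod p)"
    by (rule cong_sum) (simp add: cong_def power_mod)
  also have "(\<Sum>m\<in>{1..<p}. (g * m) ^ e) = g ^ e * ?S"
    by (simp add: power_mult_distrib sum_distrib_left)
  finally have "[1 * ?S = g ^ e * ?S] (mod p)" using S by simp
  then show ?thesis
  proof -
    assume c: "[1 * ?S = g ^ e * ?S] (mod p)"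
    show ?thesis
    proof (rule ccontr)
      assume "\<not> p dvd ?S"
      then have "coprime ?S p" using prime_imp_coprime_nat[OF p] coprime_commute by blast
      then have "[1 = g ^ e] (mod p)" using c cong_mult_rcancel_nat by blast
      then show False using ge cong_sym by blast
    qed
  qed
qed

text \<open>The vectors \<open>\<Prod>\<^sub>j a\<^sup>j(v) ^ m ^ (p - 1 - j)\<close> for \<open>0 < m < p\<close> are eigenvectors of \<open>a\<close> with eigenvalue
  \<open>m\<close> or trivial, and their product is \<open>v ^ (p - 1)\<close>.\<close>

lemma (in comm_group) exists_eigenvector:
  fixes p :: nat
  assumes p: "Factorial_Ring.prime p" and a: "a \<in> hom G G"
    and ex: "\<And>x. x \<in> carrier G \<Longrightarrow> x [^] p = \<one>"
    and per: "\<And>x. x \<in> carrier G \<Longrightarrow> (a ^^ (p - 1)) x = x"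
    and v: "v \<in> carrier G" "v \<noteq> \<one>"
  shows "\<exists>w\<in>carrier G. w \<noteq> \<one> \<and> (\<exists>m::nat. a w = w [^] m)"
proof (rule ccontr)
  assume no: "\<not> ?thesis"
  \<comment> \<open>With this \<open>n\<close> the indices \<open>0..n\<close> run through one full
    period \<open>p - 1\<close> of \<open>a\<close>.\<close>
  define n where "n = p - 2"
  have p2: "p = n + 2" using prime_ge_2_nat[OF p] by (simp add: n_def)
  define u where "u j = (a ^^ j) v" for j
  have u: "u j \<in> carrier G" for j
    using v endo_simps(1)[OF a] by (induction j) (simp_all add: u_def)
  have au: "a (u j) = u (Suc j)" for j by (simp add: u_def)
  have u0: "u 0 = v" "u (Suc n) = v" using per[OF v(1)] p2 by (simp_all add: u_def)
  have pm: "x [^] (i::nat) = x [^] (j::nat)" if "x \<in> carrier G" "[i = j] (mod p)" for x i j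
  proof -
    have "x [^] i = x [^] (i mod p)" if x: "x \<in> carrier G" for i :: nat and x
    proof -
      have "x [^] i = (x [^] p) [^] (i div p) \<otimes> x [^] (i mod p)"
        using x by (simp only: nat_pow_pow nat_pow_mult nat_pow_closed) simp
      then show ?thesis using ex[OF x] x by simp
    qed
    then show ?thesis using that by (metis cong_def)
  qed
  have pc: "f \<in> {..k} \<rightarrow> carrier G" if "\<And>j. f j \<in> carrier G" for f and k :: nat using that by auto
  have hom_fp: "a (finprod G f {..k}) = finprod G (\<lambda>j. a (f j)) {..k}" if f: "\<And>j. f j \<in> carrier G" for f and k :: nat
  proof (induction k)
    case 0
    then show ?case using f endo_simps(1)[OF a f] by simp
  next
    case (Suc k)
    have "a (f (Suc k) \<otimes> finprod G f {..k}) = a (f (Suc k)) \<otimes> finprod G (\<lambda>j. a (f j)) {..k}"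
      using endo_simps(2)[OF a f finprod_closed[OF pc[OF f]]] Suc by simp
    then show ?case using f endo_simps(1)[OF a f] by simp
  qed
  have pow_fp: "finprod G f {..k} [^] (m::nat) = finprod G (\<lambda>j. f j [^] m) {..k}" if f: "\<And>j. f j \<in> carrier G" for f m and k :: nat
  proof (induction k)
    case 0
    then show ?case using f by simp
  next
    case (Suc k)
    have "(f (Suc k) \<otimes> finprod G f {..k}) [^] m = f (Suc k) [^] m \<otimes> finprod G (\<lambda>j. f j [^] m) {..k}"
      using nat_pow_distrib[OF f finprod_closed[OF pc[OF f]]] Suc by simp
    then show ?case using f by simp
  qed
  define w where "w m = finprod G (\<lambda>j. u j [^] (m ^ (Suc n - j))) {..n}" for m :: nat
  have wG: "w m \<in> carrier G" for m unfolding w_def using u by (intro finprod_closed) auto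
  have "a (w m) = w m [^] m" for m
  proof -
    let ?h = "\<lambda>j. u j [^] (m ^ (n + 2 - j))"
    have hG: "?h j \<in> carrier G" for j using u by simp
    \<comment> \<open>One product over \<open>0..n + 1\<close> is read in two ways. Splitting off
      the last factor leaves \<open>w m [^] m\<close>; splitting off the first leaves
      \<open>a (w m)\<close>. The two end factors agree because \<open>u\<close> is periodic and
      \<open>m^p = m\<close> modulo \<open>p\<close>.\<close>
    have e1: "finprod G ?h {..Suc n} = v [^] m \<otimes> w m [^] m"
    proof -
      have "w m [^] m = finprod G (\<lambda>j. (u j [^] (m ^ (Suc n - j))) [^] m) {..n}"
        unfolding w_def using u by (intro pow_fp) simp
      also have "\<dots> = finprod G ?h {..n}"
      proof (rule finprod_cong')
        show "(u j [^] (m ^ (Suc n - j))) [^] m = ?h j" if "j \<in> {..n}" for j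
        proof -
          have "m ^ (n + 2 - j) = m ^ (Suc n - j) * m" using that by (simp add: Suc_diff_le)
          then show ?thesis using u by (simp only: nat_pow_pow)
        qed
      qed (use hG in auto)
      finally show ?thesis using hG u0 by simp
    qed
    have e2: "finprod G ?h {..Suc n} = a (w m) \<otimes> v [^] m"
    proof -
      have "a (w m) = finprod G (\<lambda>j. a (u j [^] (m ^ (Suc n - j)))) {..n}"
        unfolding w_def using u by (intro hom_fp) simp
      also have "\<dots> = finprod G (\<lambda>j. ?h (Suc j)) {..n}"
        by (rule finprod_cong') (use u hG in \<open>auto simp: hom_pow[OF a u] au\<close>)
      finally have "finprod G ?h {..Suc n} = a (w m) \<otimes> ?h 0" using hG by (simp only: finprod_Suc2 Pi_I)
      moreover have "?h 0 = v [^] m"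
        using pm[OF v(1), of "m ^ p" m] cong_power_prime_power[OF p, of m 1] p2 u0 by simp
      ultimately show ?thesis by simp
    qed
    have "v [^] m \<otimes> w m [^] m = v [^] m \<otimes> a (w m)"
      using e1 e2 wG v endo_simps(1)[OF a wG] by (simp add: m_comm)
    then show ?thesis using wG v endo_simps(1)[OF a wG] by simp
  qed
  then have w1: "w m = \<one>" for m using no wG by blast
  \<comment> \<open>The left side is the product of the trivial vectors \<open>w m\<close> over
    \<open>m\<close> in \<open>M\<close>, with the exponents of each \<open>u j\<close>
    collected.\<close>
  have "finprod G (\<lambda>j. u j [^] (\<Sum>m\<in>M. m ^ (Suc n - j))) {..n} = \<one>" if "finite M" for M :: "nat set"
    using that
  proof (induction M)
    case empty
    then show ?case by (simp add: finprod_one_eqI)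
  next
    case (insert x M)
    have "finprod G (\<lambda>j. u j [^] (\<Sum>m\<in>insert x M. m ^ (Suc n - j))) {..n} =
        finprod G (\<lambda>j. u j [^] (x ^ (Suc n - j)) \<otimes> u j [^] (\<Sum>m\<in>M. m ^ (Suc n - j))) {..n}"
      using insert u by (intro finprod_cong') (auto simp: nat_pow_mult)
    also have "\<dots> = w x \<otimes> finprod G (\<lambda>j. u j [^] (\<Sum>m\<in>M. m ^ (Suc n - j))) {..n}"
      unfolding w_def using u by (intro finprod_multf) auto
    finally show ?case using w1 insert by simp
  qed
  then have "\<one> = finprod G (\<lambda>j. u j [^] (\<Sum>m\<in>{1..<p}. m ^ (Suc n - j))) {..n}" by simp
  \<comment> \<open>Only \<open>j = 0\<close> survives: its exponents sum to \<open>p - 1\<close> by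
    Fermat, while the power sums of degree 1 to \<open>p - 2\<close> vanish modulo
    \<open>p\<close>.\<close>
  also have "\<dots> = finprod G (\<lambda>j. if j = 0 then v [^] (p - 1) else \<one>) {..n}"
  proof (rule finprod_cong')
    show "u j [^] (\<Sum>m\<in>{1..<p}. m ^ (Suc n - j)) = (if j = 0 then v [^] (p - 1) else \<one>)" if j: "j \<in> {..n}" for j
    proof (cases "j = 0")
      case True
      have "[(\<Sum>m\<in>{1..<p}. m ^ (p - 1)) = (\<Sum>m\<in>{1..<p}. 1)] (mod p)"
        by (rule cong_sum, rule fermat_theorem[OF p]) (auto simp: nat_dvd_not_less)
      then have "[(\<Sum>m\<in>{1..<p}. m ^ (Suc n - 0)) = p - 1] (mod p)" using p2 by simp
      then have "v [^] (\<Sum>m\<in>{1..<p}. m ^ (Suc n - 0)) = v [^] (p - 1)" by (rule pm[OF v(1)])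
      then show ?thesis using True by (simp only: u0 if_True simp_thms)
    next
      case False
      then have "p dvd (\<Sum>m\<in>{1..<p}. m ^ (Suc n - j))"
        using j p2 by (intro prime_dvd_power_sum[OF p]) auto
      then have "[(\<Sum>m\<in>{1..<p}. m ^ (Suc n - j)) = 0] (mod p)" by (simp add: cong_0_iff)
      then have "u j [^] (\<Sum>m\<in>{1..<p}. m ^ (Suc n - j)) = u j [^] (0::nat)" by (rule pm[OF u])
      then show ?thesis using False by simp
    qed
  qed (use v in auto)
  also have "\<dots> = v [^] (p - 1)"
    using finprod_singleton_swap[of 0 "{..n}" "\<lambda>j. v [^] (p - 1)"] v by simp
  finally have "v [^] (p - 1) \<otimes> v = v" using v by simp
  then have "v [^] p = v" using p2 by (metis Group.nat_pow_Suc Suc_diff_1 add_2_eq_Suc' zero_less_Suc)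
  then show False using ex v by simp
qed

section \<open>Common eigenvectors and invariant series\<close>

context finite_p_group
begin

text \<open>Among the central elements of order dividing \<open>p\<close>, take a minimal nontrivial
  \<open>B\<close>-invariant subgroup \<open>W\<close>. An eigenspace of \<open>b\<close> in
  \<open>W\<close> is nontrivial and, by commutation, invariant, so it is all of \<open>W\<close>;
  any nontrivial element of \<open>W\<close> then works for every \<open>b\<close>.\<close>

lemma exists_common_eigenvector:
  assumes ne: "carrier G \<noteq> {\<one>}" and B: "\<And>b. b \<in> B \<Longrightarrow> b \<in> hom G G" "\<And>b. b \<in> B \<Longrightarrow> inj_on b (carrier G)"
    and per: "\<And>b z. \<lbrakk>b \<in> B; z \<in> carrier G; \<And>g. g \<in> carrier G \<Longrightarrow> g \<otimes> z = z \<otimes> g\<rbrakk> \<Longrightarrow> (b ^^ (p - 1)) z = z"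
    and com: "\<And>b c z. \<lbrakk>b \<in> B; c \<in> B; z \<in> carrier G; \<And>g. g \<in> carrier G \<Longrightarrow> g \<otimes> z = z \<otimes> g\<rbrakk> \<Longrightarrow> b (c z) = c (b z)"
  shows "\<exists>z\<in>carrier G. z \<noteq> \<one> \<and> z [^] p = \<one> \<and> (\<forall>g\<in>carrier G. g \<otimes> z = z \<otimes> g) \<and> (\<forall>b\<in>B. \<exists>m::nat. b z = z [^] m)"
proof -
  define V where "V = {z \<in> carrier G. z [^] p = \<one> \<and> (\<forall>g\<in>carrier G. g \<otimes> z = z \<otimes> g)}"
  have VD: "z \<in> carrier G" "z [^] p = \<one>" "g \<in> carrier G \<Longrightarrow> g \<otimes> z = z \<otimes> g" if "z \<in> V" for z g
    using that by (auto simp: V_def)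
  have sub: "subgroup {z \<in> W. b z = z [^] m} G" if W: "subgroup W G" "W \<subseteq> V" and b: "b \<in> hom G G" for W b and m :: nat
  proof (rule finite_subgroupI)
    have WG: "W \<subseteq> carrier G" using W subgroup.subset by blast
    show "finite {z \<in> W. b z = z [^] m}" using finite_subgroup[OF W(1)] by simp
    show "{z \<in> W. b z = z [^] m} \<subseteq> carrier G" using WG by blast
    have "\<one> \<in> {z \<in> W. b z = z [^] m}" using endo_simps(3)[OF b] subgroup.one_closed[OF W(1)] by simp
    then show "{z \<in> W. b z = z [^] m} \<noteq> {}" by blast
    fix x y assume xy: "x \<in> {z \<in> W. b z = z [^] m}" "y \<in> {z \<in> W. b z = z [^] m}"
    then have G: "x \<in> carrier G" "y \<in> carrier G" and c: "x \<otimes> y = y \<otimes> x" using WG VD(3) W(2) by blast+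
    show "x \<otimes> y \<in> {z \<in> W. b z = z [^] m}"
      using xy endo_simps(2)[OF b G] subgroup.m_closed[OF W(1)] pow_mult_distrib[OF c G] by simp
  qed
  have Vs: "subgroup V G"
  proof (rule finite_subgroupI)
    show "finite V" unfolding V_def using finite_carrier by simp
    show "V \<subseteq> carrier G" unfolding V_def by blast
    have "\<one> \<in> V" by (simp add: V_def)
    then show "V \<noteq> {}" by blast
    fix x y assume xy: "x \<in> V" "y \<in> V"
    note G = VD(1)[OF xy(1)] VD(1)[OF xy(2)]
    have c: "x \<otimes> y = y \<otimes> x" using VD(3)[OF xy(2) G(1)] .
    have "g \<otimes> (x \<otimes> y) = x \<otimes> y \<otimes> g" if g: "g \<in> carrier G" for g
    proof -
      have "g \<otimes> (x \<otimes> y) = (g \<otimes> x) \<otimes> y" using G g by (simp add: m_assoc)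
      also have "g \<otimes> x = x \<otimes> g" using VD(3)[OF xy(1) g] .
      also have "(x \<otimes> g) \<otimes> y = x \<otimes> (g \<otimes> y)" using G g by (simp add: m_assoc)
      also have "g \<otimes> y = y \<otimes> g" using VD(3)[OF xy(2) g] .
      finally show ?thesis using G g by (simp add: m_assoc)
    qed
    then show "x \<otimes> y \<in> V"
      using G pow_mult_distrib[OF c G, of p] VD(2)[OF xy(1)] VD(2)[OF xy(2)] by (simp add: V_def)
  qed
  have Vinv: "preserves B V"
    unfolding preserves_def
  proof (intro ballI subsetI)
    fix b y assume b: "b \<in> B" and "y \<in> b ` V"
    then obtain z where z: "z \<in> V" "y = b z" by blast
    note hm = B(1)[OF b]
    have "b ` carrier G = carrier G"
      using endo_inj_surj[OF finite_carrier _ B(2)[OF b]] endo_simps(1)[OF hm] by blast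
    then have "g \<otimes> y = y \<otimes> g" if gG: "g \<in> carrier G" for g
    proof -
      obtain g' where g': "g' \<in> carrier G" "g = b g'" using \<open>b ` carrier G = carrier G\<close> gG by blast
      have "b (g' \<otimes> z) = b (z \<otimes> g')" using VD(3)[OF z(1) g'(1)] by simp
      then show ?thesis using endo_simps(2)[OF hm] g' z VD(1)[OF z(1)] by simp
    qed
    moreover have "y [^] p = \<one>" using hom_pow[OF hm VD(1)[OF z(1)], of p] VD(2)[OF z(1)] z endo_simps(3)[OF hm] by simp
    ultimately show "y \<in> V" using endo_simps(1)[OF hm VD(1)[OF z(1)]] z by (simp add: V_def)
  qed
  have Vne: "V \<noteq> {\<one>}"
  proof -
    obtain y where y: "y \<in> carrier G" "y \<noteq> \<one>" "\<forall>g\<in>carrier G. g \<otimes> y = y \<otimes> g" using center_nontrivial[OF ne] by blast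
    obtain j where j: "y [^] (p ^ j) \<notin> {\<one>}" "(y [^] (p ^ j)) [^] p \<in> {\<one>}"
      using last_power_outside[OF triv_subgroup y(1)] y(2) by blast
    have "g \<otimes> y [^] i = y [^] i \<otimes> g" if "g \<in> carrier G" for g and i :: nat
      using group_commutes_pow[of y g i] y that by metis
    then have "y [^] (p ^ j) \<in> V" using j y(1) by (simp add: V_def)
    then show ?thesis using j by blast
  qed
  let ?P = "\<lambda>W. subgroup W G \<and> W \<subseteq> V \<and> W \<noteq> {\<one>} \<and> preserves B W"
  obtain W where W: "?P W" "\<And>W'. ?P W' \<Longrightarrow> card W \<le> card W'"
    using ex_has_least_nat[of ?P V card] Vs Vne Vinv by blast
  have Ws: "subgroup W G" "W \<subseteq> V" "W \<noteq> {\<one>}" "preserves B W" using W(1) by auto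
  obtain w where w: "w \<in> W" "w \<noteq> \<one>" using Ws(3) subgroup.one_closed[OF Ws(1)] by blast
  have WG: "x \<in> carrier G" if "x \<in> W" for x using that VD(1) Ws(2) by blast
  have "\<exists>m::nat. b w = w [^] m" if b: "b \<in> B" for b
  proof -
    let ?W = "G\<lparr>carrier := W\<rparr>"
    note hm = B(1)[OF b]
    have bW: "b x \<in> W" if "x \<in> W" for x using that Ws(4) b by (auto simp: preserves_def)
    interpret W: comm_group ?W
    proof (rule group.group_comm_groupI)
      show "group ?W" using subgroup.subgroup_is_group[OF Ws(1) is_group] .
      fix x y assume "x \<in> carrier ?W" "y \<in> carrier ?W"
      then show "x \<otimes>\<^bsub>?W\<^esub> y = y \<otimes>\<^bsub>?W\<^esub> x" using VD(3)[of y x] Ws(2) WG by auto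
    qed
    have "\<exists>z\<in>carrier ?W. z \<noteq> \<one>\<^bsub>?W\<^esub> \<and> (\<exists>m::nat. b z = z [^]\<^bsub>?W\<^esub> m)"
    proof (rule W.exists_eigenvector[OF prime_p])
      show "b \<in> hom ?W ?W" using bW endo_simps(2)[OF hm] WG by (auto simp: hom_def)
      show "x [^]\<^bsub>?W\<^esub> p = \<one>\<^bsub>?W\<^esub>" if "x \<in> carrier ?W" for x
        using that VD(2) Ws(2) by (auto simp: nat_pow_consistent[symmetric])
      fix x assume "x \<in> carrier ?W"
      then have xW: "x \<in> W" by simp
      show "(b ^^ (p - 1)) x = x"
        by (rule per[OF b WG[OF xW]]) (rule VD(3)[OF subsetD[OF Ws(2) xW]])
    next
      show "w \<in> carrier ?W" "w \<noteq> \<one>\<^bsub>?W\<^esub>" using w by auto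
    qed
    then obtain z m where z: "z \<in> W" "z \<noteq> \<one>" "b z = z [^] (m::nat)"
      by (auto simp: nat_pow_consistent[symmetric])
    let ?U = "{z \<in> W. b z = z [^] m}"
    have Us: "subgroup ?U G" using sub[OF Ws(1,2) hm] .
    have "preserves B ?U"
      unfolding preserves_def
    proof (intro ballI subsetI)
      fix c y assume c: "c \<in> B" and "y \<in> c ` ?U"
      then obtain x where x: "x \<in> W" "b x = x [^] m" "y = c x" by blast
      have xG: "x \<in> carrier G" using WG[OF x(1)] .
      have cen: "\<And>g. g \<in> carrier G \<Longrightarrow> g \<otimes> x = x \<otimes> g" using VD(3) Ws(2) x(1) by blast
      have "b (c x) = c (b x)" using com[OF b c xG cen] .
      also have "\<dots> = c x [^] m" using hom_pow[OF B(1)[OF c] xG] x(2) by simp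
      finally have "b y = y [^] m" using x(3) by simp
      moreover have "y \<in> W" using x c Ws(4) by (auto simp: preserves_def)
      ultimately show "y \<in> ?U" by blast
    qed
    moreover have "?U \<noteq> {\<one>}" using z by blast
    ultimately have "card W \<le> card ?U" using W(2)[of ?U] Us Ws(2) by blast
    then have "?U = W" using subgroup_eqI_card[OF Ws(1), of ?U] by blast
    then show ?thesis using w by blast
  qed
  then show ?thesis using w Ws(2) VD by blast
qed

lemma cyclic_of_prime_order: "order G = p \<Longrightarrow> cyclic_group G"
proof -
  assume o: "order G = p"
  then have "carrier G \<noteq> {\<one>}" using p_gt_1 order_one_triv_iff by simp
  then obtain x where x: "x \<in> carrier G" "x \<noteq> \<one>" using one_closed by blast
  have "\<exists>i::nat. y = x [^] i" if y: "y \<in> carrier G" for y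
    using index_p_decomp[OF triv_subgroup subgroup_self _ _ x(1) _ y] o x by (auto simp: order_def)
  then have "carrier G \<subseteq> range (\<lambda>n::int. x [^] n)" by (metis int_pow_int rangeI subsetI)
  then have "carrier G = range (\<lambda>n::int. x [^] n)" using x by auto
  then show ?thesis unfolding cyclic_group using x by blast
qed

lemma cyclic_factor:
  assumes T: "subgroup T G" and n: "\<And>x. x \<in> carrier G \<Longrightarrow> normalizes x T" and c: "order G = p * card T"
  shows "cyclic_group (G Mod T)"
proof -
  have "T \<lhd> G" using T n by (auto simp: normal_inv_iff normalizes_def)
  then interpret T: normal T G .
  have "card T > 0" using finite_subgroup[OF T] subgroup.one_closed[OF T] card_gt_0_iff by blast
  then have o: "order (G Mod T) = p"
    using lagrange[OF T] c by (simp add: order_def FactGroup_def)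
  interpret F: group "G Mod T" by (rule T.factorgroup_is_group)
  interpret F: finite_p_group "G Mod T" p
    using o prime_p by unfold_locales (auto intro: exI[of _ 1])
  show ?thesis using F.cyclic_of_prime_order[OF o] .
qed

text \<open>Periodicity and commutation hold only up to conjugation, but conjugation is trivial on
  the center of \<open>G Mod T\<close>, where the eigenvector is sought. Its representative is
  adjoined to \<open>T\<close>.\<close>

lemma invariant_extension:
  assumes A: "A \<subseteq> hom G G" "\<And>\<alpha>. \<alpha> \<in> A \<Longrightarrow> inj_on \<alpha> (carrier G)"
    and per: "\<And>\<alpha>. \<alpha> \<in> A \<Longrightarrow> \<exists>g\<in>carrier G. \<forall>x\<in>carrier G. (\<alpha> ^^ (p - 1)) x = g \<otimes> x \<otimes> inv g"
    and com: "\<And>\<alpha> \<beta>. \<lbrakk>\<alpha> \<in> A; \<beta> \<in> A\<rbrakk> \<Longrightarrow> \<exists>g\<in>carrier G. \<forall>x\<in>carrier G. \<alpha> (\<beta> x) = \<beta> (\<alpha> (g \<otimes> x \<otimes> inv g))"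
    and T: "subgroup T G" "preserves A T" "\<And>x. x \<in> carrier G \<Longrightarrow> normalizes x T" "T \<noteq> carrier G"
  shows "\<exists>T'. subgroup T' G \<and> preserves A T' \<and> T \<subseteq> T' \<and> card T' = p * card T"
proof -
  have "T \<lhd> G" using T(1,3) by (auto simp: normal_inv_iff normalizes_def)
  then interpret T: normal T G .
  let ?E = "G Mod T"
  interpret F: group ?E by (rule T.factorgroup_is_group)
  interpret F: finite_p_group ?E p
  proof -
    obtain n where "order G = p ^ n" using order_eq_power by blast
    then have "card (rcosets T) dvd p ^ n" using lagrange[OF T(1)] by (metis dvd_triv_left)
    then obtain k where "card (rcosets T) = p ^ k" using divides_primepow_nat[OF prime_p] by blast
    then show "finite_p_group ?E p"
      using prime_p F.is_group by (auto simp: finite_p_group_def finite_p_group_axioms_def order_def FactGroup_def)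
  qed
  let ?\<pi> = "\<lambda>x. T #> x"
  have \<pi>hom: "?\<pi> \<in> hom G ?E" by (rule T.r_coset_hom_Mod)
  have carE: "carrier ?E = ?\<pi> ` carrier G" by (rule carrier_FactGroup)
  have repE: "\<exists>x. x \<in> carrier G \<and> Y = ?\<pi> x" if "Y \<in> carrier ?E" for Y using that unfolding carE by blast
  have \<pi>E: "?\<pi> x \<in> carrier ?E" if "x \<in> carrier G" for x using that unfolding carE by blast
  have oneE: "\<one>\<^bsub>?E\<^esub> = T" by (simp add: FactGroup_def)
  have \<pi>mult: "?\<pi> x \<otimes>\<^bsub>?E\<^esub> ?\<pi> y = ?\<pi> (x \<otimes> y)" if "x \<in> carrier G" "y \<in> carrier G" for x y
    using hom_mult[OF \<pi>hom that] by simp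
  have \<pi>one: "?\<pi> x = T \<longleftrightarrow> x \<in> T" if "x \<in> carrier G" for x
    using that coset_join1[OF _ that T(1)] coset_join2[OF that T(1)] by blast
  have TG: "T \<subseteq> carrier G" using T.subset .
  have \<alpha>T: "\<alpha> ` T = T" if "\<alpha> \<in> A" for \<alpha>
    using endo_inj_surj[OF finite_subgroup[OF T(1)]] T(2) that inj_on_subset[OF A(2)[OF that] TG]
    by (auto simp: preserves_def)
  have \<alpha>\<pi>: "\<alpha> ` ?\<pi> x = ?\<pi> (\<alpha> x)" if \<alpha>: "\<alpha> \<in> A" and x: "x \<in> carrier G" for \<alpha> x
  proof -
    have hm: "\<alpha> \<in> hom G G" using \<alpha> A by blast
    have "\<alpha> ` ?\<pi> x = (\<lambda>t. \<alpha> t \<otimes> \<alpha> x) ` T"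
      using endo_simps(2)[OF hm _ x] TG by (force simp: r_coset_def)
    also have "\<dots> = ?\<pi> (\<alpha> x)"
      using \<alpha>T[OF \<alpha>] by (force simp: r_coset_def)
    finally show ?thesis .
  qed
  \<comment> \<open>Automorphisms act on cosets by images; these are cosets again because each
    \<open>\<alpha>\<close> maps \<open>T\<close> onto itself.\<close>
  let ?B = "(\<lambda>\<alpha> Y. \<alpha> ` Y) ` A"
  have cl: "\<alpha> x \<in> carrier G" if "\<alpha> \<in> A" "x \<in> carrier G" for \<alpha> x using endo_simps(1) A that by blast
  have conj: "?\<pi> (g \<otimes> x \<otimes> inv g) = ?\<pi> x"
    if g: "g \<in> carrier G" and x: "x \<in> carrier G" and cen: "\<And>Y. Y \<in> carrier ?E \<Longrightarrow> Y \<otimes>\<^bsub>?E\<^esub> ?\<pi> x = ?\<pi> x \<otimes>\<^bsub>?E\<^esub> Y" for g x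
  proof -
    have "?\<pi> (g \<otimes> x \<otimes> inv g) = (?\<pi> g \<otimes>\<^bsub>?E\<^esub> ?\<pi> x) \<otimes>\<^bsub>?E\<^esub> ?\<pi> (inv g)" using g x \<pi>mult by simp
    also have "?\<pi> g \<otimes>\<^bsub>?E\<^esub> ?\<pi> x = ?\<pi> x \<otimes>\<^bsub>?E\<^esub> ?\<pi> g" using cen carE g by blast
    also have "(?\<pi> x \<otimes>\<^bsub>?E\<^esub> ?\<pi> g) \<otimes>\<^bsub>?E\<^esub> ?\<pi> (inv g) = ?\<pi> (x \<otimes> g \<otimes> inv g)" using g x \<pi>mult by simp
    also have "x \<otimes> g \<otimes> inv g = x" using g x by (simp add: m_assoc)
    finally show ?thesis .
  qed
  have iter: "((\<lambda>Y. \<alpha> ` Y) ^^ k) (?\<pi> x) = ?\<pi> ((\<alpha> ^^ k) x) \<and> (\<alpha> ^^ k) x \<in> carrier G" if "\<alpha> \<in> A" "x \<in> carrier G" for \<alpha> x k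
    using that by (induction k) (auto simp: \<alpha>\<pi> cl)
  have "carrier ?E \<noteq> {\<one>\<^bsub>?E\<^esub>}"
  proof
    assume "carrier ?E = {\<one>\<^bsub>?E\<^esub>}"
    then have "?\<pi> ` carrier G = {T}" by (simp only: carE oneE)
    then have "x \<in> T" if "x \<in> carrier G" for x using \<pi>one[OF that] that by blast
    then show False using T(4) TG by blast
  qed
  then have "\<exists>z\<in>carrier ?E. z \<noteq> \<one>\<^bsub>?E\<^esub> \<and> z [^]\<^bsub>?E\<^esub> p = \<one>\<^bsub>?E\<^esub> \<and>
      (\<forall>g\<in>carrier ?E. g \<otimes>\<^bsub>?E\<^esub> z = z \<otimes>\<^bsub>?E\<^esub> g) \<and> (\<forall>b\<in>?B. \<exists>m::nat. b z = z [^]\<^bsub>?E\<^esub> m)"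
  proof (rule F.exists_common_eigenvector)
    fix b assume "b \<in> ?B"
    then obtain \<alpha> where \<alpha>: "\<alpha> \<in> A" "b = (\<lambda>Y. \<alpha> ` Y)" by blast
    have hm: "\<alpha> \<in> hom G G" using \<alpha> A by blast
    show "b \<in> hom ?E ?E"
    proof (rule homI)
      fix Y Z assume YZ: "Y \<in> carrier ?E" "Z \<in> carrier ?E"
      obtain x where x: "x \<in> carrier G" "Y = ?\<pi> x" using repE[OF YZ(1)] by (elim exE conjE)
      obtain y where y: "y \<in> carrier G" "Z = ?\<pi> y" using repE[OF YZ(2)] by (elim exE conjE)
      note xy = x y
      show "b Y \<in> carrier ?E"
        unfolding \<alpha>(2) xy(2) by (simp only: \<alpha>\<pi>[OF \<alpha>(1) xy(1)] \<pi>E cl[OF \<alpha>(1) xy(1)])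
      show "b (Y \<otimes>\<^bsub>?E\<^esub> Z) = b Y \<otimes>\<^bsub>?E\<^esub> b Z"
      proof -
        have "b (Y \<otimes>\<^bsub>?E\<^esub> Z) = \<alpha> ` ?\<pi> (x \<otimes> y)"
          unfolding \<alpha>(2) xy(2,4) by (simp only: \<pi>mult[OF xy(1,3)])
        also have "\<dots> = ?\<pi> (\<alpha> (x \<otimes> y))" by (rule \<alpha>\<pi>[OF \<alpha>(1)]) (use xy in simp)
        also have "\<alpha> (x \<otimes> y) = \<alpha> x \<otimes> \<alpha> y" by (rule endo_simps(2)[OF hm xy(1,3)])
        also have "?\<pi> (\<alpha> x \<otimes> \<alpha> y) = ?\<pi> (\<alpha> x) \<otimes>\<^bsub>?E\<^esub> ?\<pi> (\<alpha> y)"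
          by (rule \<pi>mult[OF cl[OF \<alpha>(1) xy(1)] cl[OF \<alpha>(1) xy(3)], symmetric])
        finally show ?thesis
          unfolding \<alpha>(2) xy(2,4) by (simp only: \<alpha>\<pi>[OF \<alpha>(1) xy(1)] \<alpha>\<pi>[OF \<alpha>(1) xy(3)])
      qed
    qed
    show "inj_on b (carrier ?E)"
    proof
      fix Y Z assume YZ: "Y \<in> carrier ?E" "Z \<in> carrier ?E" "b Y = b Z"
      have "Y \<subseteq> carrier G" "Z \<subseteq> carrier G" using YZ r_coset_subset_G[OF TG] unfolding carE by blast+
      then show "Y = Z" using YZ(3) \<alpha>(2) inj_on_image_eq_iff[OF A(2)[OF \<alpha>(1)]] by simp
    qed
    fix Z assume Z: "Z \<in> carrier ?E" and cen: "\<And>g. g \<in> carrier ?E \<Longrightarrow> g \<otimes>\<^bsub>?E\<^esub> Z = Z \<otimes>\<^bsub>?E\<^esub> g"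
    obtain x where x: "x \<in> carrier G" "Z = ?\<pi> x" using repE[OF Z] by (elim exE conjE)
    obtain g where g: "g \<in> carrier G" "\<And>x. x \<in> carrier G \<Longrightarrow> (\<alpha> ^^ (p - 1)) x = g \<otimes> x \<otimes> inv g" using per[OF \<alpha>(1)] by blast
    have "(b ^^ (p - 1)) Z = ?\<pi> (g \<otimes> x \<otimes> inv g)" using iter[OF \<alpha>(1) x(1), of "p - 1"] x g \<alpha>(2) by simp
    then show "(b ^^ (p - 1)) Z = Z" using conj[OF g(1) x(1)] cen x by simp
  next
    fix b c Z assume "b \<in> ?B" "c \<in> ?B" and Z: "Z \<in> carrier ?E" and cen: "\<And>g. g \<in> carrier ?E \<Longrightarrow> g \<otimes>\<^bsub>?E\<^esub> Z = Z \<otimes>\<^bsub>?E\<^esub> g"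
    then obtain \<alpha> \<beta> where \<alpha>: "\<alpha> \<in> A" "b = (\<lambda>Y. \<alpha> ` Y)" and \<beta>: "\<beta> \<in> A" "c = (\<lambda>Y. \<beta> ` Y)" by blast
    obtain x where x: "x \<in> carrier G" "Z = ?\<pi> x" using repE[OF Z] by (elim exE conjE)
    obtain g where g: "g \<in> carrier G" "\<alpha> (\<beta> x) = \<beta> (\<alpha> (g \<otimes> x \<otimes> inv g))" using com[OF \<alpha>(1) \<beta>(1)] x by blast
    have gx: "g \<otimes> x \<otimes> inv g \<in> carrier G" using g x by simp
    have "b (c Z) = ?\<pi> (\<alpha> (\<beta> x))"
      unfolding \<alpha>(2) \<beta>(2) x(2) by (simp only: \<alpha>\<pi> \<alpha>(1) \<beta>(1) x(1) cl)
    also have "\<dots> = c (b (?\<pi> (g \<otimes> x \<otimes> inv g)))"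
      unfolding g(2) \<alpha>(2) \<beta>(2) by (simp only: \<alpha>\<pi> \<alpha>(1) \<beta>(1) gx cl)
    also have "?\<pi> (g \<otimes> x \<otimes> inv g) = Z" using conj[OF g(1) x(1)] cen x by simp
    finally show "b (c Z) = c (b Z)" .
  qed
  then obtain Z where Z: "Z \<in> carrier ?E" "Z \<noteq> T" "Z [^]\<^bsub>?E\<^esub> p = T" and ZB: "\<forall>b\<in>?B. \<exists>m::nat. b Z = Z [^]\<^bsub>?E\<^esub> m"
    unfolding oneE by (elim bexE conjE)
  obtain x where x: "x \<in> carrier G" "Z = ?\<pi> x" using repE[OF Z(1)] by (elim exE conjE)
  have \<pi>pow: "?\<pi> x [^]\<^bsub>?E\<^esub> k = ?\<pi> (x [^] k)" for k :: nat
    using hom_nat_pow[OF \<pi>hom x(1) is_group F.is_group, of k] by simp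
  have xT: "x \<notin> T" using Z x \<pi>one by blast
  have xp: "x [^] p \<in> T" using Z(3) x \<pi>pow \<pi>one[of "x [^] p"] by simp
  let ?T = "adjoin T x"
  have nx: "normalizes x T" using T(3) x by blast
  have T': "subgroup ?T G" "T \<subseteq> ?T" "x \<in> ?T" "card ?T = p * card T"
    using subgroup_adjoin[OF T(1) x(1) nx] adjoin_incl[OF T(1) x(1) nx] card_adjoin[OF T(1) x(1) nx xT xp] by auto
  have "preserves A ?T"
    unfolding preserves_def
  proof (intro ballI subsetI)
    fix \<alpha> y assume \<alpha>: "\<alpha> \<in> A" and "y \<in> \<alpha> ` ?T"
    then obtain t i where t: "t \<in> T" "y = \<alpha> (t \<otimes> x [^] (i::nat))" by (auto simp: adjoin_def)
    have hm: "\<alpha> \<in> hom G G" using \<alpha> A by blast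
    obtain m where "\<alpha> ` Z = Z [^]\<^bsub>?E\<^esub> (m::nat)" using ZB \<alpha> by blast
    then have "?\<pi> (\<alpha> x) = ?\<pi> (x [^] m)" using x \<alpha>\<pi>[OF \<alpha>] \<pi>pow by simp
    then have "\<alpha> x \<in> ?\<pi> (x [^] m)" using rcos_self[OF cl[OF \<alpha> x(1)] T(1)] by simp
    then obtain s where "s \<in> T" "\<alpha> x = s \<otimes> x [^] m" by (auto simp: r_coset_def)
    then have \<alpha>x: "\<alpha> x \<in> ?T" using T'(2) subgroup_pow[OF T'(1) T'(3)] subgroup.m_closed[OF T'(1)] by auto
    have \<alpha>t: "\<alpha> t \<in> ?T" using t T(2) \<alpha> T'(2) by (auto simp: preserves_def)
    have "y = \<alpha> t \<otimes> \<alpha> x [^] i"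
      using t endo_simps(2)[OF hm] hom_pow[OF hm x(1)] x TG by auto
    then show "y \<in> ?T" using \<alpha>t subgroup_pow[OF T'(1) \<alpha>x] subgroup.m_closed[OF T'(1)] by simp
  qed
  then show ?thesis using T' by blast
qed

text \<open>\<open>A\<close> contains the inner automorphisms, so invariant subgroups are normal and
  the one-step extension can be iterated.\<close>

lemma invariant_series:
  assumes A: "A \<subseteq> hom G G" "\<And>\<alpha>. \<alpha> \<in> A \<Longrightarrow> inj_on \<alpha> (carrier G)"
    and inner: "\<And>g. g \<in> carrier G \<Longrightarrow> \<exists>\<alpha>\<in>A. \<forall>x\<in>carrier G. \<alpha> x = g \<otimes> x \<otimes> inv g"
    and per: "\<And>\<alpha>. \<alpha> \<in> A \<Longrightarrow> \<exists>g\<in>carrier G. \<forall>x\<in>carrier G. (\<alpha> ^^ (p - 1)) x = g \<otimes> x \<otimes> inv g"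
    and com: "\<And>\<alpha> \<beta>. \<lbrakk>\<alpha> \<in> A; \<beta> \<in> A\<rbrakk> \<Longrightarrow> \<exists>g\<in>carrier G. \<forall>x\<in>carrier G. \<alpha> (\<beta> x) = \<beta> (\<alpha> (g \<otimes> x \<otimes> inv g))"
  shows "\<exists>n T. T (0::nat) = {\<one>} \<and> T n = carrier G \<and> (\<forall>i\<le>n. subgroup (T i) G \<and> preserves A (T i)) \<and>
    (\<forall>i<n. T i \<subseteq> T (Suc i) \<and> cyclic_group (G\<lparr>carrier := T (Suc i)\<rparr> Mod T i))"
proof -
  obtain n where n: "order G = p ^ n" using order_eq_power by blast
  have nrm: "normalizes x T" if T: "subgroup T G" "preserves A T" and x: "x \<in> carrier G" for T x
  proof -
    obtain \<alpha> where \<alpha>: "\<alpha> \<in> A" "\<And>y. y \<in> carrier G \<Longrightarrow> \<alpha> y = x \<otimes> y \<otimes> inv x" using inner[OF x] by blast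
    have "x \<otimes> h \<otimes> inv x \<in> T" if h: "h \<in> T" for h
    proof -
      have "\<alpha> h \<in> T" using T(2) \<alpha>(1) h by (auto simp: preserves_def)
      then show ?thesis using \<alpha>(2) h subgroup.mem_carrier[OF T(1)] by simp
    qed
    then show ?thesis by (simp add: normalizes_def)
  qed
  \<comment> \<open>Beyond \<open>n\<close> no order is prescribed, which lets the chosen sequence
    stay constant once the whole group is reached.\<close>
  let ?P = "\<lambda>i T. subgroup T G \<and> preserves A T \<and> (i \<le> n \<longrightarrow> card T = p ^ i) \<and> (i = 0 \<longrightarrow> T = {\<one>})"
  let ?Q = "\<lambda>i T T'. i < n \<longrightarrow> T \<subseteq> T' \<and> card T' = p * card T"
  have "\<exists>T. \<forall>i. ?P i (T i) \<and> ?Q i (T i) (T (Suc i))"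
  proof (rule dependent_nat_choice)
    have "preserves A {\<one>}" using A(1) endo_simps(3) by (auto simp: preserves_def)
    then show "\<exists>T. ?P 0 T" using triv_subgroup by (intro exI[of _ "{\<one>}"]) auto
    fix T i assume T: "?P i T"
    show "\<exists>T'. ?P (Suc i) T' \<and> ?Q i T T'"
    proof (cases "i < n")
      case True
      then have c: "card T = p ^ i" using T by simp
      have "T \<noteq> carrier G" using c n True p_gt_1 by (auto simp: order_def)
      then obtain T' where "subgroup T' G" "preserves A T'" "T \<subseteq> T'" "card T' = p * card T"
        using invariant_extension[OF A per com, of T] T nrm[of T] by blast
      then show ?thesis using c by (intro exI[of _ T']) auto
    next
      case False
      then show ?thesis using T by (intro exI[of _ T]) auto
    qed
  qed
  then obtain T where T0: "\<forall>i. ?P i (T i) \<and> ?Q i (T i) (T (Suc i))" by (elim exE)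
  have T: "?P i (T i)" "?Q i (T i) (T (Suc i))" for i
    using conjunct1[OF spec[OF T0, of i]] conjunct2[OF spec[OF T0, of i]] .
  have Tn: "T n = carrier G"
    using T(1)[of n] n subgroup_eqI_card[OF subgroup_self, of "T n"] subgroup.subset[of "T n" G] by (simp add: order_def)
  have "cyclic_group (G\<lparr>carrier := T (Suc i)\<rparr> Mod T i)" if i: "i < n" for i
  proof -
    have s: "subgroup (T i) G" "preserves A (T i)" "subgroup (T (Suc i)) G" using T(1)[of i] T(1)[of "Suc i"] by auto
    have q: "T i \<subseteq> T (Suc i)" "card (T (Suc i)) = p * card (T i)" using T(2)[of i] i by auto
    let ?H = "G\<lparr>carrier := T (Suc i)\<rparr>"
    interpret H: finite_p_group ?H p using finite_p_group_subgroup[OF s(3)] .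
    show ?thesis
    proof (rule H.cyclic_factor)
      show "subgroup (T i) ?H" using subgroup_incl[OF s(1,3) q(1)] .
      show "order ?H = p * card (T i)" using q by (simp add: order_def)
      fix x assume x: "x \<in> carrier ?H"
      then have xG: "x \<in> carrier G" using subgroup.mem_carrier[OF s(3)] by simp
      show "H.normalizes x (T i)"
        using nrm[OF s(1,2) xG] x m_inv_consistent[OF s(3), of x] by (simp add: normalizes_def H.normalizes_def)
    qed
  qed
  then show ?thesis using T Tn by (intro exI[of _ n] exI[of _ T]) auto
qed

end

section \<open>Rigid transvections of abelian \<open>p\<close>-groups\<close>

lemma (in group) pow_cong:
  fixes p :: nat
  assumes x: "x \<in> carrier G" "x [^] p = \<one>" and c: "[i = j] (mod p)"
  shows "x [^] (i::nat) = x [^] (j::nat)"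
proof -
  have "x [^] k = x [^] (k mod p)" for k :: nat
  proof -
    have "x [^] (p * (k div p) + k mod p) = (x [^] p) [^] (k div p) \<otimes> x [^] (k mod p)"
      using x(1) by (simp only: nat_pow_pow nat_pow_mult nat_pow_closed)
    then show ?thesis using x by simp
  qed
  then show ?thesis using c by (metis cong_def)
qed

locale finite_abelian_p_group = finite_p_group + comm_group
begin

definition fixed_points :: "('a \<Rightarrow> 'a) \<Rightarrow> 'a set" where
  "fixed_points t = {k \<in> carrier G. t k = k}"

definition displacements :: "('a \<Rightarrow> 'a) \<Rightarrow> 'a set" where
  "displacements t = {t k \<otimes> inv k | k. k \<in> carrier G}"

text \<open>Additively, \<open>t k = k + i(k) a\<close> in a possibly non-elementary abelian group.
  The first clause makes \<open>a\<close> nontrivial, hence of order \<open>p\<close>.\<close>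

definition transvection :: "('a \<Rightarrow> 'a) \<Rightarrow> bool" where
  "transvection t \<longleftrightarrow> (\<exists>k\<in>carrier G. t k \<noteq> k) \<and>
     (\<exists>a\<in>carrier G. a [^] p = \<one> \<and> t a = a \<and> (\<forall>k\<in>carrier G. \<exists>i::nat. t k = k \<otimes> a [^] i))"

text \<open>Excludes elements like the central -1 of a copy of SL(2, p) containing \<open>t\<close>,
  which commutes with \<open>t\<close> but inverts the quotient by its fixed points.\<close>

definition centrally_rigid :: "('a \<Rightarrow> 'a) set \<Rightarrow> ('a \<Rightarrow> 'a) \<Rightarrow> bool" where
  "centrally_rigid A t \<longleftrightarrow> (\<forall>h\<in>A. (\<forall>k\<in>carrier G. h (t k) = t (h k)) \<longrightarrow>
     (\<forall>k\<in>carrier G. h k \<otimes> inv k \<in> fixed_points t))"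

text \<open>Separates a transvection into its direction \<open>a\<close> and its linear form
  \<open>f\<close>, a homomorphism to the integers modulo \<open>p\<close> given by natural
  representatives.\<close>

definition transvection_data :: "('a \<Rightarrow> 'a) \<Rightarrow> 'a \<Rightarrow> ('a \<Rightarrow> nat) \<Rightarrow> bool" where
  "transvection_data t a f \<longleftrightarrow> a \<in> carrier G \<and> a [^] p = \<one> \<and> a \<noteq> \<one> \<and> p dvd f a \<and> (\<exists>k\<in>carrier G. \<not> p dvd f k) \<and>
     (\<forall>k\<in>carrier G. t k = k \<otimes> a [^] f k) \<and>
     (\<forall>k\<in>carrier G. \<forall>l\<in>carrier G. [f (k \<otimes> l) = f k + f l] (mod p))"

lemma transvection_dataD:
  assumes "transvection_data t a f"
  shows "a \<in> carrier G" "a [^] p = \<one>" "a \<noteq> \<one>" "p dvd f a"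
    "k \<in> carrier G \<Longrightarrow> t k = k \<otimes> a [^] f k"
    "k \<in> carrier G \<Longrightarrow> l \<in> carrier G \<Longrightarrow> [f (k \<otimes> l) = f k + f l] (mod p)"
    "\<exists>k\<in>carrier G. \<not> p dvd f k"
  using assms by (auto simp: transvection_data_def)

lemma pow_eq_one_iff:
  assumes "a \<in> carrier G" "a [^] p = \<one>" "a \<noteq> \<one>"
  shows "a [^] (i::nat) = \<one> \<longleftrightarrow> p dvd i"
  using pow_mem_iff[OF triv_subgroup assms(1), of i] assms by simp

lemma pow_eq_iff:
  assumes "a \<in> carrier G" "a [^] p = \<one>" "a \<noteq> \<one>" "a [^] (i::nat) = a [^] (j::nat)"
  shows "[i = j] (mod p)"
proof -
  have main: "[i = j] (mod p)" if "i \<le> j" "a [^] i = a [^] j" for i j :: nat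
  proof -
    have "a [^] i \<otimes> a [^] (j - i) = a [^] j" using assms(1) that(1) by (simp add: nat_pow_mult)
    then have "a [^] i = a [^] i \<otimes> a [^] (j - i)" using that(2) by simp
    then have "a [^] (j - i) = \<one>" by (rule mult_right_eq_oneD) (use assms in auto)
    then obtain s where "j - i = p * s" using pow_eq_one_iff[OF assms(1-3)] by (auto elim: dvdE)
    then have "j = i + p * s" using that(1) by simp
    then show ?thesis by (simp add: cong_def)
  qed
  show ?thesis using main[of i j] main[of j i] assms(4) cong_sym by (metis nle_le)
qed

text \<open>Exponents of \<open>a\<close> are determined modulo \<open>p\<close>; comparing those of
  \<open>k\<close>, \<open>l\<close> and \<open>k \<otimes> l\<close> shows that they add.\<close>

lemma transvection_imp_data:
  assumes hm: "t \<in> hom G G" and t: "transvection t"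
  shows "\<exists>a f. transvection_data t a f"
proof -
  obtain a where a: "a \<in> carrier G" "a [^] p = \<one>" "t a = a" and ex: "\<forall>k\<in>carrier G. \<exists>i::nat. t k = k \<otimes> a [^] i"
    using t by (auto simp: transvection_def)
  obtain f where f: "\<And>k. k \<in> carrier G \<Longrightarrow> t k = k \<otimes> a [^] (f k :: nat)" using ex by metis
  obtain k0 where k0: "k0 \<in> carrier G" "t k0 \<noteq> k0" using t by (auto simp: transvection_def)
  then have a1: "a \<noteq> \<one>" using f[of k0] by auto
  have nk0: "\<not> p dvd f k0"
  proof
    assume "p dvd f k0"
    then have "a [^] f k0 = \<one>" using pow_eq_one_iff[OF a(1,2) a1] by simp
    then show False using f[OF k0(1)] k0 by simp
  qed
  have "[f (k \<otimes> l) = f k + f l] (mod p)" if kl: "k \<in> carrier G" "l \<in> carrier G" for k l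
  proof -
    have "(k \<otimes> l) \<otimes> a [^] f (k \<otimes> l) = t (k \<otimes> l)" using f kl by simp
    also have "\<dots> = (k \<otimes> a [^] f k) \<otimes> (l \<otimes> a [^] f l)" using endo_simps(2)[OF hm kl] f kl by simp
    also have "\<dots> = (k \<otimes> l) \<otimes> a [^] (f k + f l)" using kl a by (simp add: m_ac nat_pow_mult[symmetric])
    finally have "a [^] f (k \<otimes> l) = a [^] (f k + f l)" using kl a by simp
    then show ?thesis by (rule pow_eq_iff[OF a(1,2) a1])
  qed
  moreover have "p dvd f a"
  proof -
    have "a = a \<otimes> a [^] f a" using f[OF a(1)] a(3) by simp
    then have "a [^] f a = \<one>" by (rule mult_right_eq_oneD) (use a in auto)
    then show ?thesis using pow_eq_one_iff[OF a(1,2) a1] by simp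
  qed
  ultimately have "transvection_data t a f" using a a1 f k0(1) nk0 by (auto simp: transvection_data_def)
  then show ?thesis by blast
qed

lemma transvection_data_fixed:
  assumes d: "transvection_data t a f" and k: "k \<in> carrier G"
  shows "k \<in> fixed_points t \<longleftrightarrow> p dvd f k"
proof -
  note D = transvection_dataD[OF d]
  have "k \<in> fixed_points t \<longleftrightarrow> k \<otimes> a [^] f k = k" using D(5)[OF k] k by (simp add: fixed_points_def)
  also have "\<dots> \<longleftrightarrow> a [^] f k = \<one>"
    using mult_right_eq_oneD[of k "a [^] f k"] k D(1) by auto
  finally show ?thesis using pow_eq_one_iff[OF D(1-3)] by simp
qed

lemma transvection_data_pow:
  assumes d: "transvection_data t a f" and k: "k \<in> carrier G"
  shows "[f (k [^] (n::nat)) = n * f k] (mod p)"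
proof (induction n)
  case 0
  have "[f (\<one> \<otimes> \<one>) = f \<one> + f \<one>] (mod p)" using transvection_dataD(6)[OF d] by blast
  then have "[f \<one> + 0 = f \<one> + f \<one>] (mod p)" by simp
  then have "[0 = f \<one>] (mod p)" by (simp only: cong_add_lcancel_nat)
  then show ?case by (simp add: cong_sym_eq)
next
  case (Suc n)
  have "[f (k [^] n \<otimes> k) = f (k [^] n) + f k] (mod p)" using transvection_dataD(6)[OF d] k by blast
  also have "[f (k [^] n) + f k = n * f k + f k] (mod p)" using cong_add[OF Suc cong_refl] .
  finally show ?case by (simp add: add.commute)
qed

text \<open>If neither transvection fixed the displacements of the other, then for a suitable power
  \<open>u\<^sup>j\<close> the automorphism \<open>(t u\<^sup>j t)\<^sup>2\<close> would act as \<open>-1\<close> on the span of \<open>a\<close> and \<open>b\<close>, and so commute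
  with \<open>t\<close> while inverting the elements modulo the fixed points of \<open>t\<close>.\<close>

lemma rigid_transvections_triangular:
  assumes odd: "odd p" and A: "A \<subseteq> hom G G"
    and compA: "\<forall>\<alpha>\<in>A. \<forall>\<beta>\<in>A. \<exists>\<gamma>\<in>A. \<forall>k\<in>carrier G. \<gamma> k = \<alpha> (\<beta> k)"
    and t: "t \<in> A" "centrally_rigid A t" "transvection_data t a f"
    and u: "u \<in> A" "transvection_data u b g"
  shows "p dvd f b \<or> p dvd g a"
proof (rule ccontr)
  assume no: "\<not> ?thesis"
  have comp: "\<exists>\<gamma>\<in>A. \<forall>k\<in>carrier G. \<gamma> k = \<alpha> (\<beta> k)" if "\<alpha> \<in> A" "\<beta> \<in> A" for \<alpha> \<beta>
    using compA that by blast
  note T = transvection_dataD[OF t(3)] and U = transvection_dataD[OF u(2)]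
  have aG: "a \<in> carrier G" and bG: "b \<in> carrier G" using T U by auto
  have fpow: "[f (k [^] (n::nat)) = n * f k] (mod p)" "[g (k [^] (n::nat)) = n * g k] (mod p)" if "k \<in> carrier G" for k n
    using transvection_data_pow[OF t(3) that] transvection_data_pow[OF u(2) that] by auto
  have "coprime p (f b * g a)" using no prime_p prime_imp_coprime_nat by simp
  then have "coprime (f b * g a) p" by (simp only: coprime_commute)
  then obtain r where r: "[f b * g a * r = 1] (mod p)" using cong_solve_coprime_nat[of "f b * g a" p] by auto
  \<comment> \<open>\<open>j\<close> represents minus the inverse of \<open>f b * g a\<close>, so
    that \<open>c * e = -1\<close> modulo \<open>p\<close>. On the span of \<open>a\<close> and
    \<open>b [^] j\<close>, the maps \<open>t\<close> and \<open>u^j\<close> are then the two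
    unipotent matrices with off-diagonal entries \<open>c\<close> and \<open>e\<close>.\<close>
  define j where "j = (p - 1) * r"
  define c where "c = j * f b"
  define e where "e = g a"
  have "p dvd c * e + 1"
  proof -
    have "c * e + 1 = (p - 1) * (f b * g a * r) + 1" by (simp add: c_def e_def j_def)
    moreover have "[(p - 1) * (f b * g a * r) + 1 = (p - 1) * 1 + 1] (mod p)"
      using cong_add[OF cong_scalar_left[OF r] cong_refl] .
    moreover have "(p - 1) * 1 + 1 = p" using p_gt_1 by simp
    ultimately show ?thesis by (simp add: cong_dvd_iff)
  qed
  then obtain s where s: "c * e + 1 = p * s" by (elim dvdE)
  \<comment> \<open>The relation \<open>c * e = -1\<close> in a form that avoids subtraction:
    multiples of \<open>c * e + 1\<close> may be dropped.\<close>
  have key: "[x = y] (mod p)" if "x = y + (c * e + 1) * z" for x y z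
    unfolding that s by (simp add: cong_def mult.assoc)
  \<comment> \<open>Closure of \<open>A\<close> under composition supplies only positive powers of
    \<open>u\<close>.\<close>
  obtain m where m: "j = Suc m"
  proof -
    have "r \<noteq> 0"
    proof
      assume "r = 0"
      then have "[0 = 1] (mod p)" using r by simp
      then show False using p_gt_1 by (simp add: cong_def)
    qed
    then have "j \<noteq> 0" using p_gt_1 by (simp add: j_def)
    then show thesis using that by (cases j) auto
  qed
  let ?b = "b [^] j"
  have bjG: "?b \<in> carrier G" using bG by simp
  have bjp: "?b [^] p = \<one>" using bG U(2) by (metis nat_pow_one nat_pow_pow mult.commute)
  have fb: "[f ?b = c] (mod p)" using fpow(1)[OF bG] by (simp add: c_def)
  have fa: "[f a = 0] (mod p)" using T(4) by (simp add: cong_0_iff)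
  have "[j * g b = 0] (mod p)" using U(4) by (simp add: cong_0_iff)
  then have gb: "[g ?b = 0] (mod p)" using cong_trans[OF fpow(2)[OF bG, of j]] by blast
  have lin: "[f (k \<otimes> a [^] x \<otimes> ?b [^] y) = f k + c * y] (mod p)"
      "[g (k \<otimes> a [^] x \<otimes> ?b [^] y) = g k + e * x] (mod p)" if k: "k \<in> carrier G" for k and x y :: nat
  proof -
    have "[f (k \<otimes> a [^] x \<otimes> ?b [^] y) = f (k \<otimes> a [^] x) + f (?b [^] y)] (mod p)" using T(6) k aG bjG by simp
    also have "[f (k \<otimes> a [^] x) + f (?b [^] y) = (f k + f (a [^] x)) + y * f ?b] (mod p)"
      using T(6) k aG fpow(1)[OF bjG] by (intro cong_add) simp_all
    also have "[(f k + f (a [^] x)) + y * f ?b = (f k + x * 0) + y * c] (mod p)"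
      using cong_trans[OF fpow(1)[OF aG, of x] cong_scalar_left[OF fa]] cong_scalar_left[OF fb]
      by (intro cong_add cong_refl)
    finally show "[f (k \<otimes> a [^] x \<otimes> ?b [^] y) = f k + c * y] (mod p)" by (simp add: mult.commute)
    have "[g (k \<otimes> a [^] x \<otimes> ?b [^] y) = g (k \<otimes> a [^] x) + g (?b [^] y)] (mod p)" using U(6) k aG bjG by simp
    also have "[g (k \<otimes> a [^] x) + g (?b [^] y) = (g k + g (a [^] x)) + y * g ?b] (mod p)"
      using U(6) k aG fpow(2)[OF bjG] by (intro cong_add) simp_all
    also have "[(g k + g (a [^] x)) + y * g ?b = (g k + x * e) + y * 0] (mod p)"
      unfolding e_def using fpow(2)[OF aG, of x] cong_scalar_left[OF gb]
      by (intro cong_add cong_refl)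
    finally show "[g (k \<otimes> a [^] x \<otimes> ?b [^] y) = g k + e * x] (mod p)" by (simp add: mult.commute)
  qed
  have pa: "a [^] x = a [^] y" if "[x = y] (mod p)" for x y :: nat using pow_cong[OF T(1,2) that] .
  have pb: "?b [^] x = ?b [^] y" if "[x = y] (mod p)" for x y :: nat using pow_cong[OF bjG bjp that] .
  have tform: "t (k \<otimes> a [^] x \<otimes> ?b [^] y) = k \<otimes> a [^] (x + f k + c * y) \<otimes> ?b [^] y" if k: "k \<in> carrier G" for k and x y :: nat
  proof -
    have G: "k \<otimes> a [^] x \<otimes> ?b [^] y \<in> carrier G" using k aG bjG by simp
    have "t (k \<otimes> a [^] x \<otimes> ?b [^] y) = (k \<otimes> a [^] x \<otimes> ?b [^] y) \<otimes> a [^] (f k + c * y)"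
      using T(5)[OF G] pa[OF lin(1)[OF k]] by simp
    also have "\<dots> = k \<otimes> (a [^] x \<otimes> a [^] (f k + c * y)) \<otimes> ?b [^] y" using k aG bjG by (simp only: m_ac m_closed nat_pow_closed)
    also have "a [^] x \<otimes> a [^] (f k + c * y) = a [^] (x + f k + c * y)" using aG by (simp only: nat_pow_mult add.assoc)
    finally show ?thesis .
  qed
  have upow: "(u ^^ n) k = k \<otimes> (b [^] n) [^] g k" if k: "k \<in> carrier G" for k n
  proof (induction n)
    case 0
    then show ?case using k by simp
  next
    case (Suc n)
    let ?k = "k \<otimes> (b [^] n) [^] g k"
    have G: "?k \<in> carrier G" using k bG by simp
    have "[g ?k = g k + g ((b [^] n) [^] g k)] (mod p)" using U(6) k bG by simp
    also have "[g k + g ((b [^] n) [^] g k) = g k + g k * (n * 0)] (mod p)"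
    proof (rule cong_add[OF cong_refl])
      have "[g b = 0] (mod p)" using U(4) by (simp add: cong_0_iff)
      then have "[g (b [^] n) = n * 0] (mod p)" using cong_trans[OF fpow(2)[OF bG] cong_scalar_left] by blast
      then show "[g ((b [^] n) [^] g k) = g k * (n * 0)] (mod p)"
        using cong_trans[OF fpow(2)[OF nat_pow_closed[OF bG]] cong_scalar_left] by blast
    qed
    finally have "b [^] g ?k = b [^] g k" using pow_cong[OF U(1,2)] by simp
    then have "(u ^^ Suc n) k = ?k \<otimes> b [^] g k" using Suc U(5)[OF G] by simp
    also have "\<dots> = k \<otimes> ((b [^] n) [^] g k \<otimes> b [^] g k)" using k bG by (simp add: m_assoc)
    also have "(b [^] n) [^] g k \<otimes> b [^] g k = (b [^] Suc n) [^] g k"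
      using bG by (simp add: nat_pow_distrib)
    finally show ?case .
  qed
  have uform: "(u ^^ j) (k \<otimes> a [^] x \<otimes> ?b [^] y) = k \<otimes> a [^] x \<otimes> ?b [^] (y + g k + e * x)" if k: "k \<in> carrier G" for k and x y :: nat
  proof -
    have G: "k \<otimes> a [^] x \<otimes> ?b [^] y \<in> carrier G" using k aG bjG by simp
    have "(u ^^ j) (k \<otimes> a [^] x \<otimes> ?b [^] y) = (k \<otimes> a [^] x \<otimes> ?b [^] y) \<otimes> ?b [^] (g k + e * x)"
      using upow[OF G] pb[OF lin(2)[OF k]] by simp
    also have "\<dots> = k \<otimes> a [^] x \<otimes> (?b [^] y \<otimes> ?b [^] (g k + e * x))" using k aG bjG by (simp only: m_assoc m_closed nat_pow_closed)
    also have "?b [^] y \<otimes> ?b [^] (g k + e * x) = ?b [^] (y + g k + e * x)" using bjG by (simp only: nat_pow_mult add.assoc)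
    finally show ?thesis .
  qed
  have upowA: "\<exists>v\<in>A. \<forall>k\<in>carrier G. v k = (u ^^ Suc n) k" for n
  proof (induction n)
    case 0
    then show ?case using u(1) by auto
  next
    case (Suc n)
    then obtain v where v: "v \<in> A" "\<forall>k\<in>carrier G. v k = (u ^^ Suc n) k" by blast
    obtain v' where "v' \<in> A" "\<forall>k\<in>carrier G. v' k = u (v k)" using comp[OF u(1) v(1)] by blast
    then show ?case using v by auto
  qed
  obtain v where v: "v \<in> A" "\<And>k. k \<in> carrier G \<Longrightarrow> v k = (u ^^ j) k" using upowA[of m] m by blast
  obtain vt where vt: "vt \<in> A" "\<And>k. k \<in> carrier G \<Longrightarrow> vt k = v (t k)" using comp[OF v(1) t(1)] by blast
  \<comment> \<open>\<open>w\<close> is \<open>t u^j t\<close>, the Weyl element: zero diagonal and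
    entries \<open>c\<close> and \<open>e\<close> on the span. Its square \<open>h\<close> is
    therefore \<open>c * e = -1\<close> there.\<close>
  obtain w where w: "w \<in> A" "\<And>k. k \<in> carrier G \<Longrightarrow> w k = t (vt k)" using comp[OF t(1) vt(1)] by blast
  obtain h where h: "h \<in> A" "\<And>k. k \<in> carrier G \<Longrightarrow> h k = w (w k)" using comp[OF w(1) w(1)] by blast
  have cl: "\<alpha> k \<in> carrier G" if "\<alpha> \<in> A" "k \<in> carrier G" for \<alpha> k using endo_simps(1) A that by blast
  have wform: "w k = k \<otimes> a [^] (f k + c * g k) \<otimes> ?b [^] (g k + e * f k)" if k: "k \<in> carrier G" for k
  proof -
    have k0: "k = k \<otimes> a [^] (0::nat) \<otimes> ?b [^] (0::nat)" using k by simp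
    have t1: "t k = k \<otimes> a [^] f k \<otimes> ?b [^] (0::nat)" using T(5)[OF k] k aG by simp
    have "v (t k) = k \<otimes> a [^] f k \<otimes> ?b [^] (0 + g k + e * f k)"
      using v(2)[OF cl[OF t(1) k]] unfolding t1 uform[OF k] .
    then have "w k = k \<otimes> a [^] (f k + f k + c * (g k + e * f k)) \<otimes> ?b [^] (g k + e * f k)"
      using w(2)[OF k] vt(2)[OF k] tform[OF k] by simp
    also have "a [^] (f k + f k + c * (g k + e * f k)) = a [^] (f k + c * g k)"
    proof (rule pa)
      have "f k + f k + c * (g k + e * f k) = f k + c * g k + (c * e + 1) * f k" by (simp add: algebra_simps)
      then show "[f k + f k + c * (g k + e * f k) = f k + c * g k] (mod p)" by (rule key)
    qed
    finally show ?thesis .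
  qed
  have hform: "h k = k \<otimes> a [^] (2 * c * g k) \<otimes> ?b [^] (2 * e * f k)" if k: "k \<in> carrier G" for k
  proof -
    have fw: "[f (w k) = c * g k] (mod p)"
    proof -
      have "f k + c * (g k + e * f k) = c * g k + (c * e + 1) * f k" by (simp add: algebra_simps)
      then have "[f k + c * (g k + e * f k) = c * g k] (mod p)" by (rule key)
      then show ?thesis using lin(1)[OF k] cong_trans unfolding wform[OF k] by blast
    qed
    have gw: "[g (w k) = e * f k] (mod p)"
    proof -
      have "g k + e * (f k + c * g k) = e * f k + (c * e + 1) * g k" by (simp add: algebra_simps)
      then have "[g k + e * (f k + c * g k) = e * f k] (mod p)" by (rule key)
      then show ?thesis using lin(2)[OF k] cong_trans unfolding wform[OF k] by blast
    qed
    have "h k = w k \<otimes> a [^] (f (w k) + c * g (w k)) \<otimes> ?b [^] (g (w k) + e * f (w k))"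
      using h(2)[OF k] wform[OF cl[OF w(1) k]] by simp
    also have "a [^] (f (w k) + c * g (w k)) = a [^] (c * g k + c * (e * f k))"
      by (rule pa, rule cong_add[OF fw cong_scalar_left[OF gw]])
    also have "?b [^] (g (w k) + e * f (w k)) = ?b [^] (e * f k + e * (c * g k))"
      by (rule pb, rule cong_add[OF gw cong_scalar_left[OF fw]])
    also have "w k \<otimes> a [^] (c * g k + c * (e * f k)) \<otimes> ?b [^] (e * f k + e * (c * g k)) =
        k \<otimes> (a [^] (f k + c * g k) \<otimes> a [^] (c * g k + c * (e * f k))) \<otimes>
          (?b [^] (g k + e * f k) \<otimes> ?b [^] (e * f k + e * (c * g k)))"
      unfolding wform[OF k] using k aG bjG by (simp only: m_ac m_closed nat_pow_closed)
    also have "a [^] (f k + c * g k) \<otimes> a [^] (c * g k + c * (e * f k)) = a [^] (2 * c * g k)"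
    proof -
      have "f k + c * g k + (c * g k + c * (e * f k)) = 2 * c * g k + (c * e + 1) * f k" by (simp add: algebra_simps)
      then have "[f k + c * g k + (c * g k + c * (e * f k)) = 2 * c * g k] (mod p)" by (rule key)
      then show ?thesis using pa aG by (simp only: nat_pow_mult)
    qed
    also have "?b [^] (g k + e * f k) \<otimes> ?b [^] (e * f k + e * (c * g k)) = ?b [^] (2 * e * f k)"
    proof -
      have "g k + e * f k + (e * f k + e * (c * g k)) = 2 * e * f k + (c * e + 1) * g k" by (simp add: algebra_simps)
      then have "[g k + e * f k + (e * f k + e * (c * g k)) = 2 * e * f k] (mod p)" by (rule key)
      then show ?thesis using pb bjG by (simp only: nat_pow_mult)
    qed
    finally show ?thesis .
  qed
  have fh: "[f (h k) = f k + c * (2 * e * f k)] (mod p)" if k: "k \<in> carrier G" for k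
    using lin(1)[OF k] unfolding hform[OF k] .
  have "h (t k) = t (h k)" if k: "k \<in> carrier G" for k
  proof -
    have t1: "t k = k \<otimes> a [^] f k \<otimes> ?b [^] (0::nat)" using T(5)[OF k] k aG by simp
    have tk: "t k \<in> carrier G" using cl t k by blast
    have ft: "[f (t k) = f k] (mod p)" and gt: "[g (t k) = g k + e * f k] (mod p)"
      using lin[OF k, of "f k" 0] unfolding t1 by simp_all
    have "h (t k) = t k \<otimes> a [^] (2 * c * (g k + e * f k)) \<otimes> ?b [^] (2 * e * f k)"
      unfolding hform[OF tk] using pa[OF cong_scalar_left[OF gt]] pb[OF cong_scalar_left[OF ft]] by simp
    also have "\<dots> = k \<otimes> (a [^] f k \<otimes> a [^] (2 * c * (g k + e * f k))) \<otimes> ?b [^] (2 * e * f k)"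
      using T(5)[OF k] k aG bjG by (simp add: m_assoc)
    also have "a [^] f k \<otimes> a [^] (2 * c * (g k + e * f k)) = a [^] (2 * c * g k + f k + c * (2 * e * f k))"
      using aG by (simp only: nat_pow_mult) (simp add: algebra_simps)
    also have "k \<otimes> a [^] (2 * c * g k + f k + c * (2 * e * f k)) \<otimes> ?b [^] (2 * e * f k) = t (h k)"
      unfolding hform[OF k] tform[OF k] by simp
    finally show ?thesis .
  qed
  then have rig: "h k \<otimes> inv k \<in> fixed_points t" if "k \<in> carrier G" for k
    using t(2) h(1) that unfolding centrally_rigid_def by blast
  have hb: "h b \<in> carrier G" using cl h bG by blast
  have "p dvd f (h b \<otimes> inv b)" using transvection_data_fixed[OF t(3)] rig[OF bG] hb bG by simp
  moreover have "[f ((h b \<otimes> inv b) \<otimes> b) = f (h b \<otimes> inv b) + f b] (mod p)" using T(6) hb bG by simp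
  moreover have "(h b \<otimes> inv b) \<otimes> b = h b" using hb bG by (simp add: m_assoc)
  ultimately have "[f (h b) = 0 + f b] (mod p)"
    by (metis cong_0_iff cong_add_rcancel_nat cong_trans)
  then have "[f b + c * (2 * e * f b) = f b + 0] (mod p)" using fh[OF bG] by (metis add_0 add_0_right cong_sym cong_trans)
  then have d: "p dvd c * (2 * e * f b)" by (simp only: cong_add_lcancel_nat cong_0_iff)
  \<comment> \<open>With \<open>c * e = -1\<close> the divisibility \<open>d\<close> says that
    \<open>-2 f b\<close> vanishes modulo \<open>p\<close>.\<close>
  have "p dvd 2 * f b"
  proof -
    have "c * (2 * e * f b) + 2 * f b = p * (s * 2 * f b)" using s by (metis (no_types, opaque_lifting) add_mult_distrib mult.assoc mult.commute mult.left_commute mult_1)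
    then show ?thesis using d by (metis dvd_add_right_iff dvd_triv_left)
  qed
  then have "p dvd 2" using no prime_p by (metis prime_dvd_mult_iff)
  then show False using odd p_gt_1 by (metis dvd_imp_le even_numeral less_2_cases_iff  linorder_neqE_nat not_less_iff_gr_or_eq numeral_2_eq_2 zero_less_numeral le_neq_implies_less less_one not_one_less_zero One_nat_def)
qed

lemma displacements_subset:
  assumes d: "transvection_data t a f"
  shows "displacements t \<subseteq> {a [^] i | i. i \<in> (UNIV::nat set)}"
proof
  note D = transvection_dataD[OF d]
  fix x assume "x \<in> displacements t"
  then obtain k where k: "k \<in> carrier G" "x = t k \<otimes> inv k" by (auto simp: displacements_def)
  have "x = a [^] f k" using D(5)[OF k(1)] k D(1) by (simp add: m_ac mult_inv_cancel)
  then show "x \<in> {a [^] i | i. i \<in> (UNIV::nat set)}" by blast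
qed

lemma subgroup_fixed_points: "t \<in> hom G G \<Longrightarrow> subgroup (fixed_points t) G"
  using subgroup_fixed[OF _ subgroup_self, of t] by (simp add: fixed_points_def)

text \<open>Displacements are powers of \<open>a\<close>, and some value of \<open>f\<close> is
  invertible modulo \<open>p\<close>, so they generate the same subgroup as
  \<open>a\<close>.\<close>

lemma displacements_subset_fixed_iff:
  assumes d: "transvection_data t a f" and s: "s \<in> hom G G"
  shows "displacements t \<subseteq> fixed_points s \<longleftrightarrow> a \<in> fixed_points s"
proof
  note D = transvection_dataD[OF d]
  assume "a \<in> fixed_points s"
  then show "displacements t \<subseteq> fixed_points s"
    using displacements_subset[OF d] subgroup_pow[OF subgroup_fixed_points[OF s]] by blast
next
  note D = transvection_dataD[OF d]
  assume sub: "displacements t \<subseteq> fixed_points s"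
  show "a \<in> fixed_points s"
  proof (rule ccontr)
    assume a: "a \<notin> fixed_points s"
    have ap: "a [^] p \<in> fixed_points s" using D(2) subgroup.one_closed[OF subgroup_fixed_points[OF s]] by simp
    have "p dvd f k" if k: "k \<in> carrier G" for k
    proof -
      have "t k \<otimes> inv k = a [^] f k" using D(5)[OF k] k D(1) by (simp add: m_ac mult_inv_cancel)
      moreover have "t k \<otimes> inv k \<in> displacements t" using k by (auto simp: displacements_def)
      ultimately have "a [^] f k \<in> fixed_points s" using sub by auto
      then show ?thesis using pow_mem_iff[OF subgroup_fixed_points[OF s] D(1) a ap] by simp
    qed
    then show False using D(7) by blast
  qed
qed

text \<open>A rigid transvection whose fixed points are maximal for the relation \<open>?R\<close> below fixes the
  displacements of all rigid transvections.\<close>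

lemma exists_sink:
  assumes odd: "odd p" and A: "A \<subseteq> hom G G" "\<And>\<alpha>. \<alpha> \<in> A \<Longrightarrow> inj_on \<alpha> (carrier G)"
    and compA: "\<forall>\<alpha>\<in>A. \<forall>\<beta>\<in>A. \<exists>\<gamma>\<in>A. \<forall>k\<in>carrier G. \<gamma> k = \<alpha> (\<beta> k)"
    and E: "E \<subseteq> A" "\<And>t. t \<in> E \<Longrightarrow> transvection t \<and> centrally_rigid A t"
    and conjE: "\<forall>t\<in>E. \<forall>u\<in>A. \<exists>t'\<in>E. \<forall>k\<in>carrier G. t' (u k) = u (t k)"
    and ne: "E \<noteq> {}"
  shows "\<exists>t\<in>E. \<forall>u\<in>E. displacements u \<subseteq> fixed_points t"
proof -
  \<comment> \<open>The relation lives on fixed subgroups rather than on transvections, because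
    transitivity replaces \<open>v\<close> by a conjugate with the same fixed points.\<close>
  let ?R = "{(Y, Z). Z \<in> fixed_points ` E \<and> (\<exists>v\<in>E. fixed_points v = Y \<and> \<not> displacements v \<subseteq> Z)}"
  have hom: "t \<in> hom G G" if "t \<in> E" for t using that E A by blast
  have data: "\<exists>a f. transvection_data t a f" if "t \<in> E" for t
    using transvection_imp_data[OF hom[OF that]] E(2)[OF that] by blast
  have fin: "finite ?R"
  proof (rule finite_subset)
    show "?R \<subseteq> Pow (carrier G) \<times> Pow (carrier G)" by (auto simp: fixed_points_def)
    show "finite (Pow (carrier G) \<times> Pow (carrier G))" using finite_carrier by simp
  qed
  have "trans ?R"
  proof (rule transI)
    fix Z Y W assume "(Z, Y) \<in> ?R" "(Y, W) \<in> ?R"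
    then obtain u v t where u: "u \<in> E" "fixed_points u = Y" "\<not> displacements u \<subseteq> W"
      and v: "v \<in> E" "fixed_points v = Z" "\<not> displacements v \<subseteq> Y"
      and t: "t \<in> E" "W = fixed_points t" by auto
    have Wm: "W \<in> fixed_points ` E" using t by blast
    show "(Z, W) \<in> ?R"
    proof (cases "displacements v \<subseteq> W")
      case False
      then show ?thesis using v Wm by blast
    next
      case True
      obtain a f where a: "transvection_data u a f" using data[OF u(1)] by blast
      obtain b g where b: "transvection_data v b g" using data[OF v(1)] by blast
      note DA = transvection_dataD[OF a] and DB = transvection_dataD[OF b]
      have "b \<notin> fixed_points u" using v(3) u(2) displacements_subset_fixed_iff[OF b hom[OF u(1)]] by blast
      then have nb: "\<not> p dvd f b" using transvection_data_fixed[OF a DB(1)] by simp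
      have uA: "u \<in> A" and vA: "v \<in> A" and uR: "centrally_rigid A u" using u(1) v(1) E by auto
      have "p dvd g a"
        using nb rigid_transvections_triangular[OF odd A(1) compA uA uR a vA b] by blast
      then have aZ: "a \<in> fixed_points v" using transvection_data_fixed[OF b DA(1)] by simp
      have aW: "a \<notin> W" using u(3) t displacements_subset_fixed_iff[OF a hom[OF t(1)]] by blast
      have bW: "b \<in> W" using True t displacements_subset_fixed_iff[OF b hom[OF t(1)]] by blast
      \<comment> \<open>\<open>v'\<close> is \<open>v\<close> conjugated by \<open>u\<close>. As
        \<open>a\<close> lies in \<open>Z\<close>, \<open>u\<close> preserves \<open>Z\<close>, so
        \<open>v'\<close> still has fixed points \<open>Z\<close>. Its direction is
        \<open>u b = b \<otimes> a [^] f b\<close>, which leaves \<open>W\<close>: \<open>b\<close>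
        is in \<open>W\<close>, \<open>a\<close> is not, and \<open>f b\<close> is prime to
        \<open>p\<close>.\<close>
      obtain v' where v': "v' \<in> E" "\<And>k. k \<in> carrier G \<Longrightarrow> v' (u k) = u (v k)" using conjE v(1) uA by blast
      have ucl: "u k \<in> carrier G" if "k \<in> carrier G" for k using endo_simps(1)[OF hom[OF u(1)] that] .
      have vcl: "v k \<in> carrier G" if "k \<in> carrier G" for k using endo_simps(1)[OF hom[OF v(1)] that] .
      have onto: "\<exists>l\<in>carrier G. k = u l" if "k \<in> carrier G" for k
        using endo_inj_surj[OF finite_carrier _ A(2)[OF uA]] ucl that by (metis image_iff image_subsetI)
      have uZ: "u k \<in> Z" if k: "k \<in> Z" for k
      proof -
        have kG: "k \<in> carrier G" using k v(2) by (auto simp: fixed_points_def)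
        have "k \<otimes> a [^] f k \<in> fixed_points v"
          using k v(2) aZ subgroup_pow[OF subgroup_fixed_points[OF hom[OF v(1)]]]
            subgroup.m_closed[OF subgroup_fixed_points[OF hom[OF v(1)]]] by blast
        then show ?thesis using DA(5)[OF kG] v(2) by simp
      qed
      have ZG: "Z \<subseteq> carrier G" using v(2) by (auto simp: fixed_points_def)
      have uimg: "u ` Z = Z"
        using endo_inj_surj[of Z u] finite_subset[OF ZG finite_carrier] uZ inj_on_subset[OF A(2)[OF uA] ZG] by blast
      have "fixed_points v' = Z"
      proof
        show "fixed_points v' \<subseteq> Z"
        proof
          fix k assume k: "k \<in> fixed_points v'"
          then have kG: "k \<in> carrier G" by (simp add: fixed_points_def)
          obtain l where l: "l \<in> carrier G" "k = u l" using onto[OF kG] by blast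
          have "u (v l) = u l" using v'(2)[OF l(1)] k l by (simp add: fixed_points_def)
          then have "v l = l" using inj_onD[OF A(2)[OF uA]] vcl l by blast
          then have "l \<in> Z" using l v(2) by (auto simp: fixed_points_def)
          then show "k \<in> Z" using uZ l by blast
        qed
        show "Z \<subseteq> fixed_points v'"
        proof
          fix k assume k: "k \<in> Z"
          then obtain l where l: "l \<in> Z" "k = u l" using uimg by blast
          have lG: "l \<in> carrier G" using l ZG by blast
          have "v l = l" using l v(2) by (auto simp: fixed_points_def)
          then have "v' k = k" using v'(2)[OF lG] l by simp
          then show "k \<in> fixed_points v'" using k ZG by (auto simp: fixed_points_def)
        qed
      qed
      moreover have "\<not> displacements v' \<subseteq> W"
      proof
        assume sub: "displacements v' \<subseteq> W"
        have Ws: "subgroup W G" using subgroup_fixed_points[OF hom[OF t(1)]] t by simp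
        obtain k where k: "k \<in> carrier G" "\<not> p dvd g k" using DB(7) by blast
        have "v' (u k) \<otimes> inv (u k) \<in> displacements v'" using ucl[OF k(1)] by (auto simp: displacements_def)
        then have "u (v k) \<otimes> inv (u k) \<in> W" using sub v'(2)[OF k(1)] by auto
        moreover have "u (v k) \<otimes> inv (u k) = u (b [^] g k)"
          using endo_simps(2)[OF hom[OF u(1)] k(1), of "b [^] g k"] DB(5)[OF k(1)] DB(1) ucl[OF k(1)] ucl[of "b [^] g k"]
          by (simp add: m_ac mult_inv_cancel)
        moreover have "u (b [^] g k) = b [^] g k \<otimes> a [^] f (b [^] g k)" using DA(5) DB(1) by simp
        ultimately have m: "b [^] g k \<otimes> a [^] f (b [^] g k) \<in> W" by simp
        have bk: "b [^] g k \<in> W" using subgroup_pow[OF Ws bW] .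
        have "inv (b [^] g k) \<otimes> (b [^] g k \<otimes> a [^] f (b [^] g k)) \<in> W"
          using m bk subgroup.m_closed[OF Ws] subgroup.m_inv_closed[OF Ws] by blast
        then have "a [^] f (b [^] g k) \<in> W" using DA(1) DB(1) by (simp add: mult_inv_cancel)
        moreover have "a [^] p \<in> W" using DA(2) subgroup.one_closed[OF Ws] by simp
        ultimately have "p dvd f (b [^] g k)" using pow_mem_iff[OF Ws DA(1) aW] by simp
        then have "p dvd g k * f b" using transvection_data_pow[OF a DB(1), of "g k"] cong_dvd_iff by blast
        then show False using nb k prime_p by (metis prime_dvd_mult_iff)
      qed
      ultimately show ?thesis using v'(1) Wm by blast
    qed
  qed
  moreover have "irrefl ?R"
  proof (rule irreflI)
    fix Y show "(Y, Y) \<notin> ?R"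
    proof
      assume "(Y, Y) \<in> ?R"
      then obtain v where v: "v \<in> E" "fixed_points v = Y" "\<not> displacements v \<subseteq> Y" by blast
      obtain b g where b: "transvection_data v b g" using data[OF v(1)] by blast
      have "b \<in> fixed_points v"
        using transvection_data_fixed[OF b] transvection_dataD[OF b] by blast
      then show False using v displacements_subset_fixed_iff[OF b hom[OF v(1)]] by blast
    qed
  qed
  ultimately have "acyclic ?R" by (simp add: acyclic_irrefl trancl_id)
  then have wf: "wf ?R" using finite_acyclic_wf[OF fin] by blast
  obtain t0 where "t0 \<in> E" using ne by blast
  then obtain Z where Z: "Z \<in> fixed_points ` E" "\<And>Y. (Y, Z) \<in> ?R \<Longrightarrow> Y \<notin> fixed_points ` E"
    using wfE_min[OF wf, of "fixed_points t0" "fixed_points ` E"] by blast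
  then obtain t where t: "t \<in> E" "Z = fixed_points t" by blast
  have "displacements u \<subseteq> fixed_points t" if u: "u \<in> E" for u
  proof (rule ccontr)
    assume "\<not> displacements u \<subseteq> fixed_points t"
    then have "(fixed_points u, Z) \<in> ?R" using u t by blast
    then show False using Z(2) u by blast
  qed
  then show ?thesis using t by blast
qed

text \<open>Conjugation permutes the sinks, so their common fixed points \<open>Z\<close> are
  \<open>A\<close>-invariant. The automorphisms in \<open>A\<close> trivial on \<open>Z\<close> and
  modulo \<open>Z\<close> form a normal subgroup, which contains a sink, since its displacements are
  fixed by all sinks.\<close>

lemma normal_p_subgroup_of_rigid_transvection:
  assumes odd: "odd p" and A: "subgroup A (BijGroup (carrier G))" "A \<subseteq> hom G G"
    and t0: "t0 \<in> A" "transvection t0" "centrally_rigid A t0"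
  shows "\<exists>N. subgroup N (BijGroup (carrier G)) \<and> N \<subseteq> A \<and> (\<exists>k. card N = p ^ k) \<and>
    (\<forall>\<alpha>\<in>A. \<forall>\<nu>\<in>N. inv\<^bsub>BijGroup (carrier G)\<^esub> \<alpha> \<otimes>\<^bsub>BijGroup (carrier G)\<^esub> \<nu> \<otimes>\<^bsub>BijGroup (carrier G)\<^esub> \<alpha> \<in> N) \<and>
    (\<exists>\<nu>\<in>N. \<exists>k\<in>carrier G. \<nu> k \<noteq> k)"
proof -
  let ?B = "BijGroup (carrier G)"
  interpret B: group ?B by (rule group_BijGroup)
  have AB: "\<alpha> \<in> Bij (carrier G)" if "\<alpha> \<in> A" for \<alpha>
    using that subgroup.subset[OF A(1)] by (auto simp: BijGroup_def)
  have cl: "\<alpha> k \<in> carrier G" if "\<alpha> \<in> A" "k \<in> carrier G" for \<alpha> k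
    using Bij_imp_funcset[OF AB[OF that(1)]] that(2) by blast
  have inj: "inj_on \<alpha> (carrier G)" if "\<alpha> \<in> A" for \<alpha>
    using AB[OF that] by (auto simp: Bij_def bij_betw_def)
  have mult: "(\<alpha> \<otimes>\<^bsub>?B\<^esub> \<beta>) x = \<alpha> (\<beta> x)" if "\<alpha> \<in> A" "\<beta> \<in> A" "x \<in> carrier G" for \<alpha> \<beta> x
    using AB that by (simp add: BijGroup_def compose_def)
  have clA: "\<alpha> \<otimes>\<^bsub>?B\<^esub> \<beta> \<in> A" if "\<alpha> \<in> A" "\<beta> \<in> A" for \<alpha> \<beta> using subgroup.m_closed[OF A(1)] that .
  have invA: "inv\<^bsub>?B\<^esub> \<alpha> \<in> A" if "\<alpha> \<in> A" for \<alpha> using subgroup.m_inv_closed[OF A(1)] that .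
  have carB: "\<alpha> \<in> carrier ?B" if "\<alpha> \<in> A" for \<alpha> using AB[OF that] by (simp only: carrier_BijGroup)
  have oneB: "\<one>\<^bsub>?B\<^esub> x = x" if "x \<in> carrier G" for x using that by (simp add: BijGroup_def)
  have invl: "(inv\<^bsub>?B\<^esub> \<alpha>) (\<alpha> x) = x" "\<alpha> ((inv\<^bsub>?B\<^esub> \<alpha>) x) = x" if \<alpha>: "\<alpha> \<in> A" and x: "x \<in> carrier G" for \<alpha> x
  proof -
    have "(inv\<^bsub>?B\<^esub> \<alpha> \<otimes>\<^bsub>?B\<^esub> \<alpha>) x = x" "(\<alpha> \<otimes>\<^bsub>?B\<^esub> inv\<^bsub>?B\<^esub> \<alpha>) x = x"
      unfolding B.l_inv[OF carB[OF \<alpha>]] B.r_inv[OF carB[OF \<alpha>]] using oneB[OF x] by auto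
    then show "(inv\<^bsub>?B\<^esub> \<alpha>) (\<alpha> x) = x" "\<alpha> ((inv\<^bsub>?B\<^esub> \<alpha>) x) = x"
      unfolding mult[OF invA[OF \<alpha>] \<alpha> x] mult[OF \<alpha> invA[OF \<alpha>] x] by auto
  qed
  have hom: "\<alpha> \<in> hom G G" if "\<alpha> \<in> A" for \<alpha> using A(2) that by blast
  have comp: "\<exists>\<gamma>\<in>A. \<forall>k\<in>carrier G. \<gamma> k = \<alpha> (\<beta> k)" if "\<alpha> \<in> A" "\<beta> \<in> A" for \<alpha> \<beta>
    using clA[OF that] mult[OF that] by blast
  define E where "E = {t \<in> A. transvection t \<and> centrally_rigid A t}"
  have EA: "E \<subseteq> A" by (auto simp: E_def)
  have conj: "\<exists>t'\<in>E. \<forall>k\<in>carrier G. t' (u k) = u (t k)" if t: "t \<in> E" and u: "u \<in> A" for t u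
  proof -
    let ?t = "u \<otimes>\<^bsub>?B\<^esub> t \<otimes>\<^bsub>?B\<^esub> inv\<^bsub>?B\<^esub> u"
    have tA: "t \<in> A" and tt: "transvection t" and tr: "centrally_rigid A t" using t by (auto simp: E_def)
    have t'A: "?t \<in> A" using clA[OF clA[OF u tA] invA[OF u]] .
    have t': "?t (u k) = u (t k)" if k: "k \<in> carrier G" for k
      using mult[OF clA[OF u tA] invA[OF u] cl[OF u k]] mult[OF u tA] invl(1)[OF u k] k by simp
    have onto: "\<exists>l\<in>carrier G. k = u l" if "k \<in> carrier G" for k
      using invl(2)[OF u that] cl[OF invA[OF u] that] by metis
    have "transvection ?t"
      unfolding transvection_def
    proof (intro conjI)
      obtain k where k: "k \<in> carrier G" "t k \<noteq> k" using tt by (auto simp: transvection_def)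
      have "?t (u k) \<noteq> u k" using t'[OF k(1)] inj_onD[OF inj[OF u]] cl[OF tA k(1)] k by metis
      then show "\<exists>k\<in>carrier G. ?t k \<noteq> k" using cl[OF u k(1)] by blast
      obtain a where a: "a \<in> carrier G" "a [^] p = \<one>" "t a = a" "\<forall>k\<in>carrier G. \<exists>i::nat. t k = k \<otimes> a [^] i"
        using tt by (auto simp: transvection_def)
      show "\<exists>a\<in>carrier G. a [^] p = \<one> \<and> ?t a = a \<and> (\<forall>k\<in>carrier G. \<exists>i::nat. ?t k = k \<otimes> a [^] i)"
      proof (intro bexI[of _ "u a"] conjI ballI)
        show "u a \<in> carrier G" using cl[OF u a(1)] .
        show "u a [^] p = \<one>" using hom_pow[OF hom[OF u] a(1), of p] a(2) endo_simps(3)[OF hom[OF u]] by simp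
        show "?t (u a) = u a" using t'[OF a(1)] a(3) by simp
        fix k assume "k \<in> carrier G"
        then obtain l where l: "l \<in> carrier G" "k = u l" using onto by blast
        obtain i where i: "t l = l \<otimes> a [^] (i::nat)" using a(4) l by blast
        have "?t k = u l \<otimes> u a [^] i"
          using t'[OF l(1)] l i endo_simps(2)[OF hom[OF u] l(1)] hom_pow[OF hom[OF u] a(1)] a(1) by simp
        then show "\<exists>i::nat. ?t k = k \<otimes> u a [^] i" using l by blast
      qed
    qed
    moreover have "centrally_rigid A ?t"
      unfolding centrally_rigid_def
    proof (intro ballI impI)
      fix h k assume h: "h \<in> A" and com: "\<forall>k\<in>carrier G. h (?t k) = ?t (h k)" and k: "k \<in> carrier G"
      let ?h = "inv\<^bsub>?B\<^esub> u \<otimes>\<^bsub>?B\<^esub> h \<otimes>\<^bsub>?B\<^esub> u"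
      have h'A: "?h \<in> A" using clA[OF clA[OF invA[OF u] h] u] .
      have h': "u (?h l) = h (u l)" if l: "l \<in> carrier G" for l
        using mult[OF clA[OF invA[OF u] h] u l] mult[OF invA[OF u] h cl[OF u l]] invl(2)[OF u cl[OF h cl[OF u l]]] by simp
      have "?h (t l) = t (?h l)" if l: "l \<in> carrier G" for l
      proof -
        have "u (?h (t l)) = h (?t (u l))" using h'[OF cl[OF tA l]] t'[OF l] by simp
        also have "\<dots> = ?t (h (u l))" using com cl[OF u l] by blast
        also have "\<dots> = u (t (?h l))" unfolding h'[OF l, symmetric] by (rule t'[OF cl[OF h'A l]])
        finally show ?thesis
          using inj_onD[OF inj[OF u]] cl[OF h'A cl[OF tA l]] cl[OF tA cl[OF h'A l]] by blast
      qed
      then have fx: "?h l \<otimes> inv l \<in> fixed_points t" if "l \<in> carrier G" for l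
        using tr h'A that unfolding centrally_rigid_def by blast
      obtain l where l: "l \<in> carrier G" "k = u l" using onto[OF k] by blast
      have hl: "?h l \<in> carrier G" using cl[OF h'A l(1)] .
      have e: "u (?h l \<otimes> inv l) = h k \<otimes> inv k"
        using endo_simps(2)[OF hom[OF u] hl inv_closed[OF l(1)]] endo_simps(4)[OF hom[OF u] l(1)] h'[OF l(1)] l(2) by simp
      have "?t (u (?h l \<otimes> inv l)) = u (?h l \<otimes> inv l)"
        using t'[of "?h l \<otimes> inv l"] fx[OF l(1)] by (simp add: fixed_points_def)
      then show "h k \<otimes> inv k \<in> fixed_points ?t"
        unfolding e using cl[OF h k] k by (simp add: fixed_points_def)
    qed
    ultimately have "?t \<in> E" using t'A by (simp add: E_def)
    then show ?thesis using t' by blast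
  qed
  define sink where "sink t \<longleftrightarrow> t \<in> E \<and> (\<forall>u\<in>E. displacements u \<subseteq> fixed_points t)" for t
  obtain s0 where s0: "sink s0"
  proof -
    have ne: "E \<noteq> {}" using t0 by (auto simp: E_def)
    have Epr: "transvection t \<and> centrally_rigid A t" if "t \<in> E" for t using that by (auto simp: E_def)
    have "\<exists>t\<in>E. \<forall>u\<in>E. displacements u \<subseteq> fixed_points t"
      by (rule exists_sink[OF odd A(2) inj _ EA Epr _ ne]) (use comp conj in blast)+
    then show thesis using that by (auto simp: sink_def)
  qed
  have sinkA: "t \<in> A" if "sink t" for t using that EA by (auto simp: sink_def)
  have sconj: "\<exists>t'. sink t' \<and> (\<forall>k\<in>carrier G. t' (u k) = u (t k))" if t: "sink t" and u: "u \<in> A" for t u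
  proof -
    obtain t' where t': "t' \<in> E" "\<And>k. k \<in> carrier G \<Longrightarrow> t' (u k) = u (t k)" using conj[of t u] t u by (auto simp: sink_def)
    have "displacements w \<subseteq> fixed_points t'" if w: "w \<in> E" for w
    proof
      fix x assume "x \<in> displacements w"
      then obtain k where k: "k \<in> carrier G" "x = w k \<otimes> inv k" by (auto simp: displacements_def)
      have wA: "w \<in> A" using w EA by blast
      obtain w' where w': "w' \<in> E" "\<And>k. k \<in> carrier G \<Longrightarrow> w' ((inv\<^bsub>?B\<^esub> u) k) = (inv\<^bsub>?B\<^esub> u) (w k)"
        using conj[OF w invA[OF u]] by blast
      let ?k = "(inv\<^bsub>?B\<^esub> u) k"
      have kc: "?k \<in> carrier G" using cl[OF invA[OF u] k(1)] .
      have w'c: "w' ?k \<in> carrier G" using cl[of w' ?k] w'(1) EA kc by blast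
      have "w' ?k \<otimes> inv ?k \<in> displacements w'" using kc by (auto simp: displacements_def)
      then have fx: "t (w' ?k \<otimes> inv ?k) = w' ?k \<otimes> inv ?k" using t w'(1) by (auto simp: sink_def fixed_points_def)
      have "u (w' ?k \<otimes> inv ?k) = x"
        using endo_simps(2)[OF hom[OF u] w'c inv_closed[OF kc]] endo_simps(4)[OF hom[OF u] kc]
          w'(2)[OF k(1)] invl(2)[OF u cl[OF wA k(1)]] invl(2)[OF u k(1)] k(2) by simp
      then have "t' x = x" using t'(2)[of "w' ?k \<otimes> inv ?k"] fx w'c kc by simp
      moreover have "x \<in> carrier G" using k cl[OF wA k(1)] by simp
      ultimately show "x \<in> fixed_points t'" by (simp add: fixed_points_def)
    qed
    then show ?thesis using t' by (auto simp: sink_def)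
  qed
  define Z where "Z = {k \<in> carrier G. \<forall>t. sink t \<longrightarrow> t k = k}"
  have ZG: "Z \<subseteq> carrier G" by (auto simp: Z_def)
  have Zs: "subgroup Z G"
  proof (rule finite_subgroupI)
    show "finite Z" using finite_subset[OF ZG finite_carrier] .
    show "Z \<subseteq> carrier G" by fact
    have "\<one> \<in> Z" using endo_simps(3)[OF hom[OF sinkA]] by (simp add: Z_def)
    then show "Z \<noteq> {}" by blast
    fix x y assume xy: "x \<in> Z" "y \<in> Z"
    then have G: "x \<in> carrier G" "y \<in> carrier G" using ZG by auto
    have "t (x \<otimes> y) = x \<otimes> y" if t: "sink t" for t
    proof -
      have "t x = x" "t y = y" using xy t unfolding Z_def by blast+
      then show ?thesis using endo_simps(2)[OF hom[OF sinkA[OF t]] G] by simp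
    qed
    then show "x \<otimes> y \<in> Z" using G by (simp add: Z_def)
  qed
  have Zinv: "u z \<in> Z" if u: "u \<in> A" and z: "z \<in> Z" for u z
  proof -
    have zG: "z \<in> carrier G" using z ZG by blast
    have "t (u z) = u z" if t: "sink t" for t
    proof -
      obtain t' where t': "sink t'" "\<And>k. k \<in> carrier G \<Longrightarrow> t' ((inv\<^bsub>?B\<^esub> u) k) = (inv\<^bsub>?B\<^esub> u) (t k)"
        using sconj[OF t invA[OF u]] by blast
      have "(inv\<^bsub>?B\<^esub> u) (t (u z)) = t' z" using t'(2)[OF cl[OF u zG]] invl(1)[OF u zG] by simp
      also have "\<dots> = z" using z t'(1) by (simp add: Z_def)
      finally have "u ((inv\<^bsub>?B\<^esub> u) (t (u z))) = u z" by simp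
      then show ?thesis using invl(2)[OF u cl[OF sinkA[OF t] cl[OF u zG]]] by simp
    qed
    then show ?thesis using cl[OF u zG] by (simp add: Z_def)
  qed
  define N where "N = {g \<in> A. (\<forall>z\<in>Z. g z = z) \<and> (\<forall>k\<in>carrier G. g k \<otimes> inv k \<in> Z)}"
  have NA: "N \<subseteq> A" by (auto simp: N_def)
  have finA: "finite A" by (rule finite_subset[OF subsetI finite_Bij[OF finite_carrier]]) (rule AB)
  have Ns: "subgroup N ?B"
  proof (rule B.finite_subgroupI)
    show "finite N" using finite_subset[OF NA finA] .
    show "N \<subseteq> carrier ?B" using NA carB by blast
    have "\<one>\<^bsub>?B\<^esub> \<in> N" using subgroup.one_closed[OF A(1)] oneB subgroup.one_closed[OF Zs] ZG by (auto simp: N_def)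
    then show "N \<noteq> {}" by blast
    fix g h assume gh: "g \<in> N" "h \<in> N"
    then have ghA: "g \<in> A" "h \<in> A" using NA by auto
    have "(g \<otimes>\<^bsub>?B\<^esub> h) z = z" if "z \<in> Z" for z
      using that gh ZG mult[OF ghA] by (auto simp: N_def)
    moreover have "(g \<otimes>\<^bsub>?B\<^esub> h) k \<otimes> inv k \<in> Z" if k: "k \<in> carrier G" for k
    proof -
      have hk: "h k \<in> carrier G" "g (h k) \<in> carrier G" using cl ghA k by auto
      have "(g (h k) \<otimes> inv (h k)) \<otimes> (h k \<otimes> inv k) \<in> Z"
        using gh hk k subgroup.m_closed[OF Zs] by (simp add: N_def)
      moreover have "(g (h k) \<otimes> inv (h k)) \<otimes> (h k \<otimes> inv k) = g (h k) \<otimes> inv k"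
        using hk k by (simp add: m_assoc mult_inv_cancel)
      ultimately show ?thesis using mult[OF ghA k] by simp
    qed
    ultimately show "g \<otimes>\<^bsub>?B\<^esub> h \<in> N" using clA[OF ghA] by (simp add: N_def)
  qed
  moreover have "\<exists>k. card N = p ^ k"
  proof -
    let ?NG = "?B\<lparr>carrier := N\<rparr>"
    interpret NG: group ?NG using subgroup.subgroup_is_group[OF Ns B.is_group] .
    have "\<exists>k. order ?NG = p ^ k"
    proof (rule NG.order_prime_powerI[OF prime_p])
      show "finite (carrier ?NG)" using finite_subset[OF NA finA] by simp
      fix q g assume q: "Factorial_Ring.prime q" "q \<noteq> p" and g: "g \<in> carrier ?NG" "g [^]\<^bsub>?NG\<^esub> q = \<one>\<^bsub>?NG\<^esub>"
      have gN: "g \<in> N" and gA: "g \<in> A" using g(1) NA by auto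
      have "g [^]\<^bsub>?B\<^esub> q = \<one>\<^bsub>?B\<^esub>" using g(2) B.nat_pow_consistent by simp
      then have "(g ^^ q) x = x" if "x \<in> carrier G" for x
        using BijGroup_pow[OF AB[OF gA] that, of q] oneB[OF that] by simp
      then have cop: "coprime_aut q g" using q hom[OF gA] by (auto simp: coprime_aut_def)
      \<comment> \<open>The commutator of \<open>x\<close> with \<open>g\<close> lies in
        \<open>Z\<close>, where \<open>g\<close> is trivial; a coprime \<open>g\<close> must then
        fix \<open>x\<close>.\<close>
      have "g x = x" if x: "x \<in> carrier G" for x
      proof (rule coprime_aut_fix_commutator[OF cop x])
        have "inv x \<otimes> g x = g x \<otimes> inv x" using x cl[OF gA x] by (simp add: m_comm)
        then show "g (inv x \<otimes> g x) = inv x \<otimes> g x" using gN x by (simp add: N_def)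
      qed
      then have "g = (\<lambda>x\<in>carrier G. x)"
        using Bij_imp_extensional[OF AB[OF gA]] by (intro extensionalityI) auto
      then show "g = \<one>\<^bsub>?NG\<^esub>" by (simp add: BijGroup_def)
    qed
    then show ?thesis by (simp add: order_def)
  qed
  moreover have "inv\<^bsub>?B\<^esub> \<alpha> \<otimes>\<^bsub>?B\<^esub> \<nu> \<otimes>\<^bsub>?B\<^esub> \<alpha> \<in> N" if \<alpha>: "\<alpha> \<in> A" and \<nu>: "\<nu> \<in> N" for \<alpha> \<nu>
  proof -
    let ?n = "inv\<^bsub>?B\<^esub> \<alpha> \<otimes>\<^bsub>?B\<^esub> \<nu> \<otimes>\<^bsub>?B\<^esub> \<alpha>"
    have \<nu>A: "\<nu> \<in> A" using \<nu> NA by blast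
    have nA: "?n \<in> A" using clA[OF clA[OF invA[OF \<alpha>] \<nu>A] \<alpha>] .
    have n: "?n k = (inv\<^bsub>?B\<^esub> \<alpha>) (\<nu> (\<alpha> k))" if k: "k \<in> carrier G" for k
      using mult[OF clA[OF invA[OF \<alpha>] \<nu>A] \<alpha> k] mult[OF invA[OF \<alpha>] \<nu>A cl[OF \<alpha> k]] by simp
    have "?n z = z" if z: "z \<in> Z" for z
    proof -
      have zG: "z \<in> carrier G" using z ZG by blast
      have "\<nu> (\<alpha> z) = \<alpha> z" using Zinv[OF \<alpha> z] \<nu> by (simp add: N_def)
      then show ?thesis using n[OF zG] invl(1)[OF \<alpha> zG] by simp
    qed
    moreover have "?n k \<otimes> inv k \<in> Z" if k: "k \<in> carrier G" for k
    proof -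
      have c: "\<alpha> k \<in> carrier G" "\<nu> (\<alpha> k) \<in> carrier G" using cl \<alpha> \<nu>A k by auto
      have "\<nu> (\<alpha> k) \<otimes> inv (\<alpha> k) \<in> Z" using \<nu> c by (simp add: N_def)
      then have "(inv\<^bsub>?B\<^esub> \<alpha>) (\<nu> (\<alpha> k) \<otimes> inv (\<alpha> k)) \<in> Z" using Zinv[OF invA[OF \<alpha>]] by blast
      moreover have "(inv\<^bsub>?B\<^esub> \<alpha>) (\<nu> (\<alpha> k) \<otimes> inv (\<alpha> k)) = ?n k \<otimes> inv k"
        using endo_simps(2)[OF hom[OF invA[OF \<alpha>]] c(2) inv_closed[OF c(1)]]
          endo_simps(4)[OF hom[OF invA[OF \<alpha>]] c(1)] invl(1)[OF \<alpha> k] n[OF k] by simp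
      ultimately show ?thesis by simp
    qed
    ultimately show ?thesis using nA by (simp add: N_def)
  qed
  moreover have "\<exists>\<nu>\<in>N. \<exists>k\<in>carrier G. \<nu> k \<noteq> k"
  proof -
    have "s0 k \<otimes> inv k \<in> Z" if k: "k \<in> carrier G" for k
    proof -
      have "s0 k \<otimes> inv k \<in> displacements s0" using k by (auto simp: displacements_def)
      then have "s0 k \<otimes> inv k \<in> fixed_points t" if "sink t" for t using that s0 by (auto simp: sink_def)
      then show ?thesis using cl[OF sinkA[OF s0] k] k by (auto simp: Z_def fixed_points_def)
    qed
    then have "s0 \<in> N" using sinkA[OF s0] s0 by (auto simp: N_def Z_def)
    moreover have "\<exists>k\<in>carrier G. s0 k \<noteq> k" using s0 by (auto simp: sink_def E_def transvection_def)
    ultimately show ?thesis by blast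
  qed
  ultimately show ?thesis using NA by blast
qed

end

section \<open>Morphisms of fusion systems\<close>

sublocale fusion_system \<subseteq> finite_p_group S p
  using prime_p p_group by unfold_locales

context fusion_system
begin

lemma F_morphism:
  assumes "subgroup P S" "subgroup Q S" "\<phi> \<in> F P Q"
  shows "x \<in> P \<Longrightarrow> y \<in> P \<Longrightarrow> \<phi> (x \<otimes> y) = \<phi> x \<otimes> \<phi> y" "x \<in> P \<Longrightarrow> \<phi> x \<in> Q" "inj_on \<phi> P"
    "\<phi> \<in> extensional P" "\<phi> ` P \<subseteq> Q"
  using subset_mon[OF assms(1,2)] assms(3) by (auto simp: mon_def hom_def)

lemma F_group_hom:
  assumes "subgroup P S" "subgroup Q S" "\<phi> \<in> F P Q"
  shows "group_hom (S\<lparr>carrier := P\<rparr>) S \<phi>"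
proof -
  have "\<phi> x \<in> carrier S" if "x \<in> P" for x using F_morphism(2)[OF assms that] assms(2) subgroup.mem_carrier by metis
  then show ?thesis
    using subgroup.subgroup_is_group[OF assms(1) is_group] is_group F_morphism(1)[OF assms]
    by (auto simp: group_hom_def group_hom_axioms_def hom_def)
qed

lemma F_image_subgroup:
  assumes "subgroup P S" "subgroup Q S" "\<phi> \<in> F P Q"
  shows "subgroup (\<phi> ` P) S"
  using group_hom.img_is_subgroup[OF F_group_hom[OF assms]] by simp

lemma F_inv:
  assumes "subgroup P S" "subgroup Q S" "\<phi> \<in> F P Q" "x \<in> P"
  shows "\<phi> (inv x) = inv (\<phi> x)"
  using group_hom.hom_inv[OF F_group_hom[OF assms(1-3)], of x] m_inv_consistent[OF assms(1,4)] assms(4) by simp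

lemma F_pow:
  assumes "subgroup P S" "subgroup Q S" "\<phi> \<in> F P Q" "x \<in> P"
  shows "\<phi> (x [^] (n::nat)) = \<phi> x [^] n"
  using group_hom.hom_nat_pow[OF F_group_hom[OF assms(1-3)], of x n] assms(4)
  by (simp add: nat_pow_consistent[symmetric])

lemma F_inclusion:
  assumes "subgroup P S" "subgroup Q S" "P \<subseteq> Q"
  shows "(\<lambda>x\<in>P. x) \<in> F P Q"
proof -
  have PG: "P \<subseteq> carrier S" using assms subgroup.subset by blast
  have e: "conj_map S P \<one> = (\<lambda>x\<in>P. x)" using PG by (auto simp: conj_map_def fun_eq_iff)
  have "conj_map S P \<one> ` P \<subseteq> Q" unfolding e using assms(3) by auto
  then have "conj_map S P \<one> \<in> conj_homs S P Q" unfolding conj_homs_def by blast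
  then show ?thesis using conj_homs_subset[OF assms(1,2)] e by auto
qed

lemma F_restrict:
  assumes "subgroup P S" "subgroup Q S" "\<phi> \<in> F P Q" "subgroup P' S" "P' \<subseteq> P"
  shows "restrict \<phi> P' \<in> F P' Q"
proof -
  have "compose P' \<phi> (\<lambda>x\<in>P'. x) \<in> F P' Q"
    using compose_closed[OF assms(4,1,2) F_inclusion[OF assms(4,1,5)] assms(3)] .
  moreover have "compose P' \<phi> (\<lambda>x\<in>P'. x) = restrict \<phi> P'" by (auto simp: compose_def fun_eq_iff)
  ultimately show ?thesis by simp
qed

lemma F_change_target:
  assumes "subgroup P S" "subgroup Q S" "\<phi> \<in> F P Q" "subgroup R S" "\<phi> ` P \<subseteq> R"
  shows "\<phi> \<in> F P R"
proof -
  note im = F_image_subgroup[OF assms(1-3)]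
  have 1: "\<phi> \<in> F P (\<phi> ` P)" using iso_onto_image[OF assms(1-3)] by blast
  have "compose P (\<lambda>x\<in>\<phi> ` P. x) \<phi> \<in> F P R"
    using compose_closed[OF assms(1) im assms(4) 1 F_inclusion[OF im assms(4,5)]] .
  moreover have "compose P (\<lambda>x\<in>\<phi> ` P. x) \<phi> = \<phi>"
    using F_morphism(4)[OF assms(1-3)] by (auto simp: compose_def fun_eq_iff extensional_def)
  ultimately show ?thesis by simp
qed

lemma F_inverse:
  assumes "subgroup P S" "subgroup Q S" "\<phi> \<in> F P Q"
  shows "\<exists>\<psi>\<in>F (\<phi> ` P) P. \<forall>x\<in>P. \<psi> (\<phi> x) = x"
proof (rule bexI)
  show "(\<lambda>y\<in>\<phi> ` P. inv_into P \<phi> y) \<in> F (\<phi> ` P) P" using iso_onto_image[OF assms] by blast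
  show "\<forall>x\<in>P. (\<lambda>y\<in>\<phi> ` P. inv_into P \<phi> y) (\<phi> x) = x" using F_morphism(3)[OF assms] by simp
qed

lemma F_compose:
  assumes "subgroup P S" "subgroup Q S" "subgroup R S" "\<phi> \<in> F P Q" "\<psi> \<in> F Q R"
  shows "\<exists>\<chi>\<in>F P R. \<forall>x\<in>P. \<chi> x = \<psi> (\<phi> x)"
  using compose_closed[OF assms] by (intro bexI[of _ "compose P \<psi> \<phi>"]) (auto simp: compose_def)

lemma F_conj_map:
  assumes "subgroup P S" "subgroup Q S" "g \<in> carrier S" "\<And>x. x \<in> P \<Longrightarrow> g \<otimes> x \<otimes> inv g \<in> Q"
  shows "conj_map S P g \<in> F P Q"
proof -
  have "conj_map S P g ` P \<subseteq> Q" using assms(4) by (auto simp: conj_map_def)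
  then have "conj_map S P g \<in> conj_homs S P Q" using assms(3) unfolding conj_homs_def by blast
  then show ?thesis using conj_homs_subset[OF assms(1,2)] by blast
qed

lemma F_auto_image:
  assumes "subgroup P S" "\<alpha> \<in> F P P"
  shows "\<alpha> ` P = P"
  using endo_inj_surj[OF finite_subgroup[OF assms(1)] F_morphism(5,3)[OF assms(1,1,2)]] .

lemma F_auto_Bij: "subgroup P S \<Longrightarrow> \<alpha> \<in> F P P \<Longrightarrow> \<alpha> \<in> Bij P"
  using F_auto_image F_morphism(3,4) by (simp add: Bij_def bij_betw_def)

lemma F_auto_subgroup:
  assumes P: "subgroup P S"
  shows "subgroup (F P P) (BijGroup P)"
proof -
  interpret B: group "BijGroup P" by (rule group_BijGroup)
  show ?thesis
  proof (rule B.finite_subgroupI)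
    have sub: "F P P \<subseteq> Bij P" using F_auto_Bij[OF P] by blast
    then show "finite (F P P)" using finite_Bij[OF finite_subgroup[OF P]] finite_subset by blast
    show "F P P \<subseteq> carrier (BijGroup P)" using sub by (simp add: carrier_BijGroup)
    show "F P P \<noteq> {}" using F_inclusion[OF P P] by blast
    fix \<alpha> \<beta> assume "\<alpha> \<in> F P P" "\<beta> \<in> F P P"
    then show "\<alpha> \<otimes>\<^bsub>BijGroup P\<^esub> \<beta> \<in> F P P"
      using compose_closed[OF P P P] F_auto_Bij[OF P] by (simp add: BijGroup_def)
  qed
qed

lemma F_auto_hom: "subgroup P S \<Longrightarrow> F P P \<subseteq> hom (S\<lparr>carrier := P\<rparr>) (S\<lparr>carrier := P\<rparr>)"
  using subset_mon by (auto simp: mon_def)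

lemma group_aut_group: "subgroup P S \<Longrightarrow> group (aut_group F P)"
  unfolding aut_group_def using subgroup.subgroup_is_group[OF F_auto_subgroup group_BijGroup] .

lemma finite_F_auto: "subgroup P S \<Longrightarrow> finite (F P P)"
  using finite_Bij[OF finite_subgroup] F_auto_Bij finite_subset[of "F P P" "Bij P"] by blast

lemma aut_group_simps:
  "carrier (aut_group F P) = F P P"
  "\<lbrakk>subgroup P S; \<alpha> \<in> F P P; \<beta> \<in> F P P\<rbrakk> \<Longrightarrow> \<alpha> \<otimes>\<^bsub>aut_group F P\<^esub> \<beta> = compose P \<alpha> \<beta>"
  using F_auto_Bij by (simp_all add: aut_group_def BijGroup_def)

lemma conj_homs_iff:
  "\<alpha> \<in> conj_homs S P Q \<longleftrightarrow> \<alpha> \<in> extensional P \<and> (\<exists>g\<in>carrier S. \<forall>x\<in>P. \<alpha> x = g \<otimes> x \<otimes> inv g \<and> \<alpha> x \<in> Q)"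
proof
  assume "\<alpha> \<in> conj_homs S P Q"
  then show "\<alpha> \<in> extensional P \<and> (\<exists>g\<in>carrier S. \<forall>x\<in>P. \<alpha> x = g \<otimes> x \<otimes> inv g \<and> \<alpha> x \<in> Q)"
  proof -
    assume "\<alpha> \<in> conj_homs S P Q"
    then obtain g where g: "g \<in> carrier S" "\<alpha> = conj_map S P g" "conj_map S P g ` P \<subseteq> Q"
      by (auto simp: conj_homs_def)
    have "\<forall>x\<in>P. \<alpha> x = g \<otimes> x \<otimes> inv g \<and> \<alpha> x \<in> Q" using g(2,3) by (auto simp: conj_map_def)
    moreover have "\<alpha> \<in> extensional P" using g(2) by (simp add: conj_map_def)
    ultimately show ?thesis using g(1) by blast
  qed
next
  assume a: "\<alpha> \<in> extensional P \<and> (\<exists>g\<in>carrier S. \<forall>x\<in>P. \<alpha> x = g \<otimes> x \<otimes> inv g \<and> \<alpha> x \<in> Q)"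
  then obtain g where g: "g \<in> carrier S" "\<And>x. x \<in> P \<Longrightarrow> \<alpha> x = g \<otimes> x \<otimes> inv g \<and> \<alpha> x \<in> Q" by blast
  have "\<alpha> = conj_map S P g"
    unfolding conj_map_def by (rule extensionalityI[of _ P]) (use a g in auto)
  moreover have "\<alpha> ` P \<subseteq> Q" using g by blast
  ultimately show "\<alpha> \<in> conj_homs S P Q" using g by (auto simp: conj_homs_def)
qed

lemma mem_normalizer_iff:
  assumes Q: "subgroup Q S"
  shows "g \<in> normalizer S Q \<longleftrightarrow> g \<in> carrier S \<and> normalizes g Q"
proof -
  have QG: "Q \<subseteq> carrier S" using Q subgroup.subset by blast
  have e: "g <# Q #> inv g = (\<lambda>x. g \<otimes> x \<otimes> inv g) ` Q" by (auto simp: l_coset_def r_coset_def)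
  have "(\<lambda>x. g \<otimes> x \<otimes> inv g) ` Q = Q" if g: "g \<in> carrier S" and n: "normalizes g Q"
  proof (rule endo_inj_surj[OF finite_subgroup[OF Q]])
    show "(\<lambda>x. g \<otimes> x \<otimes> inv g) ` Q \<subseteq> Q" using n by (auto simp: normalizes_def)
    show "inj_on (\<lambda>x. g \<otimes> x \<otimes> inv g) Q" using g QG by (auto simp: inj_on_def subset_iff)
  qed
  moreover have "normalizes g Q" if "(\<lambda>x. g \<otimes> x \<otimes> inv g) ` Q = Q"
    using that by (auto simp: normalizes_def)
  ultimately show ?thesis using QG e by (auto simp: normalizer_def stabilizer_def)
qed

text \<open>Removes the inverse of \<open>\<phi>\<close> from the definition; that the transported
  map stays within the image follows from \<open>g\<close> normalizing \<open>P\<close>.\<close>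

lemma mem_extension_domain_iff:
  assumes P: "subgroup P S" and \<phi>: "\<phi> \<in> F P (carrier S)"
  shows "g \<in> extension_domain S P \<phi> \<longleftrightarrow> g \<in> carrier S \<and> normalizes g P \<and>
    (\<exists>h\<in>carrier S. \<forall>x\<in>P. \<phi> (g \<otimes> x \<otimes> inv g) = h \<otimes> \<phi> x \<otimes> inv h)"
proof (cases "g \<in> carrier S \<and> normalizes g P")
  case True
  let ?\<beta> = "\<lambda>y\<in>\<phi> ` P. \<phi> (conj_map S P g (inv_into P \<phi> y))"
  have inj: "inj_on \<phi> P" using F_morphism(3)[OF P subgroup_self \<phi>] .
  have b: "?\<beta> (\<phi> x) = \<phi> (g \<otimes> x \<otimes> inv g)" if "x \<in> P" for x
    using that inj by (simp add: conj_map_def)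
  have "?\<beta> \<in> conj_homs S (\<phi> ` P) (\<phi> ` P) \<longleftrightarrow> (\<exists>h\<in>carrier S. \<forall>x\<in>P. \<phi> (g \<otimes> x \<otimes> inv g) = h \<otimes> \<phi> x \<otimes> inv h)"
  proof -
    have "?\<beta> \<in> conj_homs S (\<phi> ` P) (\<phi> ` P) \<longleftrightarrow>
      (\<exists>h\<in>carrier S. \<forall>x\<in>P. ?\<beta> (\<phi> x) = h \<otimes> \<phi> x \<otimes> inv h \<and> ?\<beta> (\<phi> x) \<in> \<phi> ` P)"
      unfolding conj_homs_iff by (simp only: ball_simps(9) restrict_extensional simp_thms)
    also have "\<dots> \<longleftrightarrow> (\<exists>h\<in>carrier S. \<forall>x\<in>P. \<phi> (g \<otimes> x \<otimes> inv g) = h \<otimes> \<phi> x \<otimes> inv h)"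
    proof -
      have "\<phi> (g \<otimes> x \<otimes> inv g) \<in> \<phi> ` P" if "x \<in> P" for x using True that by (simp add: normalizes_def)
      then show ?thesis using b by simp
    qed
    finally show ?thesis .
  qed
  then show ?thesis using True mem_normalizer_iff[OF P] by (simp add: extension_domain_def)
next
  case False
  then show ?thesis using mem_normalizer_iff[OF P] by (auto simp: extension_domain_def)
qed

lemma
  assumes P: "subgroup P S" and \<phi>: "\<phi> \<in> F P (carrier S)"
  shows subgroup_extension_domain: "subgroup (extension_domain S P \<phi>) S"
    and extension_domain_incl: "P \<subseteq> extension_domain S P \<phi>"
proof -
  let ?N = "extension_domain S P \<phi>"
  note iff = mem_extension_domain_iff[OF P \<phi>]
  note mor = F_morphism[OF P subgroup_self \<phi>]
  have PG: "x \<in> carrier S" if "x \<in> P" for x using that P subgroup.mem_carrier by metis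
  show incl: "P \<subseteq> ?N"
  proof
    fix g assume g: "g \<in> P"
    have "\<phi> (g \<otimes> x \<otimes> inv g) = \<phi> g \<otimes> \<phi> x \<otimes> inv (\<phi> g)" if x: "x \<in> P" for x
      using mor(1)[OF subgroup.m_closed[OF P g x] subgroup.m_inv_closed[OF P g]] mor(1)[OF g x]
        F_inv[OF P subgroup_self \<phi> g] by simp
    then show "g \<in> ?N" using iff g PG normalizes_mem[OF P g] mor(2) by blast
  qed
  show "subgroup ?N S"
  proof (rule finite_subgroupI)
    show sub: "?N \<subseteq> carrier S" using iff by blast
    show "finite ?N" using finite_subset[OF sub finite_carrier] .
    show "?N \<noteq> {}" using incl subgroup.one_closed[OF P] by blast
    fix g g' assume "g \<in> ?N" "g' \<in> ?N"
    then obtain h h' where g: "g \<in> carrier S" "normalizes g P" "h \<in> carrier S" "\<And>x. x \<in> P \<Longrightarrow> \<phi> (g \<otimes> x \<otimes> inv g) = h \<otimes> \<phi> x \<otimes> inv h"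
      and g': "g' \<in> carrier S" "normalizes g' P" "h' \<in> carrier S" "\<And>x. x \<in> P \<Longrightarrow> \<phi> (g' \<otimes> x \<otimes> inv g') = h' \<otimes> \<phi> x \<otimes> inv h'"
      unfolding iff by blast
    have "\<phi> ((g \<otimes> g') \<otimes> x \<otimes> inv (g \<otimes> g')) = (h \<otimes> h') \<otimes> \<phi> x \<otimes> inv (h \<otimes> h')" if x: "x \<in> P" for x
    proof -
      have "(g \<otimes> g') \<otimes> x \<otimes> inv (g \<otimes> g') = g \<otimes> (g' \<otimes> x \<otimes> inv g') \<otimes> inv g"
        using g(1) g'(1) PG[OF x] by (simp add: group_word_simps)
      then have "\<phi> ((g \<otimes> g') \<otimes> x \<otimes> inv (g \<otimes> g')) = h \<otimes> (h' \<otimes> \<phi> x \<otimes> inv h') \<otimes> inv h"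
        using g(4)[OF normalizes_closed[OF g'(2) x]] g'(4)[OF x] by simp
      then show ?thesis using g(3) g'(3) mor(2)[OF x] by (simp add: group_word_simps)
    qed
    then show "g \<otimes> g' \<in> ?N"
      unfolding iff using g(1,3) g'(1,3) normalizes_mult[OF P g(1) g'(1) g(2) g'(2)]
      by (intro conjI bexI[of _ "h \<otimes> h'"]) auto
  qed
qed

section \<open>Conjugate subgroups and transport of automorphisms\<close>

lemma fusion_conjugateI:
  "subgroup P S \<Longrightarrow> \<phi> \<in> F P (carrier S) \<Longrightarrow> fusion_conjugate S F P (\<phi> ` P)"
  using iso_onto_image[OF _ subgroup_self] F_image_subgroup[OF _ subgroup_self]
  unfolding fusion_conjugate_def by blast

lemma fusion_conjugateD:
  assumes "fusion_conjugate S F P Q"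
  shows "subgroup P S" "subgroup Q S" "card Q = card P" "\<exists>\<phi>\<in>F P (carrier S). \<phi> ` P = Q"
proof -
  show s: "subgroup P S" "subgroup Q S" using assms by (auto simp: fusion_conjugate_def)
  obtain \<phi> where \<phi>: "\<phi> \<in> F P Q" "\<phi> ` P = Q" using assms by (auto simp: fusion_conjugate_def)
  show "card Q = card P" using card_image[OF F_morphism(3)[OF s \<phi>(1)]] \<phi>(2) by simp
  have "\<phi> \<in> F P (carrier S)" using F_change_target[OF s \<phi>(1) subgroup_self] F_morphism(5)[OF s \<phi>(1)] subgroup.subset[OF s(2)] by blast
  then show "\<exists>\<phi>\<in>F P (carrier S). \<phi> ` P = Q" using \<phi> by blast
qed

lemma fusion_conjugate_trans:
  assumes "fusion_conjugate S F P Q" "fusion_conjugate S F Q R"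
  shows "fusion_conjugate S F P R"
proof -
  note s = fusion_conjugateD(1,2)[OF assms(1)] fusion_conjugateD(2)[OF assms(2)]
  obtain \<phi> \<psi> where f: "\<phi> \<in> F P Q" "\<phi> ` P = Q" "\<psi> \<in> F Q R" "\<psi> ` Q = R" using assms by (auto simp: fusion_conjugate_def)
  obtain \<chi> where \<chi>: "\<chi> \<in> F P R" "\<forall>x\<in>P. \<chi> x = \<psi> (\<phi> x)" using F_compose[OF s f(1,3)] by blast
  have "\<chi> ` P = R" using \<chi>(2) f(2,4) by force
  then show ?thesis using \<chi>(1) s by (auto simp: fusion_conjugate_def)
qed

lemma exists_fully_normalized:
  assumes P: "subgroup P S"
  shows "\<exists>\<chi>\<in>F P (carrier S). fully_normalized S F (\<chi> ` P)"
proof -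
  have self: "fusion_conjugate S F P P"
  proof -
    have "(\<lambda>x\<in>P. x) ` P = P" by auto
    then show ?thesis using F_inclusion[OF P P] P unfolding fusion_conjugate_def by blast
  qed
  have bound: "\<forall>Q. fusion_conjugate S F P Q \<longrightarrow> card (normalizer S Q) < Suc (card (carrier S))"
  proof (intro allI impI)
    fix Q assume "fusion_conjugate S F P Q"
    then have "normalizer S Q \<subseteq> carrier S" using mem_normalizer_iff fusion_conjugateD(2) by blast
    then show "card (normalizer S Q) < Suc (card (carrier S))" using card_mono[OF finite_carrier] by (simp add: le_imp_less_Suc)
  qed
  obtain Q where Q: "fusion_conjugate S F P Q" "\<And>R. fusion_conjugate S F P R \<Longrightarrow> card (normalizer S R) \<le> card (normalizer S Q)"
    using ex_has_greatest_nat[OF self bound] by blast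
  obtain \<chi> where \<chi>: "\<chi> \<in> F P (carrier S)" "\<chi> ` P = Q" using fusion_conjugateD(4)[OF Q(1)] by blast
  have "fully_normalized S F Q"
    unfolding fully_normalized_def using fusion_conjugateD(2)[OF Q(1)] Q(2) fusion_conjugate_trans[OF Q(1)] by blast
  then show ?thesis using \<chi> by blast
qed

text \<open>The automorphism \<open>\<chi> \<alpha> \<chi>^-1\<close>, extensional on the image of
  \<open>P\<close>.\<close>

definition transport :: "'a set \<Rightarrow> ('a \<Rightarrow> 'a) \<Rightarrow> ('a \<Rightarrow> 'a) \<Rightarrow> 'a \<Rightarrow> 'a" where
  "transport P \<chi> \<alpha> = (\<lambda>y\<in>\<chi> ` P. \<chi> (\<alpha> (inv_into P \<chi> y)))"

lemma transport_apply:
  assumes P: "subgroup P S" and \<chi>: "\<chi> \<in> F P (carrier S)" and x: "x \<in> P"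
  shows "transport P \<chi> \<alpha> (\<chi> x) = \<chi> (\<alpha> x)"
  using F_morphism(3)[OF P subgroup_self \<chi>] x by (simp add: transport_def)

lemma transport_F:
  assumes P: "subgroup P S" and \<chi>: "\<chi> \<in> F P (carrier S)" and \<alpha>: "\<alpha> \<in> F P P"
  shows "transport P \<chi> \<alpha> \<in> F (\<chi> ` P) (\<chi> ` P)"
proof -
  let ?K = "\<chi> ` P"
  have K: "subgroup ?K S" using F_image_subgroup[OF P subgroup_self \<chi>] .
  have i: "\<chi> \<in> F P ?K" "(\<lambda>y\<in>?K. inv_into P \<chi> y) \<in> F ?K P" using iso_onto_image[OF P subgroup_self \<chi>] by auto
  obtain \<beta> where \<beta>: "\<beta> \<in> F ?K P" "\<forall>y\<in>?K. \<beta> y = \<alpha> ((\<lambda>y\<in>?K. inv_into P \<chi> y) y)"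
    using F_compose[OF K P P i(2) \<alpha>] by blast
  obtain \<gamma> where \<gamma>: "\<gamma> \<in> F ?K ?K" "\<forall>y\<in>?K. \<gamma> y = \<chi> (\<beta> y)" using F_compose[OF K P K \<beta>(1) i(1)] by blast
  have "\<gamma> = transport P \<chi> \<alpha>"
    by (rule extensionalityI[OF F_morphism(4)[OF K K \<gamma>(1)]]) (auto simp: transport_def \<gamma>(2) \<beta>(2))
  then show ?thesis using \<gamma>(1) by simp
qed

text \<open>Serves to carry the Sylow subgroup \<open>Aut_S(P)\<close> to a second Sylow subgroup of
  the automizer of the image. Surjectivity comes from conjugating back with the inverse of
  \<open>\<chi>\<close>.\<close>

lemma transport_iso:
  assumes P: "subgroup P S" and \<chi>: "\<chi> \<in> F P (carrier S)"
  shows "transport P \<chi> \<in> iso (aut_group F P) (aut_group F (\<chi> ` P))"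
proof -
  let ?K = "\<chi> ` P"
  have K: "subgroup ?K S" using F_image_subgroup[OF P subgroup_self \<chi>] .
  note tr = transport_apply[OF P \<chi>] and tF = transport_F[OF P \<chi>]
  have inj\<chi>: "inj_on \<chi> P" using F_morphism(3)[OF P subgroup_self \<chi>] .
  have acl: "\<alpha> x \<in> P" if "\<alpha> \<in> F P P" "x \<in> P" for \<alpha> x using F_morphism(2)[OF P P that] .
  have h: "transport P \<chi> (compose P \<alpha> \<beta>) = compose ?K (transport P \<chi> \<alpha>) (transport P \<chi> \<beta>)"
    if ab: "\<alpha> \<in> F P P" "\<beta> \<in> F P P" for \<alpha> \<beta>
  proof (rule extensionalityI[of _ ?K])
    show "transport P \<chi> (compose P \<alpha> \<beta>) \<in> extensional ?K" by (simp add: transport_def)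
    show "compose ?K (transport P \<chi> \<alpha>) (transport P \<chi> \<beta>) \<in> extensional ?K" by (rule compose_extensional)
    fix y assume "y \<in> ?K"
    then obtain x where x: "x \<in> P" "y = \<chi> x" by blast
    show "transport P \<chi> (compose P \<alpha> \<beta>) y = compose ?K (transport P \<chi> \<alpha>) (transport P \<chi> \<beta>) y"
      using x tr[OF x(1)] tr[OF acl[OF ab(2) x(1)]] by (simp add: compose_def)
  qed
  have "transport P \<chi> \<in> hom (aut_group F P) (aut_group F ?K)"
    by (rule homI) (simp_all add: aut_group_simps(1) aut_group_simps(2)[OF P] aut_group_simps(2)[OF K] tF h)
  moreover have "inj_on (transport P \<chi>) (F P P)"
  proof
    fix \<alpha> \<beta> assume ab: "\<alpha> \<in> F P P" "\<beta> \<in> F P P" "transport P \<chi> \<alpha> = transport P \<chi> \<beta>"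
    have "\<alpha> x = \<beta> x" if x: "x \<in> P" for x
    proof -
      have "\<chi> (\<alpha> x) = \<chi> (\<beta> x)" using tr[OF x, of \<alpha>] tr[OF x, of \<beta>] ab(3) by simp
      then show ?thesis using inj_onD[OF inj\<chi>] acl ab x by blast
    qed
    then show "\<alpha> = \<beta>"
      using extensionalityI[OF F_morphism(4)[OF P P ab(1)] F_morphism(4)[OF P P ab(2)]] by blast
  qed
  moreover have "transport P \<chi> ` F P P = F ?K ?K"
  proof
    show "transport P \<chi> ` F P P \<subseteq> F ?K ?K" using tF by blast
    show "F ?K ?K \<subseteq> transport P \<chi> ` F P P"
    proof
      fix \<beta> assume \<beta>: "\<beta> \<in> F ?K ?K"
      have i: "\<chi> \<in> F P ?K" "(\<lambda>y\<in>?K. inv_into P \<chi> y) \<in> F ?K P" using iso_onto_image[OF P subgroup_self \<chi>] by auto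
      obtain \<gamma> where \<gamma>: "\<gamma> \<in> F P ?K" "\<forall>x\<in>P. \<gamma> x = \<beta> (\<chi> x)" using F_compose[OF P K K i(1) \<beta>] by blast
      obtain \<alpha> where \<alpha>: "\<alpha> \<in> F P P" "\<forall>x\<in>P. \<alpha> x = (\<lambda>y\<in>?K. inv_into P \<chi> y) (\<gamma> x)"
        using F_compose[OF P K P \<gamma>(1) i(2)] by blast
      have "\<beta> = transport P \<chi> \<alpha>"
      proof (rule extensionalityI[OF F_morphism(4)[OF K K \<beta>]])
        show "transport P \<chi> \<alpha> \<in> extensional ?K" by (simp add: transport_def)
        fix y assume y: "y \<in> ?K"
        then obtain x where x: "x \<in> P" "y = \<chi> x" by blast
        have by': "\<beta> y \<in> ?K" using F_morphism(2)[OF K K \<beta> y] .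
        have "\<chi> (\<alpha> x) = \<chi> (inv_into P \<chi> (\<beta> y))" using \<alpha>(2) \<gamma>(2) x by' by simp
        also have "\<dots> = \<beta> y" using f_inv_into_f[OF by'] .
        finally show "\<beta> y = transport P \<chi> \<alpha> y" using tr[OF x(1)] x(2) by simp
      qed
      then show "\<beta> \<in> transport P \<chi> ` F P P" using \<alpha>(1) by blast
    qed
  qed
  ultimately show ?thesis by (simp add: iso_def bij_betw_def aut_group_simps(1))
qed

end

section \<open>Extending morphisms to \<open>S\<close>\<close>

text \<open>The subgroup \<open>D\<close> enters only through its order, recorded as the exponent
  \<open>d\<close>.\<close>

locale semi_invariant_fusion = saturated_fusion_system +
  fixes d :: nat
  assumes odd_p: "odd p" and d_pos: "0 < d" and d_lt: "p ^ d < order S"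
    and abelian: "\<lbrakk>subgroup H S; card H = p ^ d\<rbrakk> \<Longrightarrow> comm_group (S\<lparr>carrier := H\<rparr>)"
    and semi_inv: "\<lbrakk>subgroup H S; card H = p ^ d\<rbrakk> \<Longrightarrow> semi_invariant S F H"
begin

lemma abelianD:
  assumes "subgroup H S" "card H = p ^ d" "x \<in> H" "y \<in> H"
  shows "x \<otimes> y = y \<otimes> x"
  using comm_groupE(4)[OF abelian[OF assms(1,2)], of x y] assms(3,4) by simp

lemma semi_invD:
  assumes "subgroup H S" "card H = p ^ d" "subgroup K S" "H \<subseteq> K" "\<alpha> \<in> F K K"
  shows "\<alpha> ` H = H"
  using semi_inv[OF assms(1,2)] assms(3-5) by (auto simp: semi_invariant_def)

text \<open>Semi-invariance inside \<open>K = S\<close>, applied to the inner automorphisms.\<close>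

lemma normalizes_card_pd:
  assumes H: "subgroup H S" "card H = p ^ d" and g: "g \<in> carrier S"
  shows "normalizes g H"
proof -
  have "conj_map S (carrier S) g \<in> F (carrier S) (carrier S)"
    using g by (intro F_conj_map[OF subgroup_self subgroup_self]) auto
  then have e: "conj_map S (carrier S) g ` H = H"
    using semi_invD[OF H subgroup_self subgroup.subset[OF H(1)]] by blast
  have "g \<otimes> h \<otimes> inv g \<in> H" if h: "h \<in> H" for h
  proof -
    have "conj_map S (carrier S) g h \<in> H" using e h by blast
    then show ?thesis using subgroup.mem_carrier[OF H(1) h] by (simp add: conj_map_def)
  qed
  then show ?thesis by (simp add: normalizes_def)
qed

lemma sylow_conj_homs:
  assumes "fully_normalized S F K"
  shows "sylow_subgroup p (conj_homs S K K) (aut_group F K)"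
  using fully_normalized_imp[OF assms] by blast

text \<open>Turns the finite order of \<open>g\<close> into a \<open>p\<close>-power period of the
  automorphism it induces on \<open>P\<close>.\<close>

lemma conj_iterate:
  assumes g: "g \<in> carrier S" and x: "x \<in> carrier S" and n: "\<And>y. y \<in> P \<Longrightarrow> \<beta> y = g \<otimes> y \<otimes> inv g" "\<And>y. y \<in> P \<Longrightarrow> \<beta> y \<in> P"
    and xP: "x \<in> P" and P: "P \<subseteq> carrier S"
  shows "(\<beta> ^^ k) x = g [^] k \<otimes> x \<otimes> inv (g [^] k)"
proof -
  have "(\<beta> ^^ k) x \<in> P \<and> (\<beta> ^^ k) x = g [^] k \<otimes> x \<otimes> inv (g [^] k)"
  proof (induction k)
    case 0
    then show ?case using x xP by simp
  next
    case (Suc k)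
    have "(\<beta> ^^ Suc k) x = g \<otimes> (g [^] k \<otimes> x \<otimes> inv (g [^] k)) \<otimes> inv g" using Suc n(1) by auto
    also have "\<dots> = (g \<otimes> g [^] k) \<otimes> x \<otimes> inv (g \<otimes> g [^] k)" using g x by (simp add: group_word_simps)
    also have "g \<otimes> g [^] k = g [^] Suc k" using g by (simp add: nat_pow_Suc2[symmetric] del: nat_pow_Suc)
    finally have "(\<beta> ^^ Suc k) x = g [^] Suc k \<otimes> x \<otimes> inv (g [^] Suc k)" .
    moreover have "(\<beta> ^^ Suc k) x \<in> P" using Suc n(2) by auto
    ultimately show ?case by (intro conjI)
  qed
  then show ?thesis by blast
qed

section \<open>Extension domains of subgroups whose order is not p^d\<close>

text \<open>The Frattini kernel of a controlling subgroup is a \<open>p\<close>-group containing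
  \<open>Aut_S(K)\<close>, which is Sylow since \<open>K\<close> is fully normalized, so the two
  coincide. Each property of the kernel becomes a statement about conjugation by elements of
  \<open>S\<close>.\<close>

lemma large_automorphisms:
  assumes K: "subgroup K S" and big: "p ^ d < card K" and fn: "fully_normalized S F K"
  shows "\<lbrakk>\<beta> \<in> F K K; \<And>y. y \<in> K \<Longrightarrow> (\<beta> ^^ (p ^ m)) y = y\<rbrakk> \<Longrightarrow> \<exists>s\<in>carrier S. \<forall>y\<in>K. \<beta> y = s \<otimes> y \<otimes> inv s"
    and "\<beta> \<in> F K K \<Longrightarrow> \<exists>s\<in>carrier S. \<forall>y\<in>K. (\<beta> ^^ (p - 1)) y = s \<otimes> y \<otimes> inv s"
    and "\<lbrakk>\<beta> \<in> F K K; \<gamma> \<in> F K K\<rbrakk> \<Longrightarrow>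
      \<exists>s\<in>carrier S. \<forall>y\<in>K. s \<otimes> y \<otimes> inv s \<in> K \<and> \<beta> (\<gamma> y) = \<gamma> (\<beta> (s \<otimes> y \<otimes> inv s))"
proof -
  let ?K = "S\<lparr>carrier := K\<rparr>" and ?A = "F K K"
  interpret K: finite_p_group ?K p using finite_p_group_subgroup[OF K] .
  have KG: "K \<subseteq> carrier S" using subgroup.subset[OF K] .
  have sub: "subgroup H S" "H \<subseteq> K" if "subgroup H ?K" for H
    using incl_subgroup[OF K that] subgroup.subset[OF that] by auto
  have A: "subgroup ?A (BijGroup (carrier ?K))" "?A \<subseteq> hom ?K ?K"
    using F_auto_subgroup[OF K] F_auto_hom[OF K] by auto
  have "\<exists>Q. K.controlling ?A Q"
  proof (rule K.exists_controlling[OF odd_p d_pos _ A(2)])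
    show "p ^ d < order ?K" using big by (simp add: order_def)
    show "preserves ?A H" if "subgroup H ?K" "card H = p ^ d" for H
      using semi_invD[OF sub(1)[OF that(1)] that(2) K sub(2)[OF that(1)]] by (auto simp: preserves_def)
    show "K.normalizes x H" if "subgroup H ?K" "card H = p ^ d" "x \<in> carrier ?K" for H x
      using normalizes_card_pd[OF sub(1)[OF that(1)] that(2), of x] that(3) KG m_inv_consistent[OF K, of x]
      by (auto simp: normalizes_def K.normalizes_def)
  qed
  then obtain Q where Q: "K.controlling ?A Q" by blast
  let ?N = "K.frattini_kernel ?A Q" and ?T = "conj_homs S K K"
  interpret aut: group "aut_group F K" by (rule group_aut_group[OF K])
  have T: "subgroup ?T (aut_group F K)" "card ?T = p ^ multiplicity p (order (aut_group F K))"
    using sylow_conj_homs[OF fn] by (auto simp: sylow_subgroup_def)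
  have finA: "finite ?A" using finite_F_auto[OF K] .
  have TA: "?T \<subseteq> ?A" using conj_homs_subset[OF K K] .
  have TN: "?T \<subseteq> ?N"
  proof
    fix \<tau> assume \<tau>: "\<tau> \<in> ?T"
    then obtain g where g: "g \<in> carrier S" "\<And>y. y \<in> K \<Longrightarrow> \<tau> y = g \<otimes> y \<otimes> inv g" "\<And>y. y \<in> K \<Longrightarrow> \<tau> y \<in> K"
      unfolding conj_homs_iff by blast
    obtain m where m: "g [^] (p ^ m) = \<one>" using pow_card_eq_one[OF g(1)] by blast
    show "\<tau> \<in> ?N"
    proof (rule K.frattini_kernel_p_power[OF A Q])
      show "\<tau> \<in> ?A" using \<tau> TA by blast
      fix y assume "y \<in> carrier ?K"
      then have y: "y \<in> K" "y \<in> carrier S" using KG by auto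
      show "(\<tau> ^^ (p ^ m)) y = y"
        using conj_iterate[OF g(1) y(2) g(2,3) y(1) KG, of "p ^ m"] m y(2) by simp
    qed
  qed
  have NA: "?N \<subseteq> ?A" by (auto simp: K.frattini_kernel_def)
  have NT: "?N = ?T"
  proof -
    have Ns: "subgroup ?N (aut_group F K)"
      unfolding aut_group_def
      using group.subgroup_incl[OF group_BijGroup K.subgroup_frattini_kernel[OF A Q] A(1) NA] by simp
    obtain k where k: "card ?N = p ^ k" using K.card_frattini_kernel[OF A Q] by blast
    have o: "order (aut_group F K) \<noteq> 0"
      using finA F_inclusion[OF K K] by (auto simp: order_def aut_group_simps(1))
    have "p ^ k dvd order (aut_group F K)"
      using aut.lagrange[OF Ns] k by (metis dvd_triv_right)
    then have "k \<le> multiplicity p (order (aut_group F K))"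
      using o prime_p multiplicity_geI not_prime_unit by blast
    then have "card ?N \<le> card ?T" using k T(2) p_gt_1 by (simp add: power_increasing)
    then show ?thesis using card_seteq[OF finite_subset[OF NA finA] TN] by simp
  qed
  have conjD: "\<exists>s\<in>carrier S. \<forall>y\<in>K. \<nu> y = s \<otimes> y \<otimes> inv s \<and> \<nu> y \<in> K" if "\<nu> \<in> ?N" for \<nu>
    using that unfolding NT conj_homs_iff by blast
  show "\<exists>s\<in>carrier S. \<forall>y\<in>K. \<beta> y = s \<otimes> y \<otimes> inv s" if "\<beta> \<in> F K K" "\<And>y. y \<in> K \<Longrightarrow> (\<beta> ^^ (p ^ m)) y = y"
    using conjD[OF K.frattini_kernel_p_power[OF A Q that(1), of m]] that(2) by auto
  show "\<exists>s\<in>carrier S. \<forall>y\<in>K. (\<beta> ^^ (p - 1)) y = s \<otimes> y \<otimes> inv s" if \<beta>: "\<beta> \<in> F K K"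
  proof -
    have "\<beta> [^]\<^bsub>BijGroup K\<^esub> (p - 1) \<in> ?N" using K.frattini_kernel_power[OF A Q \<beta>] by simp
    then obtain s where s: "s \<in> carrier S" "\<forall>y\<in>K. (\<beta> [^]\<^bsub>BijGroup K\<^esub> (p - 1)) y = s \<otimes> y \<otimes> inv s \<and> (\<beta> [^]\<^bsub>BijGroup K\<^esub> (p - 1)) y \<in> K"
      using conjD by blast
    have "(\<beta> ^^ (p - 1)) y = s \<otimes> y \<otimes> inv s" if y: "y \<in> K" for y
      using BijGroup_pow[OF F_auto_Bij[OF K \<beta>] y, of "p - 1"] s(2) y by simp
    then show ?thesis using s(1) by blast
  qed
  show "\<exists>s\<in>carrier S. \<forall>y\<in>K. s \<otimes> y \<otimes> inv s \<in> K \<and> \<beta> (\<gamma> y) = \<gamma> (\<beta> (s \<otimes> y \<otimes> inv s))"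
    if \<beta>: "\<beta> \<in> F K K" and \<gamma>: "\<gamma> \<in> F K K"
  proof -
    obtain \<nu> where \<nu>: "\<nu> \<in> ?N" "\<forall>x\<in>K. \<beta> (\<gamma> x) = \<gamma> (\<beta> (\<nu> x))"
      using K.frattini_kernel_commutator[OF A Q \<beta> \<gamma>] by auto
    obtain s where s: "s \<in> carrier S" "\<forall>y\<in>K. \<nu> y = s \<otimes> y \<otimes> inv s \<and> \<nu> y \<in> K" using conjD[OF \<nu>(1)] by blast
    have "s \<otimes> y \<otimes> inv s \<in> K \<and> \<beta> (\<gamma> y) = \<gamma> (\<beta> (s \<otimes> y \<otimes> inv s))" if y: "y \<in> K" for y
    proof -
      have "\<nu> y = s \<otimes> y \<otimes> inv s" "\<nu> y \<in> K" using s(2) y by blast+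
      then show ?thesis using \<nu>(2) y by metis
    qed
    then show ?thesis using s(1) by blast
  qed
qed

text \<open>Subgroups of order less than \<open>p\<^sup>d\<close> are properly contained in abelian subgroups, so they never
  contain their centralizer.\<close>

lemma small_extension_domain:
  assumes P: "subgroup P S" and \<chi>: "\<chi> \<in> F P (carrier S)" and c: "card P < p ^ d"
  shows "\<exists>g\<in>extension_domain S P \<chi>. g \<notin> P"
proof -
  have "card P \<le> p ^ d" "p ^ d \<le> card (carrier S)" using c d_lt by (auto simp: order_def)
  then obtain H where H: "subgroup H S" "P \<subseteq> H" "card H = p ^ d"
    using subgroup_of_card_between[OF P subgroup_self subgroup.subset[OF P]] by blast
  then have "H \<noteq> P" using c by auto
  then obtain g where g: "g \<in> H" "g \<notin> P" using H by blast
  have gG: "g \<in> carrier S" using g H subgroup.mem_carrier by metis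
  have fxd: "g \<otimes> x \<otimes> inv g = x" if x: "x \<in> P" for x
  proof -
    have xG: "x \<in> carrier S" using x P subgroup.mem_carrier by metis
    have "g \<otimes> x = x \<otimes> g" using abelianD[OF H(1,3) g(1)] x H(2) by blast
    then show ?thesis using xG gG by (simp add: m_assoc)
  qed
  have "normalizes g P" using fxd by (simp add: normalizes_def)
  moreover have "\<chi> (g \<otimes> x \<otimes> inv g) = \<one> \<otimes> \<chi> x \<otimes> inv \<one>" if x: "x \<in> P" for x
    using fxd[OF x] F_morphism(2)[OF P subgroup_self \<chi> x] by simp
  ultimately have "g \<in> extension_domain S P \<chi>"
    using mem_extension_domain_iff[OF P \<chi>] gG one_closed by blast
  then show ?thesis using g by blast
qed

text \<open>An element \<open>g\<close> outside \<open>P\<close> normalizing \<open>P\<close>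
  induces an automorphism of \<open>p\<close>-power period; transported to the fully normalized
  image it is again conjugation by an element of \<open>S\<close>, which is the condition on
  \<open>g\<close>.\<close>

lemma large_extension_domain:
  assumes P: "subgroup P S" and \<chi>: "\<chi> \<in> F P (carrier S)" and c: "p ^ d < card P" "P \<noteq> carrier S"
    and fn: "fully_normalized S F (\<chi> ` P)"
  shows "\<exists>g\<in>extension_domain S P \<chi>. g \<notin> P"
proof -
  let ?K = "\<chi> ` P"
  have K: "subgroup ?K S" using F_image_subgroup[OF P subgroup_self \<chi>] .
  have cK: "card ?K = card P" using card_image[OF F_morphism(3)[OF P subgroup_self \<chi>]] .
  have PG: "P \<subseteq> carrier S" using subgroup.subset[OF P] .
  obtain g where g: "g \<in> carrier S" "g \<notin> P" "normalizes g P" using proper_subgroup_normalized[OF P c(2)] by blast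
  let ?\<gamma> = "conj_map S P g"
  have \<gamma>: "?\<gamma> \<in> F P P" using F_conj_map[OF P P g(1)] normalizes_closed[OF g(3)] by blast
  have \<gamma>y: "?\<gamma> y = g \<otimes> y \<otimes> inv g" "?\<gamma> y \<in> P" if "y \<in> P" for y
    using that normalizes_closed[OF g(3) that] by (auto simp: conj_map_def)
  let ?\<beta> = "transport P \<chi> ?\<gamma>"
  have \<beta>: "?\<beta> \<in> F ?K ?K" using transport_F[OF P \<chi> \<gamma>] .
  have it: "(?\<beta> ^^ k) (\<chi> x) = \<chi> ((?\<gamma> ^^ k) x) \<and> (?\<gamma> ^^ k) x \<in> P" if x: "x \<in> P" for x k
    by (induction k) (use x \<gamma>y transport_apply[OF P \<chi>] in auto)
  obtain m where m: "g [^] (p ^ m) = \<one>" using pow_card_eq_one[OF g(1)] by blast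
  have "(?\<beta> ^^ (p ^ m)) y = y" if yK: "y \<in> ?K" for y
  proof -
    obtain x where x: "x \<in> P" "y = \<chi> x" using yK by blast
    have xG: "x \<in> carrier S" using x PG by blast
    have "(?\<gamma> ^^ (p ^ m)) x = x"
      using conj_iterate[OF g(1) xG \<gamma>y x(1) PG, of "p ^ m"] m xG by simp
    then show ?thesis using it[OF x(1), of "p ^ m"] x(2) by simp
  qed
  then obtain s where s: "s \<in> carrier S" "\<forall>y\<in>?K. ?\<beta> y = s \<otimes> y \<otimes> inv s"
    using large_automorphisms(1)[OF K _ fn \<beta>, of m] c cK by auto
  have "\<chi> (g \<otimes> x \<otimes> inv g) = s \<otimes> \<chi> x \<otimes> inv s" if x: "x \<in> P" for x
    using transport_apply[OF P \<chi> x, of ?\<gamma>] \<gamma>y(1)[OF x] s(2) x by simp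
  then have "g \<in> extension_domain S P \<chi>"
    using mem_extension_domain_iff[OF P \<chi>] g s(1) by blast
  then show ?thesis using g by blast
qed

section \<open>Extension domains of subgroups of order p^d\<close>

text \<open>A nonabelian group is not cyclic, so the powers of \<open>y\<close> form a proper
  subgroup, contained in a maximal one.\<close>

lemma exists_pd_subgroup_of_nonabelian:
  assumes L: "subgroup L S" "card L = p ^ Suc d" and na: "a \<in> L" "b \<in> L" "a \<otimes> b \<noteq> b \<otimes> a" and y: "y \<in> L"
  shows "\<exists>M. subgroup M S \<and> M \<subseteq> L \<and> card M = p ^ d \<and> y \<in> M"
proof -
  have yG: "y \<in> carrier S" using y L subgroup.mem_carrier by metis
  let ?Y = "{y [^] i | i. i \<in> (UNIV::nat set)}"
  have Ys: "subgroup ?Y S" using adjoin_one_pow(2)[OF yG] .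
  have YL: "?Y \<subseteq> L" using subgroup_pow[OF L(1) y] by blast
  have "?Y \<noteq> L"
  proof
    assume "?Y = L"
    then have "a \<in> ?Y" "b \<in> ?Y" using na by auto
    then obtain i j where "a = y [^] (i::nat)" "b = y [^] (j::nat)" by blast
    then have "a \<otimes> b = b \<otimes> a" using yG by (simp add: nat_pow_mult add.commute)
    then show False using na(3) by blast
  qed
  then obtain M where M: "index_p_subgroup S p L M" "?Y \<subseteq> M" using exists_index_p_subgroup[OF Ys L(1)] YL by blast
  have "y = y [^] (1::nat)" using yG by simp
  then have "y \<in> M" using M(2) by blast
  then show ?thesis using M(1) L(2) p_gt_1 by (auto simp: index_p_subgroup_def)
qed

text \<open>For \<open>x \<in> S\<close> outside a self-centralizing \<open>K\<close> of order \<open>p\<^sup>d\<close> with \<open>x\<^sup>p \<in> K\<close>, all maximal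
  subgroups of the nonabelian group \<open>L = K\<langle>x\<rangle>\<close> are abelian and invariant under automorphisms of
  \<open>L\<close>. The former makes conjugation by \<open>x\<close> a transvection of \<open>K\<close>, and the latter, applied to an
  extension of \<open>h\<close> to \<open>L\<close>, makes it rigid.\<close>

lemma conj_transvection:
  assumes K: "subgroup K S" "card K = p ^ d" and cen: "centralizer S K = K"
    and x: "x \<in> carrier S" "x \<notin> K" "x [^] p \<in> K" and fc: "fully_centralized S F K"
  shows "finite_abelian_p_group.transvection (S\<lparr>carrier := K\<rparr>) p (conj_map S K x)"
    and "finite_abelian_p_group.centrally_rigid (S\<lparr>carrier := K\<rparr>) (F K K) (conj_map S K x)"
proof -
  let ?K = "S\<lparr>carrier := K\<rparr>"
  interpret K: finite_abelian_p_group ?K p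
    using finite_p_group_subgroup[OF K(1)] abelian[OF K] by (simp add: finite_abelian_p_group_def)
  have KG: "k \<in> carrier S" if "k \<in> K" for k using that K subgroup.mem_carrier by metis
  let ?t = "conj_map S K x"
  let ?L = "adjoin K x"
  have nx: "normalizes x K" using normalizes_card_pd[OF K x(1)] .
  have L: "subgroup ?L S" "K \<subseteq> ?L" "x \<in> ?L" "card ?L = p ^ Suc d"
    using subgroup_adjoin[OF K(1) x(1) nx] adjoin_incl[OF K(1) x(1) nx] card_adjoin[OF K(1) x(1) nx x(2,3)] K(2) by auto
  have LG: "k \<in> carrier S" if "k \<in> ?L" for k using that L(1) subgroup.mem_carrier by metis
  have kab: "k \<otimes> l = l \<otimes> k" if "k \<in> K" "l \<in> K" for k l using abelianD[OF K that] .
  have cenD: "g \<in> K" if "g \<in> carrier S" "\<And>k. k \<in> K \<Longrightarrow> g \<otimes> k = k \<otimes> g" for g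
    using that cen by (auto simp: centralizer_def)
  obtain c where c: "c \<in> K" "x \<otimes> c \<noteq> c \<otimes> x" using cenD[OF x(1)] x(2) by blast
  have max: "\<exists>M. subgroup M S \<and> M \<subseteq> ?L \<and> card M = p ^ d \<and> y \<in> M" if "y \<in> ?L" for y
    using exists_pd_subgroup_of_nonabelian[OF L(1,4) L(3) _ c(2) that] c(1) L(2) by blast
  have t: "?t k = x \<otimes> k \<otimes> inv x" "?t k \<in> K" if "k \<in> K" for k
    using that normalizes_closed[OF nx that] by (auto simp: conj_map_def)
  have tfix: "?t k = k \<longleftrightarrow> x \<otimes> k = k \<otimes> x" if k: "k \<in> K" for k
  proof
    assume "?t k = k"
    then have "x \<otimes> k \<otimes> inv x \<otimes> x = k \<otimes> x" using t(1)[OF k] by simp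
    then show "x \<otimes> k = k \<otimes> x" using KG[OF k] x(1) by (simp add: m_assoc)
  next
    assume "x \<otimes> k = k \<otimes> x"
    then show "?t k = k" using t(1)[OF k] KG[OF k] x(1) by (simp add: m_assoc)
  qed
  have tF: "?t \<in> F K K" using F_conj_map[OF K(1) K(1) x(1)] t by (metis normalizes_closed nx)
  note tmor = F_morphism[OF K(1) K(1) tF]
  \<comment> \<open>A maximal subgroup of \<open>?L\<close> through \<open>x\<close>: being abelian,
    it makes \<open>K \<inter> M\<close> fixed under \<open>?t\<close>.\<close>
  obtain M where M: "subgroup M S" "M \<subseteq> ?L" "card M = p ^ d" "x \<in> M" using max[OF L(3)] by blast
  have MG: "m \<in> carrier S" if "m \<in> M" for m using that M(1) subgroup.mem_carrier by metis
  have MK: "x \<otimes> k = k \<otimes> x" if "k \<in> M" for k using abelianD[OF M(1,3,4) that] .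
  have iM: "card ?L = p * card M" using L(4) M(3) by simp
  have "\<not> K \<subseteq> M"
  proof
    assume "K \<subseteq> M"
    then have "K = M" using subgroup_eqI_card[OF M(1)] K(2) M(3) by simp
    then show False using M(4) x(2) by simp
  qed
  then obtain k0 where k0: "k0 \<in> K" "k0 \<notin> M" by blast
  have k0L: "k0 \<in> ?L" and k0G: "k0 \<in> carrier S" using k0 L(2) KG by auto
  \<comment> \<open>\<open>K\<close> is generated by \<open>K \<inter> M\<close> and
    \<open>k0\<close>, so this single commutator is the direction of the transvection.\<close>
  define a where "a = inv k0 \<otimes> ?t k0"
  have aK: "a \<in> K" unfolding a_def using k0 t K(1) by (meson subgroup.m_closed subgroup.m_inv_closed)
  have aG: "a \<in> carrier S" using aK KG by blast
  have tk0: "?t k0 = k0 \<otimes> a" unfolding a_def using k0G KG[OF t(2)[OF k0(1)]] by (simp add: mult_inv_cancel)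
  have aM: "a \<in> M"
  proof -
    have "normalizes (inv k0) M" using normalizes_card_pd[OF M(1,3)] k0G by simp
    then have "inv k0 \<otimes> x \<otimes> inv (inv k0) \<in> M" using normalizes_closed M(4) by blast
    then have "(inv k0 \<otimes> x \<otimes> inv (inv k0)) \<otimes> inv x \<in> M" using M(1,4) by (meson subgroup.m_closed subgroup.m_inv_closed)
    then show ?thesis unfolding a_def t(1)[OF k0(1)] using k0G x(1) by (simp add: m_assoc)
  qed
  have ta: "?t a = a" using tfix[OF aK] MK[OF aM] by blast
  have tpow: "?t (k0 [^] i) = k0 [^] i \<otimes> a [^] i" for i :: nat
  proof -
    have "?t (k0 [^] i) = (k0 \<otimes> a) [^] i" using F_pow[OF K(1) K(1) tF k0(1)] tk0 by simp
    then show ?thesis using pow_mult_distrib[OF kab[OF k0(1) aK] k0G aG] by simp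
  qed
  have ap: "a [^] p = \<one>"
  proof -
    have "k0 [^] p \<in> M" using index_p_power[OF M(1) L(1) M(2) iM k0L] .
    moreover have k0p: "k0 [^] p \<in> K" using subgroup_pow[OF K(1) k0(1)] .
    ultimately have "?t (k0 [^] p) = k0 [^] p" using tfix MK by blast
    then have "k0 [^] p = k0 [^] p \<otimes> a [^] p" using tpow[of p] by simp
    then show ?thesis by (rule mult_right_eq_oneD) (use k0G aG in auto)
  qed
  have form: "\<exists>i::nat. ?t k = k \<otimes> a [^] i" if k: "k \<in> K" for k
  proof -
    obtain m i where m: "m \<in> M" "k = m \<otimes> k0 [^] (i::nat)"
      using index_p_decomp[OF M(1) L(1) M(2) iM k0L k0(2)] k L(2) by blast
    have "m = k \<otimes> inv (k0 [^] i)" using MG[OF m(1)] k0G by (subst m(2)) (simp add: m_assoc)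
    then have mK: "m \<in> K" using k subgroup_pow[OF K(1) k0(1)] K(1) by (simp add: subgroup.m_closed subgroup.m_inv_closed)
    have "?t k = ?t m \<otimes> ?t (k0 [^] i)" unfolding m(2) by (rule tmor(1)[OF mK subgroup_pow[OF K(1) k0(1)]])
    also have "?t m = m" using tfix[OF mK] MK[OF m(1)] by blast
    also have "m \<otimes> ?t (k0 [^] i) = k \<otimes> a [^] i" unfolding tpow m(2) using MG[OF m(1)] k0G aG by (simp add: m_assoc)
    finally show ?thesis by blast
  qed
  show "K.transvection ?t"
    unfolding K.transvection_def
  proof (intro conjI)
    show "\<exists>k\<in>carrier ?K. ?t k \<noteq> k" using tfix[OF c(1)] c by auto
    show "\<exists>a\<in>carrier ?K. a [^]\<^bsub>?K\<^esub> p = \<one>\<^bsub>?K\<^esub> \<and> ?t a = a \<and> (\<forall>k\<in>carrier ?K. \<exists>i::nat. ?t k = k \<otimes>\<^bsub>?K\<^esub> a [^]\<^bsub>?K\<^esub> i)"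
      using aK ap ta form by (intro bexI[of _ a]) (auto simp: nat_pow_consistent[symmetric])
  qed
  show "K.centrally_rigid (F K K) ?t"
    unfolding K.centrally_rigid_def
  proof (intro ballI impI)
    fix h k assume h: "h \<in> F K K" and com: "\<forall>k\<in>carrier ?K. h (?t k) = ?t (h k)" and kc: "k \<in> carrier ?K"
    have k: "k \<in> K" using kc by simp
    note hmor = F_morphism[OF K(1) K(1) h]
    have himg: "h ` K = K" using F_auto_image[OF K(1) h] .
    have hS: "h \<in> F K (carrier S)"
      using F_change_target[OF K(1) K(1) h subgroup_self] himg KG by blast
    let ?N = "extension_domain S K h"
    have Ns: "subgroup ?N S" "K \<subseteq> ?N" using subgroup_extension_domain[OF K(1) hS] extension_domain_incl[OF K(1) hS] by auto
    \<comment> \<open>Since \<open>h\<close> commutes with conjugation by \<open>x\<close>, its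
      extension domain contains \<open>x\<close>, hence \<open>?L\<close>; this brings
      \<open>h\<close> under the invariance of the maximal subgroups of \<open>?L\<close>.\<close>
    obtain \<psi> where \<psi>: "\<psi> \<in> F ?N (carrier S)" "\<forall>k\<in>K. \<psi> k = h k"
      using extension[OF K(1) hS] fc himg by auto
    have comh: "h (x \<otimes> l \<otimes> inv x) = x \<otimes> h l \<otimes> inv x" if l: "l \<in> K" for l
    proof -
      have "h (?t l) = ?t (h l)" using com l by simp
      then show ?thesis by (simp only: t(1)[OF l] t(1)[OF hmor(2)[OF l]])
    qed
    have xN: "x \<in> ?N" using mem_extension_domain_iff[OF K(1) hS] x(1) nx comh by blast
    have LN: "?L \<subseteq> ?N" using adjoin_least[OF Ns(1,2) xN] .
    note \<psi>mor = F_morphism[OF Ns(1) subgroup_self \<psi>(1)]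
    let ?y = "\<psi> x"
    have yG: "?y \<in> carrier S" using \<psi>mor(2)[OF xN] .
    define q where "q = inv x \<otimes> ?y"
    have qG: "q \<in> carrier S" unfolding q_def using x yG by simp
    have yq: "?y = x \<otimes> q" unfolding q_def using x yG by (simp add: mult_inv_cancel)
    \<comment> \<open>\<open>?y\<close> and \<open>x\<close> induce the same conjugation on
      \<open>K\<close>, so \<open>q\<close> centralizes \<open>K\<close>, which is its own
      centralizer.\<close>
    have qK: "q \<in> K"
    proof (rule cenD[OF qG])
      fix l' assume "l' \<in> K"
      then obtain l where l: "l \<in> K" "l' = h l" using himg by blast
      have lN: "l \<in> ?N" using l Ns(2) by blast
      have "\<psi> (x \<otimes> l \<otimes> inv x) = ?y \<otimes> h l \<otimes> inv ?y"
        using \<psi>mor(1)[OF subgroup.m_closed[OF Ns(1) xN lN] subgroup.m_inv_closed[OF Ns(1) xN]] \<psi>mor(1)[OF xN lN]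
          F_inv[OF Ns(1) subgroup_self \<psi>(1) xN] \<psi>(2) l by simp
      moreover have "\<psi> (x \<otimes> l \<otimes> inv x) = h (x \<otimes> l \<otimes> inv x)" using \<psi>(2) t[OF l(1)] by simp
      ultimately have e: "?y \<otimes> l' \<otimes> inv ?y = x \<otimes> l' \<otimes> inv x" using comh[OF l(1)] l(2) by simp
      have l'G: "l' \<in> carrier S" using KG[OF \<open>l' \<in> K\<close>] .
      have "?y \<otimes> l' = ?y \<otimes> l' \<otimes> inv ?y \<otimes> ?y" using yG l'G by (simp add: m_assoc)
      also have "\<dots> = x \<otimes> (l' \<otimes> (inv x \<otimes> ?y))" using e yG l'G x(1) by (simp add: m_assoc)
      finally have "inv x \<otimes> (?y \<otimes> l') = l' \<otimes> q" unfolding q_def using yG l'G x(1) by (simp add: mult_inv_cancel)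
      then show "q \<otimes> l' = l' \<otimes> q" unfolding q_def using yG l'G x(1) by (simp add: m_assoc)
    qed
    have yL: "?y \<in> ?L" unfolding yq using subgroup.m_closed[OF L(1,3)] L(2) qK by blast
    let ?\<psi> = "restrict \<psi> ?L"
    have "?\<psi> \<in> F ?L (carrier S)" using F_restrict[OF Ns(1) subgroup_self \<psi>(1) L(1) LN] .
    moreover have "?\<psi> ` ?L \<subseteq> ?L"
    proof
      fix w assume "w \<in> ?\<psi> ` ?L"
      then obtain l where l: "l \<in> ?L" "w = \<psi> l" by auto
      then obtain m i where m: "m \<in> K" "l = m \<otimes> x [^] (i::nat)" by (auto simp: adjoin_def)
      have "\<psi> l = h m \<otimes> ?y [^] i"
        unfolding m(2) using \<psi>mor(1)[of m "x [^] i"] m(1) Ns subgroup_pow[OF Ns(1) xN] F_pow[OF Ns(1) subgroup_self \<psi>(1) xN] \<psi>(2) by auto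
      moreover have "h m \<in> ?L" using hmor(2)[OF m(1)] L(2) by blast
      ultimately show "w \<in> ?L" using l(2) subgroup_pow[OF L(1) yL] subgroup.m_closed[OF L(1)] by simp
    qed
    ultimately have \<psi>L: "?\<psi> \<in> F ?L ?L" using F_change_target[OF L(1) subgroup_self _ L(1)] by blast
    have inv\<psi>: "\<psi> y \<in> M'" if M': "subgroup M' S" "M' \<subseteq> ?L" "card M' = p ^ d" "y \<in> M'" for M' y
    proof -
      have "?\<psi> ` M' = M'" using semi_invD[OF M'(1,3) L(1) M'(2) \<psi>L] .
      then have "?\<psi> y \<in> M'" using M'(4) by blast
      then show ?thesis using M'(2,4) by auto
    qed
    have "x \<otimes> q \<in> M" using inv\<psi>[OF M] yq by simp
    then have "inv x \<otimes> (x \<otimes> q) \<in> M" using M(1,4) by (meson subgroup.m_closed subgroup.m_inv_closed)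
    then have qM: "q \<in> M" using x(1) qG by (simp add: mult_inv_cancel)
    have kG: "k \<in> carrier S" and hkK: "h k \<in> K" and hkG: "h k \<in> carrier S" using KG[OF k] hmor(2)[OF k] KG by auto
    have xkL: "x \<otimes> k \<in> ?L" using subgroup.m_closed[OF L(1,3)] L(2) k by blast
    \<comment> \<open>A second maximal subgroup, through \<open>x \<otimes> k\<close>. Invariance
      puts \<open>q \<otimes> ?e\<close> into \<open>M2\<close>; commutativity of \<open>M2\<close>
      and of \<open>K\<close> then makes it commute with \<open>x\<close>. As \<open>q\<close> does
      too, so does \<open>?e\<close>.\<close>
    obtain M2 where M2: "subgroup M2 S" "M2 \<subseteq> ?L" "card M2 = p ^ d" "x \<otimes> k \<in> M2" using max[OF xkL] by blast
    have "\<psi> (x \<otimes> k) = (x \<otimes> q) \<otimes> h k" using \<psi>mor(1)[OF xN] Ns(2) k \<psi>(2) yq by auto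
    then have "(x \<otimes> q) \<otimes> h k \<in> M2" using inv\<psi>[OF M2] by simp
    then have w: "inv (x \<otimes> k) \<otimes> ((x \<otimes> q) \<otimes> h k) \<in> M2" using M2(1,4) by (meson subgroup.m_closed subgroup.m_inv_closed)
    let ?e = "inv k \<otimes> h k"
    have eK: "?e \<in> K" using k hkK K(1) by (meson subgroup.m_closed subgroup.m_inv_closed)
    have eG: "?e \<in> carrier S" using eK KG by blast
    have "inv (x \<otimes> k) \<otimes> ((x \<otimes> q) \<otimes> h k) = (inv k \<otimes> q) \<otimes> h k"
      using x(1) kG qG hkG by (simp add: group_word_simps)
    also have "inv k \<otimes> q = q \<otimes> inv k" using kab qK k K(1) subgroup.m_inv_closed by metis
    also have "(q \<otimes> inv k) \<otimes> h k = q \<otimes> ?e" using kG qG hkG by (simp add: m_assoc)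
    finally have qe: "q \<otimes> ?e \<in> M2" using w by simp
    have qeK: "q \<otimes> ?e \<in> K" using qK eK K(1) subgroup.m_closed by metis
    have "(x \<otimes> k) \<otimes> (q \<otimes> ?e) = (q \<otimes> ?e) \<otimes> (x \<otimes> k)" using abelianD[OF M2(1,3,4) qe] .
    moreover have "(x \<otimes> k) \<otimes> (q \<otimes> ?e) = x \<otimes> (q \<otimes> ?e) \<otimes> k"
    proof -
      have "(x \<otimes> k) \<otimes> (q \<otimes> ?e) = x \<otimes> (k \<otimes> (q \<otimes> ?e))" using x(1) kG qG eG by (intro m_assoc) auto
      also have "k \<otimes> (q \<otimes> ?e) = (q \<otimes> ?e) \<otimes> k" using kab[OF k qeK] .
      also have "x \<otimes> ((q \<otimes> ?e) \<otimes> k) = x \<otimes> (q \<otimes> ?e) \<otimes> k" using x(1) kG qG eG by (intro m_assoc[symmetric]) auto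
      finally show ?thesis .
    qed
    moreover have "(q \<otimes> ?e) \<otimes> (x \<otimes> k) = (q \<otimes> ?e) \<otimes> x \<otimes> k" using x(1) kG qG eG by (intro m_assoc[symmetric]) auto
    ultimately have "x \<otimes> (q \<otimes> ?e) \<otimes> k = (q \<otimes> ?e) \<otimes> x \<otimes> k" by simp
    then have "x \<otimes> (q \<otimes> ?e) = (q \<otimes> ?e) \<otimes> x"
      by (rule r_cancel) (use x(1) kG qG eG in auto)
    then have "?t (q \<otimes> ?e) = q \<otimes> ?e" using tfix[OF qeK] by blast
    moreover have "?t (q \<otimes> ?e) = q \<otimes> ?t ?e" using tmor(1)[OF qK eK] tfix[OF qK] MK[OF qM] by simp
    ultimately have "q \<otimes> ?t ?e = q \<otimes> ?e" by simp
    then have "?t ?e = ?e" using l_cancel qG eG KG[OF t(2)[OF eK]] by blast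
    moreover have "?e = h k \<otimes>\<^bsub>?K\<^esub> inv\<^bsub>?K\<^esub> k"
      using kab[OF subgroup.m_inv_closed[OF K(1) k] hkK] m_inv_consistent[OF K(1) k] by simp
    ultimately show "h k \<otimes>\<^bsub>?K\<^esub> inv\<^bsub>?K\<^esub> k \<in> K.fixed_points ?t"
      using eK by (simp add: K.fixed_points_def)
  qed
qed

text \<open>All subgroups of order \<open>p^d\<close> are normal in \<open>S\<close>, so their
  normalizers have the same order.\<close>

lemma pd_fully_normalized:
  assumes H: "subgroup H S" "card H = p ^ d"
  shows "fully_normalized S F H"
proof -
  have "normalizer S Q = carrier S" if "subgroup Q S" "card Q = p ^ d" for Q
    using mem_normalizer_iff[OF that(1)] normalizes_card_pd[OF that] by blast
  then have "card (normalizer S Q) \<le> card (normalizer S H)" if "fusion_conjugate S F H Q" for Q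
    using fusion_conjugateD(2,3)[OF that] H by simp
  then show ?thesis using H by (simp add: fully_normalized_def)
qed

text \<open>An element centralizing \<open>P\<close> from outside \<open>P\<close> lies in every
  extension domain. If there is none, the image is self-centralizing, any \<open>x\<close> of order
  \<open>p\<close> modulo it gives a rigid transvection, and the resulting normal
  \<open>p\<close>-subgroup supplies the required conjugation.\<close>

lemma middle_extension_domain:
  assumes P: "subgroup P S" and \<chi>: "\<chi> \<in> F P (carrier S)" and c: "card P = p ^ d"
  shows "\<exists>g\<in>extension_domain S P \<chi>. g \<notin> P"
proof (cases "centralizer S P \<subseteq> P")
  case False
  then obtain g where g: "g \<in> carrier S" "\<And>x. x \<in> P \<Longrightarrow> g \<otimes> x = x \<otimes> g" "g \<notin> P" by (auto simp: centralizer_def)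
  have fxd: "g \<otimes> x \<otimes> inv g = x" if x: "x \<in> P" for x
    using g(2)[OF x] g(1) subgroup.mem_carrier[OF P x] by (simp add: m_assoc)
  have "\<chi> (g \<otimes> x \<otimes> inv g) = \<one> \<otimes> \<chi> x \<otimes> inv \<one>" if x: "x \<in> P" for x
    using fxd[OF x] F_morphism(2)[OF P subgroup_self \<chi> x] by simp
  moreover have "normalizes g P" using fxd by (simp add: normalizes_def)
  ultimately have "g \<in> extension_domain S P \<chi>"
    using mem_extension_domain_iff[OF P \<chi>] g one_closed by blast
  then show ?thesis using g by blast
next
  case True
  let ?K = "\<chi> ` P"
  have K: "subgroup ?K S" using F_image_subgroup[OF P subgroup_self \<chi>] .
  have cK: "card ?K = p ^ d" using card_image[OF F_morphism(3)[OF P subgroup_self \<chi>]] c by simp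
  have fn: "fully_normalized S F P" "fully_normalized S F ?K" using pd_fully_normalized P c K cK by auto
  have fc: "fully_centralized S F P" "fully_centralized S F ?K" using fully_normalized_imp fn by auto
  \<comment> \<open>\<open>P\<close> is fully centralized, so the centralizer of its conjugate
    \<open>?K\<close> is no larger than that of \<open>P\<close>, which is at most
    \<open>P\<close>.\<close>
  have cenK: "centralizer S ?K = ?K"
  proof -
    have sub: "?K \<subseteq> centralizer S ?K"
      using abelianD[OF K cK] subgroup.mem_carrier[OF K] by (auto simp: centralizer_def)
    have "card (centralizer S ?K) \<le> card (centralizer S P)"
      using fc(1) fusion_conjugateI[OF P \<chi>] by (simp add: fully_centralized_def)
    also have "\<dots> \<le> card P" using card_mono[OF finite_subgroup[OF P] True] .
    finally have le: "card (centralizer S ?K) \<le> card ?K" using c cK by simp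
    have "finite (centralizer S ?K)" using finite_carrier by (auto simp: centralizer_def)
    then show ?thesis using card_seteq[OF _ sub le] by simp
  qed
  have "?K \<noteq> carrier S" using cK d_lt by (auto simp: order_def)
  then obtain y where y: "y \<in> carrier S" "y \<notin> ?K" using subgroup.subset[OF K] by blast
  obtain j where j: "y [^] (p ^ j) \<notin> ?K" "(y [^] (p ^ j)) [^] p \<in> ?K" using last_power_outside[OF K y] by blast
  let ?x = "y [^] (p ^ j)"
  have xG: "?x \<in> carrier S" using y by simp
  let ?G = "S\<lparr>carrier := ?K\<rparr>" and ?t = "conj_map S ?K ?x"
  interpret K: finite_abelian_p_group ?G p
    using finite_p_group_subgroup[OF K] abelian[OF K cK] by (simp add: finite_abelian_p_group_def)
  note tr = conj_transvection[OF K cK cenK xG j fc(2)]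
  have tF: "?t \<in> F ?K ?K"
    using F_conj_map[OF K K xG] normalizes_closed[OF normalizes_card_pd[OF K cK xG]] by blast
  let ?A = "aut_group F ?K"
  have "\<exists>N. subgroup N (BijGroup (carrier ?G)) \<and> N \<subseteq> F ?K ?K \<and> (\<exists>k. card N = p ^ k) \<and>
    (\<forall>\<alpha>\<in>F ?K ?K. \<forall>\<nu>\<in>N. inv\<^bsub>BijGroup (carrier ?G)\<^esub> \<alpha> \<otimes>\<^bsub>BijGroup (carrier ?G)\<^esub> \<nu> \<otimes>\<^bsub>BijGroup (carrier ?G)\<^esub> \<alpha> \<in> N) \<and>
    (\<exists>\<nu>\<in>N. \<exists>k\<in>carrier ?G. \<nu> k \<noteq> k)"
    by (rule K.normal_p_subgroup_of_rigid_transvection[OF odd_p _ F_auto_hom[OF K] tF tr])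
      (use F_auto_subgroup[OF K] in simp)
  then obtain N where NN: "subgroup N (BijGroup (carrier ?G)) \<and> N \<subseteq> F ?K ?K \<and> (\<exists>k. card N = p ^ k) \<and>
    (\<forall>\<alpha>\<in>F ?K ?K. \<forall>\<nu>\<in>N. inv\<^bsub>BijGroup (carrier ?G)\<^esub> \<alpha> \<otimes>\<^bsub>BijGroup (carrier ?G)\<^esub> \<nu> \<otimes>\<^bsub>BijGroup (carrier ?G)\<^esub> \<alpha> \<in> N) \<and>
    (\<exists>\<nu>\<in>N. \<exists>k\<in>carrier ?G. \<nu> k \<noteq> k)" by (rule exE)
  note N0 = NN[THEN conjunct1] NN[THEN conjunct2, THEN conjunct1] NN[THEN conjunct2, THEN conjunct2, THEN conjunct1]
    NN[THEN conjunct2, THEN conjunct2, THEN conjunct2, THEN conjunct1]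
    NN[THEN conjunct2, THEN conjunct2, THEN conjunct2, THEN conjunct2]
  have cG: "carrier ?G = ?K" by simp
  note N0 = N0[unfolded cG]
  obtain k where k: "card N = p ^ k" using N0(3) by blast
  note N = N0(1,2) k
  have Nn: "inv\<^bsub>BijGroup ?K\<^esub> \<alpha> \<otimes>\<^bsub>BijGroup ?K\<^esub> \<nu> \<otimes>\<^bsub>BijGroup ?K\<^esub> \<alpha> \<in> N"
    if "\<alpha> \<in> F ?K ?K" "\<nu> \<in> N" for \<alpha> \<nu> using N0(4) that by blast
  note Nt = N0(5)
  interpret A: group ?A by (rule group_aut_group[OF K])
  have NA: "subgroup N ?A"
    unfolding aut_group_def using group.subgroup_incl[OF group_BijGroup N(1) F_auto_subgroup[OF K] N(2)] .
  have finA: "finite (carrier ?A)" using finite_F_auto[OF K] by (simp add: aut_group_simps(1))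
  have nrm: "inv\<^bsub>?A\<^esub> \<alpha> \<otimes>\<^bsub>?A\<^esub> \<nu> \<otimes>\<^bsub>?A\<^esub> \<alpha> \<in> N" if "\<alpha> \<in> carrier ?A" "\<nu> \<in> N" for \<alpha> \<nu>
  proof -
    have \<alpha>: "\<alpha> \<in> F ?K ?K" using that(1) by (simp add: aut_group_simps(1))
    have "inv\<^bsub>?A\<^esub> \<alpha> = inv\<^bsub>BijGroup ?K\<^esub> \<alpha>"
      unfolding aut_group_def using group.m_inv_consistent[OF group_BijGroup F_auto_subgroup[OF K] \<alpha>] .
    then show ?thesis using Nn[OF \<alpha> that(2)] by (simp add: aut_group_def)
  qed
  have le: "N \<subseteq> T" if "sylow_subgroup p T ?A" for T
    by (rule A.normal_p_subgroup_le_sylow[OF prime_p finA that NA N(3) nrm])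
  obtain \<nu> where \<nu>: "\<nu> \<in> N" "\<exists>k\<in>?K. \<nu> k \<noteq> k" using Nt by blast
  have "\<nu> \<in> conj_homs S ?K ?K" using le[OF sylow_conj_homs[OF fn(2)]] \<nu> by blast
  then obtain s where s: "s \<in> carrier S" "\<forall>y\<in>?K. \<nu> y = s \<otimes> y \<otimes> inv s" unfolding conj_homs_iff by blast
  \<comment> \<open>A second Sylow subgroup of the automizer of \<open>?K\<close>. The normal
    \<open>p\<close>-subgroup lies in both, so \<open>\<nu>\<close> is a conjugation on
    \<open>?K\<close> and is also transported from a conjugation on \<open>P\<close>.\<close>
  let ?T = "transport P \<chi> ` conj_homs S P P"
  have iso: "transport P \<chi> \<in> iso (aut_group F P) ?A" by (rule transport_iso[OF P \<chi>])
  have "sylow_subgroup p ?T ?A"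
  proof -
    have T0: "subgroup (conj_homs S P P) (aut_group F P)"
      "card (conj_homs S P P) = p ^ multiplicity p (order (aut_group F P))"
      using sylow_conj_homs[OF fn(1)] by (auto simp: sylow_subgroup_def)
    have "inj_on (transport P \<chi>) (conj_homs S P P)"
      using iso subgroup.subset[OF T0(1)] by (auto simp: iso_def bij_betw_def intro: inj_on_subset)
    then have "card ?T = p ^ multiplicity p (order ?A)"
      using card_image T0(2) iso_same_order[OF iso] by metis
    moreover have "subgroup ?T ?A"
      using subgroup.iso_subgroup[OF T0(1) group_aut_group[OF P] A.is_group iso] .
    ultimately show ?thesis by (simp add: sylow_subgroup_def)
  qed
  then have "\<nu> \<in> ?T" using le \<nu>(1) by blast
  then obtain \<gamma> where \<gamma>: "\<gamma> \<in> conj_homs S P P" "\<nu> = transport P \<chi> \<gamma>" by blast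
  then obtain g where g: "g \<in> carrier S" "\<And>x. x \<in> P \<Longrightarrow> \<gamma> x = g \<otimes> x \<otimes> inv g" "\<And>x. x \<in> P \<Longrightarrow> \<gamma> x \<in> P"
    unfolding conj_homs_iff by blast
  have \<nu>\<chi>: "\<nu> (\<chi> x) = \<chi> (g \<otimes> x \<otimes> inv g)" if x: "x \<in> P" for x
    using transport_apply[OF P \<chi> x, of \<gamma>] \<gamma>(2) g(2)[OF x] by simp
  \<comment> \<open>\<open>P\<close> is abelian, so its own elements would induce the identity, and
    \<open>\<nu>\<close> is not the identity.\<close>
  have "g \<notin> P"
  proof
    assume gP: "g \<in> P"
    have "\<nu> (\<chi> x) = \<chi> x" if x: "x \<in> P" for x
    proof -
      have "g \<otimes> x \<otimes> inv g = x"
        using abelianD[OF P c gP x] g(1) subgroup.mem_carrier[OF P x] by (simp add: m_assoc)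
      then show ?thesis using \<nu>\<chi>[OF x] by simp
    qed
    then show False using \<nu>(2) by blast
  qed
  moreover have "\<chi> (g \<otimes> x \<otimes> inv g) = s \<otimes> \<chi> x \<otimes> inv s" if x: "x \<in> P" for x
    using \<nu>\<chi>[OF x] s(2) x by simp
  moreover have "normalizes g P" using g(2,3) by (auto simp: normalizes_def)
  ultimately have "g \<in> extension_domain S P \<chi>"
    using mem_extension_domain_iff[OF P \<chi>] g(1) s(1) by blast
  then show ?thesis using \<open>g \<notin> P\<close> by blast
qed

section \<open>Extension to S and the supersolvable series\<close>

text \<open>Choose \<open>\<chi>\<close> on the image of \<open>P\<close> with fully normalized
  image. Both \<open>\<chi>\<close> and \<open>\<chi> \<phi>\<close> extend to a larger domain by
  saturation and then to \<open>S\<close> by induction; the inverse of the first extension after the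
  second extends \<open>\<phi>\<close>.\<close>

lemma extends_to_S:
  assumes "subgroup P S" "\<phi> \<in> F P (carrier S)"
  shows "\<exists>\<alpha>\<in>F (carrier S) (carrier S). \<forall>x\<in>P. \<alpha> x = \<phi> x"
  using assms
proof (induction "card (carrier S) - card P" arbitrary: P \<phi> rule: less_induct)
  case less
  note P = less.prems(1) and \<phi> = less.prems(2)
  show ?case
  proof (cases "P = carrier S")
    case True
    then show ?thesis using \<phi> by blast
  next
    case False
    then have ltP: "card P < card (carrier S)"
      using subgroup.subset[OF P] finite_carrier by (metis psubsetI psubset_card_mono)
    \<comment> \<open>Stated for every \<open>R\<close> of the order of \<open>P\<close>, since it
      is applied both to \<open>P\<close> and to its image.\<close>
    have step: "\<exists>\<alpha>\<in>F (carrier S) (carrier S). \<forall>x\<in>R. \<alpha> x = \<chi> x"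
      if R: "subgroup R S" "card R = card P" and \<chi>: "\<chi> \<in> F R (carrier S)" and fn: "fully_normalized S F (\<chi> ` R)" for R \<chi>
    proof -
      have "R \<noteq> carrier S" using R ltP by auto
      then obtain g where g: "g \<in> extension_domain S R \<chi>" "g \<notin> R"
        using small_extension_domain[OF R(1) \<chi>] middle_extension_domain[OF R(1) \<chi>] large_extension_domain[OF R(1) \<chi> _ _ fn]
        by (metis linorder_neqE_nat)
      let ?N = "extension_domain S R \<chi>"
      have N: "subgroup ?N S" "R \<subseteq> ?N" using subgroup_extension_domain[OF R(1) \<chi>] extension_domain_incl[OF R(1) \<chi>] by auto
      have "R \<subset> ?N" using N(2) g by blast
      then have "card P < card ?N" using psubset_card_mono[OF finite_subgroup[OF N(1)]] R(2) by metis
      then have "card (carrier S) - card ?N < card (carrier S) - card P" using ltP by simp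
      moreover obtain \<psi> where \<psi>: "\<psi> \<in> F ?N (carrier S)" "\<forall>x\<in>R. \<psi> x = \<chi> x"
        using extension[OF R(1) \<chi>] fully_normalized_imp[OF fn] by blast
      ultimately obtain \<alpha> where "\<alpha> \<in> F (carrier S) (carrier S)" "\<forall>x\<in>?N. \<alpha> x = \<psi> x"
        using less.hyps[OF _ N(1) \<psi>(1)] by blast
      then show ?thesis using \<psi>(2) N(2) by (intro bexI[of _ \<alpha>]) auto
    qed
    let ?R = "\<phi> ` P"
    have R: "subgroup ?R S" using F_image_subgroup[OF P subgroup_self \<phi>] .
    have cR: "card ?R = card P" using card_image[OF F_morphism(3)[OF P subgroup_self \<phi>]] .
    obtain \<chi> where \<chi>: "\<chi> \<in> F ?R (carrier S)" "fully_normalized S F (\<chi> ` ?R)" using exists_fully_normalized[OF R] by blast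
    have \<phi>R: "\<phi> \<in> F P ?R" using iso_onto_image[OF P subgroup_self \<phi>] by blast
    obtain \<eta> where \<eta>: "\<eta> \<in> F P (carrier S)" "\<forall>x\<in>P. \<eta> x = \<chi> (\<phi> x)" using F_compose[OF P R subgroup_self \<phi>R \<chi>(1)] by blast
    have \<eta>P: "\<eta> ` P = \<chi> ` ?R" using \<eta>(2) by force
    obtain \<alpha> where \<alpha>: "\<alpha> \<in> F (carrier S) (carrier S)" "\<forall>y\<in>?R. \<alpha> y = \<chi> y" using step[OF R cR \<chi>] by blast
    have "fully_normalized S F (\<eta> ` P)" using \<chi>(2) \<eta>P by simp
    then obtain \<beta> where \<beta>: "\<beta> \<in> F (carrier S) (carrier S)" "\<forall>x\<in>P. \<beta> x = \<eta> x" using step[OF P refl \<eta>(1)] by blast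
    obtain \<alpha>' where \<alpha>': "\<alpha>' \<in> F (carrier S) (carrier S)" "\<forall>x\<in>carrier S. \<alpha>' (\<alpha> x) = x"
      using F_inverse[OF subgroup_self subgroup_self \<alpha>(1)] F_auto_image[OF subgroup_self \<alpha>(1)] by auto
    obtain \<gamma> where \<gamma>: "\<gamma> \<in> F (carrier S) (carrier S)" "\<forall>x\<in>carrier S. \<gamma> x = \<alpha>' (\<beta> x)"
      using F_compose[OF subgroup_self subgroup_self subgroup_self \<beta>(1) \<alpha>'(1)] by blast
    have "\<gamma> x = \<phi> x" if x: "x \<in> P" for x
    proof -
      have xG: "x \<in> carrier S" using x subgroup.mem_carrier[OF P] by blast
      have "\<beta> x = \<alpha> (\<phi> x)" using \<beta>(2) \<eta>(2) \<alpha>(2) x by simp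
      then show ?thesis using \<gamma>(2) \<alpha>'(2) xG F_morphism(2)[OF P subgroup_self \<phi> x] by simp
    qed
    then show ?thesis using \<gamma>(1) by blast
  qed
qed

text \<open>Every morphism is a restriction of an automorphism of \<open>S\<close>, so invariance
  under these controls all morphisms.\<close>

lemma strongly_closed_of_invariant:
  assumes T: "subgroup T S" "preserves (F (carrier S) (carrier S)) T"
  shows "strongly_closed S F T"
  unfolding strongly_closed_def
proof (intro conjI allI impI ballI)
  show "subgroup T S" by fact
  fix P \<phi> assume P: "subgroup P S \<and> P \<subseteq> T" and \<phi>: "\<phi> \<in> F P (carrier S)"
  obtain \<alpha> where \<alpha>: "\<alpha> \<in> F (carrier S) (carrier S)" "\<forall>x\<in>P. \<alpha> x = \<phi> x" using extends_to_S P \<phi> by blast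
  have "\<phi> ` P = \<alpha> ` P" using \<alpha>(2) by force
  also have "\<dots> \<subseteq> T" using T(2) \<alpha>(1) P by (auto simp: preserves_def)
  finally show "\<phi> ` P \<subseteq> T" .
qed

text \<open>\<open>S\<close> is its own only conjugate and so fully normalized; with
  \<open>p^d < |S|\<close> the results on large subgroups describe \<open>Aut_F(S)\<close> modulo
  conjugations, as the invariant series requires.\<close>

lemma supersolvable_fusion: "supersolvable S F"
proof -
  let ?A = "F (carrier S) (carrier S)"
  have fn: "fully_normalized S F (carrier S)"
    unfolding fully_normalized_def
  proof (intro conjI allI impI)
    show "subgroup (carrier S) S" by (rule subgroup_self)
    fix Q assume Q: "fusion_conjugate S F (carrier S) Q"
    have "card Q = card (carrier S)" "Q \<subseteq> carrier S" using fusion_conjugateD(2,3)[OF Q] subgroup.subset by blast+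
    then have "Q = carrier S" using card_subset_eq[OF finite_carrier] by blast
    then show "card (normalizer S Q) \<le> card (normalizer S (carrier S))" by simp
  qed
  note auts = large_automorphisms[OF subgroup_self d_lt[unfolded order_def] fn]
  have hom: "?A \<subseteq> hom S S" using F_auto_hom[OF subgroup_self] by simp
  have inner: "\<exists>\<alpha>\<in>?A. \<forall>x\<in>carrier S. \<alpha> x = g \<otimes> x \<otimes> inv g" if "g \<in> carrier S" for g
    using F_conj_map[OF subgroup_self subgroup_self that] that
    by (intro bexI[of _ "conj_map S (carrier S) g"]) (auto simp: conj_map_def)
  have "\<exists>n T. T (0::nat) = {\<one>} \<and> T n = carrier S \<and> (\<forall>i\<le>n. subgroup (T i) S \<and> preserves ?A (T i)) \<and>
    (\<forall>i<n. T i \<subseteq> T (Suc i) \<and> cyclic_group (S\<lparr>carrier := T (Suc i)\<rparr> Mod T i))"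
    by (rule invariant_series[OF hom F_morphism(3)[OF subgroup_self subgroup_self] inner auts(2)])
      (use auts(3) in blast)+
  then show ?thesis
    unfolding supersolvable_def using strongly_closed_of_invariant by blast
qed

end

theorem theorem4p4:
  fixes S :: "('a, 'b) monoid_scheme" and p :: nat
    and F :: "'a set \<Rightarrow> 'a set \<Rightarrow> ('a \<Rightarrow> 'a) set"
  assumes "Factorial_Ring.prime p" and "odd p"
    and "saturated_fusion_system S p F"
    and "\<exists>D. subgroup D S \<and> 1 < card D \<and> card D < order S \<and>
           (\<forall>H. subgroup H S \<and> card H = card D \<longrightarrow>
              comm_group (S\<lparr>carrier := H\<rparr>) \<and> semi_invariant S F H)"
  shows "supersolvable S F"
proof -
  interpret saturated_fusion_system S p F by fact
  obtain D where D: "subgroup D S" "1 < card D" "card D < order S"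
    "\<And>H. subgroup H S \<Longrightarrow> card H = card D \<Longrightarrow> comm_group (S\<lparr>carrier := H\<rparr>) \<and> semi_invariant S F H"
    using assms(4) by blast
  obtain d where d: "card D = p ^ d" using card_subgroup_power[OF D(1)] by blast
  interpret semi_invariant_fusion S p F d
  proof (intro semi_invariant_fusion.intro semi_invariant_fusion_axioms.intro assms(3))
    show "odd p" by fact
    show "0 < d" using D(2) d by (cases d) auto
    show "p ^ d < order S" using D(3) d by simp
    fix H assume H: "subgroup H S" "card H = p ^ d"
    show "comm_group (S\<lparr>carrier := H\<rparr>)" using D(4)[of H] H d by auto
    show "semi_invariant S F H" using D(4)[of H] H d by auto
  qed
  show ?thesis by (rule supersolvable_fusion)
qed

end
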